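(* Let $n\ge 1$ be an integer, let $\mathcal{C}$ be an abelian category with enough injectives, and let $\mathcal{A}$ and $\mathcal{B}$ be two classes of objects of $\mathcal{C}$ such that $\mathcal{B}$ contains all injective objects of $\mathcal{C}$. Then $\mathrm{Ext}^1_{\mathcal{C}}(\mathcal{A},\mathcal{B}^\wedge_{n-1})=0$ if, and only if, $\mathrm{Ext}^i_{\mathcal{C}}(\mathcal{A},\mathcal{B})=0$ for every $1\le i\le n$. In particular, $(\mathcal{A},\mathcal{B}^\wedge_{n-1})$ is a complete left cotorsion pair in $\mathcal{C}$ if, and only if, $(\mathcal{A},\mathcal{B})$ is a left $n$-cotorsion pair in $\mathcal{C}$.
   Context: $\mathrm{Ext}^i_{\mathcal{C}}$ denotes Yoneda Ext; $\mathrm{Ext}^i_{\mathcal{C}}(\mathcal{A},\mathcal{B})=0$ means $\mathrm{Ext}^i_{\mathcal{C}}(A,B)=0$ for all $A\in\mathcal{A}$, $B\in\mathcal{B}$. ${}^{\perp_i}\mathcal{B}=\{X:\mathrm{Ext}^i_{\mathcal{C}}(X,\mathcal{B})=0\}$. $\mathcal{B}^\wedge_m$ is the class of objects $C$ admitting an exact sequence $0\to B_m\to\cdots\to B_0\to C\to 0$ of length at most $m$ with all terms $B_k\in\mathcal{B}$ (i.e. $\mathcal{B}$-resolution dimension $\le m$). An $\mathcal{A}$-precover of $C$ is a morphism $f:A\to C$ with $A\in\mathcal{A}$ through which every morphism $A'\to C$ with $A'\in\mathcal{A}$ factors. Complete left cotorsion pair $(\mathcal{A},\mathcal{B})$: $\mathcal{A}={}^{\perp_1}\mathcal{B}$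 and every object of $\mathcal{C}$ has an epic $\mathcal{A}$-precover with kernel in $\mathcal{B}$. Left $n$-cotorsion pair $(\mathcal{A},\mathcal{B})$: (1) $\mathcal{A}$ is closed under direct summands; (2) $\mathrm{Ext}^i_{\mathcal{C}}(\mathcal{A},\mathcal{B})=0$ for $1\le i\le n$; (3) for every $C\in\mathcal{C}$ there is a short exact sequence $0\to K\to A\to C\to 0$ with $A\in\mathcal{A}$ and $K\in\mathcal{B}^\wedge_{n-1}$. *)

theory Defs
  imports "HOL-Algebra.Group"
begin

section \<open>Abelian categories\<close>

text \<open>
  A category carrying an additive structure on its hom-sets. Composition is written in
  applicative order; \<open>Comp\<close> and \<open>Add\<close> are only meaningful on composable, respectively
  parallel, arrows.
\<close>

record ('o, 'a) precat =
  Obj :: "'o set"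
  Arr :: "'a set"
  Dom :: "'a \<Rightarrow> 'o"
  Cod :: "'a \<Rightarrow> 'o"
  Id :: "'o \<Rightarrow> 'a"
  Comp :: "'a \<Rightarrow> 'a \<Rightarrow> 'a"  (infixl \<open>\<cdot>\<index>\<close> 70)
  Add :: "'a \<Rightarrow> 'a \<Rightarrow> 'a"
  Zero :: "'o \<Rightarrow> 'o \<Rightarrow> 'a"

definition Hom :: "('o, 'a, 'm) precat_scheme \<Rightarrow> 'o \<Rightarrow> 'o \<Rightarrow> 'a set" where
  "Hom C X Y = {f \<in> Arr C. Dom C f = X \<and> Cod C f = Y}"

definition hom_group :: "('o, 'a, 'm) precat_scheme \<Rightarrow> 'o \<Rightarrow> 'o \<Rightarrow> 'a monoid" where
  "hom_group C X Y = \<lparr>carrier = Hom C X Y, monoid.mult = Add C, one = Zero C X Y\<rparr>"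

locale category =
  fixes C :: "('o, 'a, 'm) precat_scheme" (structure)
  assumes Dom_Obj: "f \<in> Arr C \<Longrightarrow> Dom C f \<in> Obj C"
    and Cod_Obj: "f \<in> Arr C \<Longrightarrow> Cod C f \<in> Obj C"
    and Id_Hom: "X \<in> Obj C \<Longrightarrow> Id C X \<in> Hom C X X"
    and Comp_Hom: "\<lbrakk>f \<in> Hom C X Y; g \<in> Hom C Y Z\<rbrakk> \<Longrightarrow> g \<cdot> f \<in> Hom C X Z"
    and Comp_Id_right: "f \<in> Hom C X Y \<Longrightarrow> f \<cdot> Id C X = f"
    and Comp_Id_left: "f \<in> Hom C X Y \<Longrightarrow> Id C Y \<cdot> f = f"
    and Comp_assoc: "\<lbrakk>f \<in> Hom C W X; g \<in> Hom C X Y; h \<in> Hom C Y Z\<rbrakk>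
      \<Longrightarrow> h \<cdot> (g \<cdot> f) = (h \<cdot> g) \<cdot> f"

locale preadditive_category = category +
  assumes hom_comm_group:
      "\<lbrakk>X \<in> Obj C; Y \<in> Obj C\<rbrakk> \<Longrightarrow> comm_group (hom_group C X Y)"
    and Comp_Add_right: "\<lbrakk>f \<in> Hom C X Y; f' \<in> Hom C X Y; g \<in> Hom C Y Z\<rbrakk>
      \<Longrightarrow> g \<cdot> Add C f f' = Add C (g \<cdot> f) (g \<cdot> f')"
    and Comp_Add_left: "\<lbrakk>f \<in> Hom C X Y; g \<in> Hom C Y Z; g' \<in> Hom C Y Z\<rbrakk>
      \<Longrightarrow> Add C g g' \<cdot> f = Add C (g \<cdot> f) (g' \<cdot> f)"

definition is_zero_object :: "('o, 'a, 'm) precat_scheme \<Rightarrow> 'o \<Rightarrow> bool" where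
  "is_zero_object C Z \<longleftrightarrow> Z \<in> Obj C \<and>
     (\<forall>X\<in>Obj C. (\<exists>!f. f \<in> Hom C X Z) \<and> (\<exists>!f. f \<in> Hom C Z X))"

definition is_biproduct ::
  "('o, 'a, 'm) precat_scheme \<Rightarrow> 'o \<Rightarrow> 'o \<Rightarrow> 'o \<Rightarrow> 'a \<Rightarrow> 'a \<Rightarrow> 'a \<Rightarrow> 'a \<Rightarrow> bool" where
  "is_biproduct C X Y P i1 i2 p1 p2 \<longleftrightarrow>
     i1 \<in> Hom C X P \<and> i2 \<in> Hom C Y P \<and> p1 \<in> Hom C P X \<and> p2 \<in> Hom C P Y \<and>
     p1 \<cdot>\<^bsub>C\<^esub> i1 = Id C X \<and> p2 \<cdot>\<^bsub>C\<^esub> i2 = Id C Y \<and>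
     p1 \<cdot>\<^bsub>C\<^esub> i2 = Zero C Y X \<and> p2 \<cdot>\<^bsub>C\<^esub> i1 = Zero C X Y \<and>
     Add C (i1 \<cdot>\<^bsub>C\<^esub> p1) (i2 \<cdot>\<^bsub>C\<^esub> p2) = Id C P"

definition monic :: "('o, 'a, 'm) precat_scheme \<Rightarrow> 'a \<Rightarrow> bool" where
  "monic C f \<longleftrightarrow> f \<in> Arr C \<and>
     (\<forall>W. \<forall>g\<in>Hom C W (Dom C f). \<forall>h\<in>Hom C W (Dom C f).
        f \<cdot>\<^bsub>C\<^esub> g = f \<cdot>\<^bsub>C\<^esub> h \<longrightarrow> g = h)"

definition epic :: "('o, 'a, 'm) precat_scheme \<Rightarrow> 'a \<Rightarrow> bool" where
  "epic C f \<longleftrightarrow> f \<in> Arr C \<and>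
     (\<forall>W. \<forall>g\<in>Hom C (Cod C f) W. \<forall>h\<in>Hom C (Cod C f) W.
        g \<cdot>\<^bsub>C\<^esub> f = h \<cdot>\<^bsub>C\<^esub> f \<longrightarrow> g = h)"

definition is_kernel :: "('o, 'a, 'm) precat_scheme \<Rightarrow> 'a \<Rightarrow> 'a \<Rightarrow> bool" where
  "is_kernel C k f \<longleftrightarrow> k \<in> Arr C \<and> f \<in> Arr C \<and> Cod C k = Dom C f \<and>
     f \<cdot>\<^bsub>C\<^esub> k = Zero C (Dom C k) (Cod C f) \<and>
     (\<forall>W. \<forall>g\<in>Hom C W (Dom C f). f \<cdot>\<^bsub>C\<^esub> g = Zero C W (Cod C f) \<longrightarrow>
        (\<exists>!u. u \<in> Hom C W (Dom C k) \<and> k \<cdot>\<^bsub>C\<^esub> u = g))"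

definition is_cokernel :: "('o, 'a, 'm) precat_scheme \<Rightarrow> 'a \<Rightarrow> 'a \<Rightarrow> bool" where
  "is_cokernel C c f \<longleftrightarrow> c \<in> Arr C \<and> f \<in> Arr C \<and> Dom C c = Cod C f \<and>
     c \<cdot>\<^bsub>C\<^esub> f = Zero C (Dom C f) (Cod C c) \<and>
     (\<forall>W. \<forall>g\<in>Hom C (Cod C f) W. g \<cdot>\<^bsub>C\<^esub> f = Zero C (Dom C f) W \<longrightarrow>
        (\<exists>!u. u \<in> Hom C (Cod C c) W \<and> u \<cdot>\<^bsub>C\<^esub> c = g))"

locale abelian_category = preadditive_category +
  assumes ex_zero_object: "\<exists>Z. is_zero_object C Z"
    and ex_biproduct: "\<lbrakk>X \<in> Obj C; Y \<in> Obj C\<rbrakk>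
      \<Longrightarrow> \<exists>P i1 i2 p1 p2. is_biproduct C X Y P i1 i2 p1 p2"
    and ex_kernel: "f \<in> Arr C \<Longrightarrow> \<exists>k. is_kernel C k f"
    and ex_cokernel: "f \<in> Arr C \<Longrightarrow> \<exists>c. is_cokernel C c f"
    and monic_normal: "monic C f \<Longrightarrow> \<exists>g. is_kernel C f g"
    and epic_normal: "epic C f \<Longrightarrow> \<exists>g. is_cokernel C f g"

definition injective_object :: "('o, 'a, 'm) precat_scheme \<Rightarrow> 'o \<Rightarrow> bool" where
  "injective_object C I \<longleftrightarrow> I \<in> Obj C \<and>
     (\<forall>m f. monic C m \<and> f \<in> Hom C (Dom C m) I \<longrightarrow>
        (\<exists>g\<in>Hom C (Cod C m) I. g \<cdot>\<^bsub>C\<^esub> m = f))"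

definition enough_injectives :: "('o, 'a, 'm) precat_scheme \<Rightarrow> bool" where
  "enough_injectives C \<longleftrightarrow>
     (\<forall>X\<in>Obj C. \<exists>m I. injective_object C I \<and> m \<in> Hom C X I \<and> monic C m)"


section \<open>Exact sequences\<close>

definition is_image :: "('o, 'a, 'm) precat_scheme \<Rightarrow> 'a \<Rightarrow> 'a \<Rightarrow> bool" where
  "is_image C m f \<longleftrightarrow> (\<exists>c. is_cokernel C c f \<and> is_kernel C m c)"

definition exact_at :: "('o, 'a, 'm) precat_scheme \<Rightarrow> 'a \<Rightarrow> 'a \<Rightarrow> bool" where
  "exact_at C f g \<longleftrightarrow> (\<exists>m. is_image C m f \<and> is_kernel C m g)"

text \<open>
  A list \<open>[f\<^sub>0, \<dots>, f\<^sub>k]\<close> of arrows encodes the sequence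
  \<open>0 \<rightarrow> X\<^sub>0 \<rightarrow> X\<^sub>1 \<rightarrow> \<dots> \<rightarrow> X\<^sub>k\<^sub>+\<^sub>1 \<rightarrow> 0\<close>, where \<open>f\<^sub>j : X\<^sub>j \<rightarrow> X\<^sub>j\<^sub>+\<^sub>1\<close>. Exactness at the two ends is
  monicity of the first and epicity of the last arrow; composability of consecutive arrows
  is part of \<open>exact_at\<close>. A one-element list is an isomorphism.
\<close>

definition exact_sequence :: "('o, 'a, 'm) precat_scheme \<Rightarrow> 'a list \<Rightarrow> bool" where
  "exact_sequence C fs \<longleftrightarrow> fs \<noteq> [] \<and> monic C (hd fs) \<and> epic C (last fs) \<and>
     (\<forall>j. Suc j < length fs \<longrightarrow> exact_at C (fs ! j) (fs ! Suc j))"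


section \<open>Yoneda Ext\<close>

definition extensions :: "('o, 'a, 'm) precat_scheme \<Rightarrow> nat \<Rightarrow> 'o \<Rightarrow> 'o \<Rightarrow> 'a list set" where
  "extensions C i X Y = {fs. exact_sequence C fs \<and> length fs = Suc i \<and>
     Dom C (hd fs) = Y \<and> Cod C (last fs) = X}"

text \<open>
  Morphisms of extensions that are the identity on both ends; \<open>h j\<close> is the vertical arrow at
  the object \<open>X\<^sub>j\<close>, so that \<open>h 0\<close> sits at \<open>Y\<close> and \<open>h (Suc i)\<close> at \<open>X\<close>.
\<close>

definition ext_morphism_rel ::
  "('o, 'a, 'm) precat_scheme \<Rightarrow> nat \<Rightarrow> 'o \<Rightarrow> 'o \<Rightarrow> ('a list \<times> 'a list) set" where
  "ext_morphism_rel C i X Y =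
     {(fs, gs). fs \<in> extensions C i X Y \<and> gs \<in> extensions C i X Y \<and>
        (\<exists>h. h 0 = Id C Y \<and> h (Suc i) = Id C X \<and>
           (\<forall>j\<le>i. h j \<in> Hom C (Dom C (fs ! j)) (Dom C (gs ! j)) \<and>
              h (Suc j) \<cdot>\<^bsub>C\<^esub> (fs ! j) = (gs ! j) \<cdot>\<^bsub>C\<^esub> h j))}"

definition yoneda_rel ::
  "('o, 'a, 'm) precat_scheme \<Rightarrow> nat \<Rightarrow> 'o \<Rightarrow> 'o \<Rightarrow> ('a list \<times> 'a list) set" where
  "yoneda_rel C i X Y = (ext_morphism_rel C i X Y \<union> (ext_morphism_rel C i X Y)\<inverse>)\<^sup>*"

text \<open>The Yoneda Ext of \<open>X\<close> by \<open>Y\<close> in degree \<open>i \<ge> 1\<close>, as a set of equivalence classes.\<close>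

definition yoneda_ext ::
  "('o, 'a, 'm) precat_scheme \<Rightarrow> nat \<Rightarrow> 'o \<Rightarrow> 'o \<Rightarrow> 'a list set set" where
  "yoneda_ext C i X Y = extensions C i X Y // yoneda_rel C i X Y"

text \<open>
  The extensions representing the neutral element of the Baer sum: \<open>0 \<rightarrow> Y \<rightarrow> Y \<oplus> X \<rightarrow> X \<rightarrow> 0\<close> in
  degree 1, and \<open>0 \<rightarrow> Y \<rightarrow> Y \<rightarrow> 0 \<rightarrow> \<dots> \<rightarrow> 0 \<rightarrow> X \<rightarrow> X \<rightarrow> 0\<close>, with identities at the two ends, in
  higher degrees. In the latter case exactness forces the intermediate objects to be zero
  once the intermediate arrows are.
\<close>

definition trivial_extension ::
  "('o, 'a, 'm) precat_scheme \<Rightarrow> nat \<Rightarrow> 'o \<Rightarrow> 'o \<Rightarrow> 'a list \<Rightarrow> bool" where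
  "trivial_extension C i X Y fs \<longleftrightarrow> fs \<in> extensions C i X Y \<and>
     (if i = 1
      then \<exists>P i2 p1. is_biproduct C Y X P (fs ! 0) i2 p1 (fs ! 1)
      else fs ! 0 = Id C Y \<and> fs ! i = Id C X \<and>
        (\<forall>j. 0 < j \<and> j < i \<longrightarrow> fs ! j = Zero C (Dom C (fs ! j)) (Cod C (fs ! j))))"

definition yoneda_zero :: "('o, 'a, 'm) precat_scheme \<Rightarrow> nat \<Rightarrow> 'o \<Rightarrow> 'o \<Rightarrow> 'a list set" where
  "yoneda_zero C i X Y = yoneda_rel C i X Y `` {fs. trivial_extension C i X Y fs}"

definition ext_vanishes ::
  "('o, 'a, 'm) precat_scheme \<Rightarrow> nat \<Rightarrow> 'o set \<Rightarrow> 'o set \<Rightarrow> bool" where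
  "ext_vanishes C i \<A> \<B> \<longleftrightarrow>
     (\<forall>X\<in>\<A>. \<forall>Y\<in>\<B>. yoneda_ext C i X Y = {yoneda_zero C i X Y})"

definition left_perp :: "('o, 'a, 'm) precat_scheme \<Rightarrow> nat \<Rightarrow> 'o set \<Rightarrow> 'o set" where
  "left_perp C i \<B> = {X \<in> Obj C. ext_vanishes C i {X} \<B>}"


section \<open>Resolution dimension and cotorsion pairs\<close>

text \<open>
  Objects \<open>X\<close> with an exact sequence \<open>0 \<rightarrow> B\<^sub>k \<rightarrow> \<dots> \<rightarrow> B\<^sub>0 \<rightarrow> X \<rightarrow> 0\<close>, \<open>k \<le> m\<close>, all \<open>B\<^sub>j\<close> in the class;
  the \<open>B\<^sub>j\<close> are the domains of the \<open>k + 1\<close> arrows.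
\<close>

definition resolution_class ::
  "('o, 'a, 'm) precat_scheme \<Rightarrow> 'o set \<Rightarrow> nat \<Rightarrow> 'o set" where
  "resolution_class C \<B> m = {X. \<exists>fs. exact_sequence C fs \<and> length fs \<le> Suc m \<and>
     (\<forall>f\<in>set fs. Dom C f \<in> \<B>) \<and> Cod C (last fs) = X}"

definition is_precover :: "('o, 'a, 'm) precat_scheme \<Rightarrow> 'o set \<Rightarrow> 'o \<Rightarrow> 'a \<Rightarrow> bool" where
  "is_precover C \<A> X f \<longleftrightarrow> f \<in> Arr C \<and> Dom C f \<in> \<A> \<and> Cod C f = X \<and>
     (\<forall>A'\<in>\<A>. \<forall>g\<in>Hom C A' X. \<exists>h\<in>Hom C A' (Dom C f). f \<cdot>\<^bsub>C\<^esub> h = g)"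

definition complete_left_cotorsion_pair ::
  "('o, 'a, 'm) precat_scheme \<Rightarrow> 'o set \<Rightarrow> 'o set \<Rightarrow> bool" where
  "complete_left_cotorsion_pair C \<A> \<B> \<longleftrightarrow> \<A> = left_perp C 1 \<B> \<and>
     (\<forall>X\<in>Obj C. \<exists>f k. is_precover C \<A> X f \<and> epic C f \<and> is_kernel C k f \<and> Dom C k \<in> \<B>)"

definition closed_under_summands :: "('o, 'a, 'm) precat_scheme \<Rightarrow> 'o set \<Rightarrow> bool" where
  "closed_under_summands C \<A> \<longleftrightarrow>
     (\<forall>A\<in>\<A>. \<forall>X Y i1 i2 p1 p2. X \<in> Obj C \<and> Y \<in> Obj C \<and>
        is_biproduct C X Y A i1 i2 p1 p2 \<longrightarrow> X \<in> \<A>)"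

definition left_n_cotorsion_pair ::
  "('o, 'a, 'm) precat_scheme \<Rightarrow> nat \<Rightarrow> 'o set \<Rightarrow> 'o set \<Rightarrow> bool" where
  "left_n_cotorsion_pair C n \<A> \<B> \<longleftrightarrow>
     closed_under_summands C \<A> \<and>
     (\<forall>i\<in>{1..n}. ext_vanishes C i \<A> \<B>) \<and>
     (\<forall>X\<in>Obj C. \<exists>k p. exact_sequence C [k, p] \<and>
        Dom C k \<in> resolution_class C \<B> (n - 1) \<and> Dom C p \<in> \<A> \<and> Cod C p = X)"

end

theory Submission
  imports Defs
begin

text \<open>
  Let \<open>0 \<rightarrow> Y \<rightarrow> I\<^sub>1 \<rightarrow> \<dots> \<rightarrow> I\<^sub>i \<rightarrow> S \<rightarrow> 0\<close> be exact with all \<open>I\<^sub>j\<close> injective and \<open>i \<ge> 1\<close>. Comparing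
  extensions with this coresolution shows that the Yoneda group in degree \<open>i\<close> of \<open>X\<close> by \<open>Y\<close> vanishes
  if and only if every map \<open>X \<rightarrow> S\<close> lifts to \<open>I\<^sub>i\<close>. Hence it vanishes exactly if the
  group in degree 1 of \<open>X\<close> by the \<open>(i - 1)\<close>-st cosyzygy of \<open>Y\<close> does. For \<open>Y\<close> in \<open>\<B>\<close> that cosyzygy is resolved by \<open>Y\<close> and
  injectives, which lie in \<open>\<B>\<close>; this gives one implication. The other one is dimension shifting along
  a \<open>\<B>\<close>-resolution. The statement on cotorsion pairs follows since a short exact sequence ending in
  an object of the left orthogonal class, with kernel in the right class, splits.
\<close>

text \<open>Vanishing concerns a quotient by zigzags of morphisms, so it is not clear that one
  diagram can detect it. The way out is a property of single extensions, \<open>null\<close>, that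
  is constant along zigzags: a comparison map into an injective coresolution ends in an arrow that
  factors through its last epimorphism. Trivial extensions have it. Conversely, an extension that
  has it maps to one whose last arrow splits, and the trivial extensions map to that one as well.
  Pullback shows that every arrow into the cosyzygy occurs as an end.

  From there on, only liftings of arrows along epimorphisms are used; neither Baer sums nor
  connecting homomorphisms are constructed. Dimension shifting needs two fragments of the long exact
  sequence, and these come from rotation: for \<open>Y\<close> inside \<open>Z\<close> inside an
  injective \<open>I\<close>, the object \<open>Z / Y\<close> embeds into \<open>I / Y\<close> with
  quotient \<open>I / Z\<close>, and all Ext groups involved are tested by the projections from
  \<open>I\<close>. Diagram chases treat arrows into an object as generalized elements, which lift
  along an epimorphism after restriction along another one.\<close>

lemma HomD:
  assumes "f \<in> Hom C X Y"
  shows "f \<in> Arr C" "Dom C f = X" "Cod C f = Y"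
  using assms by (auto simp: Hom_def)

section \<open>Preadditive categories\<close>

context category
begin

lemma Comp_Arr:
  assumes "f \<in> Arr C" "g \<in> Arr C" "Cod C f = Dom C g"
  shows "g \<cdot> f \<in> Arr C" "Dom C (g \<cdot> f) = Dom C f" "Cod C (g \<cdot> f) = Cod C g"
  using Comp_Hom[of f "Dom C f" "Cod C f" g "Cod C g"] assms by (auto simp: Hom_def)

lemma Id_Arr:
  assumes "X \<in> Obj C"
  shows "Id C X \<in> Arr C" "Dom C (Id C X) = X" "Cod C (Id C X) = X"
  using Id_Hom[OF assms] by (auto simp: Hom_def)

lemma Comp_Arr_assoc:
  assumes "f \<in> Arr C" "g \<in> Arr C" "h \<in> Arr C" "Cod C f = Dom C g" "Cod C g = Dom C h"
  shows "(h \<cdot> g) \<cdot> f = h \<cdot> (g \<cdot> f)"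
  using Comp_assoc[of f "Dom C f" "Cod C f" g "Cod C g" h "Cod C h"] assms by (auto simp: Hom_def)

lemma Comp_Id_Arr:
  assumes "f \<in> Arr C"
  shows "Dom C f = X \<Longrightarrow> f \<cdot> Id C X = f" "Cod C f = X \<Longrightarrow> Id C X \<cdot> f = f"
  using Comp_Id_right[of f "Dom C f" "Cod C f"] Comp_Id_left[of f "Dom C f" "Cod C f"] assms
  by (auto simp: Hom_def)

lemmas arr_simps = Dom_Obj Cod_Obj Comp_Arr Id_Arr Comp_Arr_assoc Comp_Id_Arr

lemma monic_cancel:
  "monic C f \<Longrightarrow> g \<in> Hom C W (Dom C f) \<Longrightarrow> h \<in> Hom C W (Dom C f) \<Longrightarrow> f \<cdot> g = f \<cdot> h \<Longrightarrow> g = h"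
  unfolding monic_def by blast

lemma epic_cancel:
  "epic C f \<Longrightarrow> g \<in> Hom C (Cod C f) W \<Longrightarrow> h \<in> Hom C (Cod C f) W \<Longrightarrow> g \<cdot> f = h \<cdot> f \<Longrightarrow> g = h"
  unfolding epic_def by blast

lemma monic_Id: "X \<in> Obj C \<Longrightarrow> monic C (Id C X)"
  unfolding monic_def by (auto simp: Id_Arr Comp_Id_left)

lemma epic_Id: "X \<in> Obj C \<Longrightarrow> epic C (Id C X)"
  unfolding epic_def by (auto simp: Id_Arr Comp_Id_right)

lemma monic_Comp:
  assumes "monic C f" "monic C g" "Cod C f = Dom C g"
  shows "monic C (g \<cdot> f)"
  unfolding monic_def
proof safe
  have [simp]: "f \<in> Arr C" "g \<in> Arr C"
    using assms by (auto simp: monic_def)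
  show "g \<cdot> f \<in> Arr C"
    using assms by (simp add: arr_simps)
  fix W x y
  assume x: "x \<in> Hom C W (Dom C (g \<cdot> f))" and y: "y \<in> Hom C W (Dom C (g \<cdot> f))"
    and eq: "(g \<cdot> f) \<cdot> x = (g \<cdot> f) \<cdot> y"
  have xy: "x \<in> Hom C W (Dom C f)" "y \<in> Hom C W (Dom C f)"
    using x y assms by (auto simp: arr_simps)
  have "g \<cdot> (f \<cdot> x) = g \<cdot> (f \<cdot> y)"
    using eq xy assms by (simp add: arr_simps Hom_def)
  then have "f \<cdot> x = f \<cdot> y"
    using monic_cancel[OF assms(2)] xy assms(3) by (auto simp: arr_simps Hom_def)
  then show "x = y"
    using monic_cancel[OF assms(1)] xy by blast
qed

lemma epic_Comp:
  assumes "epic C f" "epic C g" "Cod C f = Dom C g"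
  shows "epic C (g \<cdot> f)"
  unfolding epic_def
proof safe
  have [simp]: "f \<in> Arr C" "g \<in> Arr C"
    using assms by (auto simp: epic_def)
  show "g \<cdot> f \<in> Arr C"
    using assms by (simp add: arr_simps)
  fix W x y
  assume x: "x \<in> Hom C (Cod C (g \<cdot> f)) W" and y: "y \<in> Hom C (Cod C (g \<cdot> f)) W"
    and eq: "x \<cdot> (g \<cdot> f) = y \<cdot> (g \<cdot> f)"
  have xy: "x \<in> Hom C (Cod C g) W" "y \<in> Hom C (Cod C g) W"
    using x y assms by (auto simp: arr_simps)
  have "(x \<cdot> g) \<cdot> f = (y \<cdot> g) \<cdot> f"
    using eq xy assms by (simp add: arr_simps Hom_def)
  then have "x \<cdot> g = y \<cdot> g"
    using epic_cancel[OF assms(1)] xy assms(3) by (auto simp: arr_simps Hom_def)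
  then show "x = y"
    using epic_cancel[OF assms(2)] xy by blast
qed

end

section \<open>Differences and zero arrows\<close>

context preadditive_category
begin

text \<open>The inverse is taken in the hom-group named by the second arrow, so that differences
  carry no object parameters.\<close>

definition Sub :: "'b \<Rightarrow> 'b \<Rightarrow> 'b" where
  "Sub f g = Add C f (m_inv (hom_group C (Dom C g) (Cod C g)) g)"

lemma Hom_Obj: "f \<in> Hom C X Y \<Longrightarrow> X \<in> Obj C \<and> Y \<in> Obj C"
  by (auto simp: Hom_def Dom_Obj Cod_Obj)

lemma hom_group_simps:
  "carrier (hom_group C X Y) = Hom C X Y"
  "monoid.mult (hom_group C X Y) = Add C"
  "one (hom_group C X Y) = Zero C X Y"
  by (simp_all add: hom_group_def)

lemma hom_group: "X \<in> Obj C \<Longrightarrow> Y \<in> Obj C \<Longrightarrow> group (hom_group C X Y)"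
  using hom_comm_group comm_group.axioms(2) by blast

lemma Zero_Hom: "X \<in> Obj C \<Longrightarrow> Y \<in> Obj C \<Longrightarrow> Zero C X Y \<in> Hom C X Y"
  using monoid.one_closed[OF group.is_monoid[OF hom_group]] by (simp add: hom_group_simps)

lemma Add_Hom: "f \<in> Hom C X Y \<Longrightarrow> g \<in> Hom C X Y \<Longrightarrow> Add C f g \<in> Hom C X Y"
  using monoid.m_closed[OF group.is_monoid[OF hom_group], of X Y f g] Hom_Obj[of f X Y]
  by (simp add: hom_group_simps)

lemma Sub_Hom: "f \<in> Hom C X Y \<Longrightarrow> g \<in> Hom C X Y \<Longrightarrow> Sub f g \<in> Hom C X Y"
  using group.inv_closed[OF hom_group, of X Y g] Hom_Obj[of f X Y]
  by (simp add: Sub_def hom_group_simps Add_Hom HomD)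

lemma Add_Zero: 
  assumes "f \<in> Hom C X Y"
  shows "Add C f (Zero C X Y) = f" "Add C (Zero C X Y) f = f"
  using monoid.r_one[OF group.is_monoid[OF hom_group], of X Y f]
    monoid.l_one[OF group.is_monoid[OF hom_group], of X Y f] Hom_Obj[OF assms] assms
  by (simp_all add: hom_group_simps)

lemma Add_commute: "f \<in> Hom C X Y \<Longrightarrow> g \<in> Hom C X Y \<Longrightarrow> Add C f g = Add C g f"
  using comm_monoid.m_comm[OF comm_group.axioms(1)[OF hom_comm_group], of X Y f g] Hom_Obj[of f X Y]
  by (simp add: hom_group_simps)

lemma Sub_Add: "f \<in> Hom C X Y \<Longrightarrow> g \<in> Hom C X Y \<Longrightarrow> Add C (Sub f g) g = f"
  using group.inv_closed[OF hom_group, of X Y g] Hom_Obj[of f X Y]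
    monoid.m_assoc[OF group.is_monoid[OF hom_group], of X Y f "m_inv (hom_group C X Y) g" g]
    group.l_inv[OF hom_group, of X Y g]
  by (simp add: Sub_def hom_group_simps HomD Add_Zero)

lemma Add_right_cancel:
  assumes "f \<in> Hom C X Y" "g \<in> Hom C X Y" "h \<in> Hom C X Y" "Add C f h = Add C g h"
  shows "f = g"
  using group.right_cancel[OF hom_group, of X Y h f g] Hom_Obj[of f X Y] assms
  by (simp add: hom_group_simps)

text \<open>Determines a difference by an equation between sums, so that its compatibility with
  composition follows from distributivity without computing inverses.\<close>

lemma Sub_unique:
  assumes "f \<in> Hom C X Y" "g \<in> Hom C X Y" "h \<in> Hom C X Y" "Add C h g = f"
  shows "h = Sub f g"
  using Add_right_cancel[of h X Y "Sub f g" g] Sub_Hom Sub_Add assms by simp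

lemma Comp_Sub:
  assumes "f \<in> Hom C X Y" "f' \<in> Hom C X Y" "g \<in> Hom C Y Z"
  shows "g \<cdot> Sub f f' = Sub (g \<cdot> f) (g \<cdot> f')"
  by (rule Sub_unique[where X=X and Y=Z])
    (use assms Sub_Add[of f X Y f'] Comp_Add_right[of "Sub f f'" X Y f' g Z, symmetric] Sub_Hom[of f X Y f'] in \<open>auto intro: Comp_Hom\<close>)

lemma Sub_Comp:
  assumes "f \<in> Hom C X Y" "g \<in> Hom C Y Z" "g' \<in> Hom C Y Z"
  shows "Sub g g' \<cdot> f = Sub (g \<cdot> f) (g' \<cdot> f)"
  by (rule Sub_unique[where X=X and Y=Z])
    (use assms Sub_Add[of g Y Z g'] Comp_Add_left[of f X Y "Sub g g'" Z g', symmetric] Sub_Hom[of g Y Z g'] in \<open>auto intro: Comp_Hom\<close>)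

lemma Sub_eq_Zero:
  assumes "f \<in> Hom C X Y" "g \<in> Hom C X Y"
  shows "Sub f g = Zero C X Y \<longleftrightarrow> f = g"
  using Sub_Add[OF assms] Add_Zero[OF assms(2)] assms Sub_unique[OF assms(1,2) Zero_Hom] Hom_Obj
  by metis

text \<open>Zero is the difference of an arrow with itself, and composition commutes with
  differences.\<close>

lemma Comp_Zero:
  assumes "f \<in> Hom C X Y"
  shows "W \<in> Obj C \<Longrightarrow> f \<cdot> Zero C W X = Zero C W Y"
    and "Z \<in> Obj C \<Longrightarrow> Zero C Y Z \<cdot> f = Zero C X Z"
proof -
  have O: "X \<in> Obj C" "Y \<in> Obj C"
    using Hom_Obj[OF assms] by auto
  show "f \<cdot> Zero C W X = Zero C W Y" if W: "W \<in> Obj C"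
    using Comp_Sub[OF Zero_Hom[OF W O(1)] Zero_Hom[OF W O(1)] assms]
      Sub_eq_Zero[OF Zero_Hom[OF W O(1)] Zero_Hom[OF W O(1)]]
      Sub_eq_Zero[OF Comp_Hom[OF Zero_Hom[OF W O(1)] assms] Comp_Hom[OF Zero_Hom[OF W O(1)] assms]]
    by metis
  show "Zero C Y Z \<cdot> f = Zero C X Z" if Z: "Z \<in> Obj C"
    using Sub_Comp[OF assms Zero_Hom[OF O(2) Z] Zero_Hom[OF O(2) Z]]
      Sub_eq_Zero[OF Zero_Hom[OF O(2) Z] Zero_Hom[OF O(2) Z]]
      Sub_eq_Zero[OF Comp_Hom[OF assms Zero_Hom[OF O(2) Z]] Comp_Hom[OF assms Zero_Hom[OF O(2) Z]]]
    by metis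
qed

lemma Zero_Arr:
  assumes "X \<in> Obj C" "Y \<in> Obj C"
  shows "Zero C X Y \<in> Arr C" "Dom C (Zero C X Y) = X" "Cod C (Zero C X Y) = Y"
  using Zero_Hom[OF assms] by (auto simp: Hom_def)

lemma Comp_Zero_Arr:
  assumes "f \<in> Arr C"
  shows "W \<in> Obj C \<Longrightarrow> Dom C f = X \<Longrightarrow> f \<cdot> Zero C W X = Zero C W (Cod C f)"
    and "Z \<in> Obj C \<Longrightarrow> Cod C f = X \<Longrightarrow> Zero C X Z \<cdot> f = Zero C (Dom C f) Z"
  using Comp_Zero[of f "Dom C f" "Cod C f"] assms by (auto simp: Hom_def)

text \<open>Applied to the difference of two arrows with the same composite.\<close>

lemma monicI:
  assumes "f \<in> Hom C X Y" "\<And>W x. x \<in> Hom C W X \<Longrightarrow> f \<cdot> x = Zero C W Y \<Longrightarrow> x = Zero C W X"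
  shows "monic C f"
  unfolding monic_def
proof safe
  show "f \<in> Arr C" using assms by (simp add: HomD)
  fix W x y
  assume "x \<in> Hom C W (Dom C f)" "y \<in> Hom C W (Dom C f)" and eq: "f \<cdot> x = f \<cdot> y"
  then have xy: "x \<in> Hom C W X" "y \<in> Hom C W X"
    using assms by (auto simp: HomD)
  have "f \<cdot> Sub x y = Zero C W Y"
    using Comp_Sub[OF xy assms(1)] Sub_eq_Zero[of "f \<cdot> x" W Y "f \<cdot> y"] eq Comp_Hom[OF _ assms(1)] xy
    by auto
  then show "x = y"
    using assms(2)[OF Sub_Hom[OF xy]] Sub_eq_Zero[OF xy] by simp
qed

lemma epicI:
  assumes "f \<in> Hom C X Y" "\<And>W x. x \<in> Hom C Y W \<Longrightarrow> x \<cdot> f = Zero C X W \<Longrightarrow> x = Zero C Y W"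
  shows "epic C f"
  unfolding epic_def
proof safe
  show "f \<in> Arr C" using assms by (simp add: HomD)
  fix W x y
  assume "x \<in> Hom C (Cod C f) W" "y \<in> Hom C (Cod C f) W" and eq: "x \<cdot> f = y \<cdot> f"
  then have xy: "x \<in> Hom C Y W" "y \<in> Hom C Y W"
    using assms by (auto simp: HomD)
  have "Sub x y \<cdot> f = Zero C X W"
    using Sub_Comp[OF assms(1) xy] Sub_eq_Zero[of "x \<cdot> f" X W "y \<cdot> f"] eq Comp_Hom[OF assms(1)] xy
    by auto
  then show "x = y"
    using assms(2)[OF Sub_Hom[OF xy]] Sub_eq_Zero[OF xy] by simp
qed

lemma monic_Zero:
  assumes "monic C f" "x \<in> Hom C W (Dom C f)" "f \<cdot> x = Zero C W (Cod C f)"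
  shows "x = Zero C W (Dom C f)"
proof -
  have "f \<in> Hom C (Dom C f) (Cod C f)" using assms by (auto simp: monic_def Hom_def)
  then show ?thesis
  using monic_cancel[OF assms(1,2) Zero_Hom] assms Comp_Zero(1)[of f] Hom_Obj by metis
qed

lemma epic_Zero:
  assumes "epic C f" "x \<in> Hom C (Cod C f) W" "x \<cdot> f = Zero C (Dom C f) W"
  shows "x = Zero C (Cod C f) W"
proof -
  have "f \<in> Hom C (Dom C f) (Cod C f)" using assms by (auto simp: epic_def Hom_def)
  then show ?thesis
  using epic_cancel[OF assms(1,2) Zero_Hom] assms Comp_Zero(2)[of f] Hom_Obj by metis
qed

end

section \<open>Exactness in abelian categories\<close>

context abelian_category
begin

section \<open>Kernels, cokernels and tests for exactness\<close>

lemma kernelD: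
  assumes "is_kernel C k f" "f \<in> Hom C X Y"
  shows "k \<in> Hom C (Dom C k) X" "f \<cdot> k = Zero C (Dom C k) Y"
  using assms by (auto simp: is_kernel_def Hom_def)

lemma kernel_factor:
  assumes "is_kernel C k f" "f \<in> Hom C X Y" "x \<in> Hom C W X" "f \<cdot> x = Zero C W Y"
  obtains u where "u \<in> Hom C W (Dom C k)" "k \<cdot> u = x"
  using assms unfolding is_kernel_def by (metis HomD(2,3))

lemma cokernelD:
  assumes "is_cokernel C c f" "f \<in> Hom C X Y"
  shows "c \<in> Hom C Y (Cod C c)" "c \<cdot> f = Zero C X (Cod C c)"
  using assms by (auto simp: is_cokernel_def Hom_def)

lemma cokernel_factor:
  assumes "is_cokernel C c f" "f \<in> Hom C X Y" "x \<in> Hom C Y W" "x \<cdot> f = Zero C X W"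
  obtains u where "u \<in> Hom C (Cod C c) W" "u \<cdot> c = x"
  using assms unfolding is_cokernel_def by (metis HomD(2,3))

lemma kernel_Hom:
  assumes "is_kernel C k f"
  shows "f \<in> Hom C (Cod C k) (Cod C f)" "k \<in> Hom C (Dom C k) (Cod C k)"
  using assms by (auto simp: is_kernel_def Hom_def)

lemma cokernel_Hom:
  assumes "is_cokernel C c f"
  shows "f \<in> Hom C (Dom C f) (Dom C c)" "c \<in> Hom C (Dom C c) (Cod C c)"
  using assms by (auto simp: is_cokernel_def Hom_def)

lemma kernel_monic:
  assumes "is_kernel C k f"
  shows "monic C k"
  unfolding monic_def
proof safe
  show "k \<in> Arr C" using assms by (simp add: is_kernel_def)
  fix W x y
  assume x: "x \<in> Hom C W (Dom C k)" and y: "y \<in> Hom C W (Dom C k)" and eq: "k \<cdot> x = k \<cdot> y"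
  note fk = kernel_Hom[OF assms]
  have "f \<cdot> (k \<cdot> x) = (f \<cdot> k) \<cdot> x"
    using Comp_assoc x fk by blast
  also have "\<dots> = Zero C W (Cod C f)"
    using kernelD(2)[OF assms fk(1)] Comp_Zero(2)[OF x] Hom_Obj fk by metis
  finally have "f \<cdot> (k \<cdot> x) = Zero C W (Cod C f)" .
  moreover have "k \<cdot> x \<in> Hom C W (Dom C f)"
    using Comp_Hom[OF x fk(2)] fk HomD by metis
  ultimately have "\<exists>!u. u \<in> Hom C W (Dom C k) \<and> k \<cdot> u = k \<cdot> x"
    using assms unfolding is_kernel_def by blast
  then show "x = y" using x y eq by metis
qed

lemma cokernel_epic:
  assumes "is_cokernel C c f"
  shows "epic C c"
  unfolding epic_def
proof safe
  show "c \<in> Arr C" using assms by (simp add: is_cokernel_def)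
  fix W x y
  assume x: "x \<in> Hom C (Cod C c) W" and y: "y \<in> Hom C (Cod C c) W" and eq: "x \<cdot> c = y \<cdot> c"
  note fc = cokernel_Hom[OF assms]
  have "(x \<cdot> c) \<cdot> f = x \<cdot> (c \<cdot> f)"
    using Comp_assoc x fc by metis
  also have "\<dots> = Zero C (Dom C f) W"
    using cokernelD(2)[OF assms fc(1)] Comp_Zero(1)[OF x] Hom_Obj fc by metis
  finally have "(x \<cdot> c) \<cdot> f = Zero C (Dom C f) W" .
  moreover have "x \<cdot> c \<in> Hom C (Cod C f) W"
    using Comp_Hom[OF fc(2) x] fc HomD by metis
  ultimately have "\<exists>!u. u \<in> Hom C (Cod C c) W \<and> u \<cdot> c = x \<cdot> c"
    using assms unfolding is_cokernel_def by blast
  then show "x = y" using x y eq by metis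
qed

lemma is_kernelI:
  assumes "k \<in> Hom C K X" "f \<in> Hom C X Y" "monic C k" "f \<cdot> k = Zero C K Y"
    and "\<And>W x. x \<in> Hom C W X \<Longrightarrow> f \<cdot> x = Zero C W Y \<Longrightarrow> \<exists>u\<in>Hom C W K. k \<cdot> u = x"
  shows "is_kernel C k f"
  unfolding is_kernel_def using assms monic_cancel[OF assms(3)] by (auto simp: HomD Ex1_def) metis

lemma is_cokernelI:
  assumes "c \<in> Hom C Y Q" "f \<in> Hom C X Y" "epic C c" "c \<cdot> f = Zero C X Q"
    and "\<And>W x. x \<in> Hom C Y W \<Longrightarrow> x \<cdot> f = Zero C X W \<Longrightarrow> \<exists>u\<in>Hom C Q W. u \<cdot> c = x"
  shows "is_cokernel C c f"
  unfolding is_cokernel_def using assms epic_cancel[OF assms(3)] by (auto simp: HomD Ex1_def) metis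

text \<open>\<open>m\<close> is the kernel of some \<open>g\<close>. Since \<open>g\<close> kills
  \<open>m\<close>, it factors through \<open>c\<close>, so an arrow killed by \<open>c\<close> is
  killed by \<open>g\<close> and factors through \<open>m\<close>.\<close>

lemma monic_kernel_of_cokernel:
  assumes "monic C m" "is_cokernel C c m"
  shows "is_kernel C m c"
proof -
  obtain g where g: "is_kernel C m g" using monic_normal assms by blast
  note gm = kernel_Hom[OF g] and mc = cokernel_Hom[OF assms(2)]
  have eq: "Cod C m = Dom C c" using mc HomD by metis
  have gm0: "g \<cdot> m = Zero C (Dom C m) (Cod C g)" using kernelD(2)[OF g gm(1)] .
  obtain u where u: "u \<in> Hom C (Cod C c) (Cod C g)" "u \<cdot> c = g"
    using cokernel_factor[OF assms(2) mc(1) _ gm0] gm eq by metis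
  show ?thesis
  proof (rule is_kernelI[OF mc(1) mc(2) assms(1) cokernelD(2)[OF assms(2) mc(1)]])
    fix W x assume x: "x \<in> Hom C W (Dom C c)" "c \<cdot> x = Zero C W (Cod C c)"
    have "g \<cdot> x = u \<cdot> (c \<cdot> x)" using u Comp_assoc[OF x(1) mc(2) u(1)] by simp
    also have "\<dots> = Zero C W (Cod C g)" using x(2) Comp_Zero(1)[OF u(1)] Hom_Obj[OF x(1)] by simp
    finally show "\<exists>v\<in>Hom C W (Dom C m). m \<cdot> v = x"
      using kernel_factor[OF g gm(1)] x(1) eq by metis
  qed
qed

lemma epic_cokernel_of_kernel:
  assumes "epic C e" "is_kernel C k e"
  shows "is_cokernel C e k"
proof -
  obtain g where g: "is_cokernel C e g" using epic_normal assms by blast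
  note ge = cokernel_Hom[OF g] and ek = kernel_Hom[OF assms(2)]
  have eq: "Dom C e = Cod C k" using ek HomD by metis
  have eg0: "e \<cdot> g = Zero C (Dom C g) (Cod C e)" using cokernelD(2)[OF g ge(1)] .
  obtain u where u: "u \<in> Hom C (Dom C g) (Dom C k)" "k \<cdot> u = g"
    using kernel_factor[OF assms(2) ek(1) _ eg0] ge eq by metis
  show ?thesis
  proof (rule is_cokernelI[OF ek(1) ek(2) assms(1) kernelD(2)[OF assms(2) ek(1)]])
    fix W x assume x: "x \<in> Hom C (Cod C k) W" "x \<cdot> k = Zero C (Dom C k) W"
    have "x \<cdot> g = (x \<cdot> k) \<cdot> u" using u Comp_assoc[OF u(1) ek(2) x(1)] by simp
    also have "\<dots> = Zero C (Dom C g) W" using x(2) Comp_Zero(2)[OF u(1)] Hom_Obj[OF x(1)] by simp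
    finally show "\<exists>v\<in>Hom C (Cod C e) W. v \<cdot> e = x"
      using cokernel_factor[OF g ge(1)] x(1) eq by metis
  qed
qed

text \<open>An arrow \<open>x\<close> factors through the image of \<open>f\<close> iff the cokernel
  of \<open>f\<close> kills it, iff every arrow that kills \<open>f\<close> kills it. The last
  condition names neither image nor cokernel, so exactness becomes a matter of zero
  composites.\<close>

lemma exact_at_iff:
  "exact_at C f g \<longleftrightarrow> f \<in> Arr C \<and> g \<in> Arr C \<and> Cod C f = Dom C g \<and>
    (\<forall>W. \<forall>x\<in>Hom C W (Dom C g). g \<cdot> x = Zero C W (Cod C g) \<longleftrightarrow>
      (\<forall>V. \<forall>c\<in>Hom C (Dom C g) V. c \<cdot> f = Zero C (Dom C f) V \<longrightarrow> c \<cdot> x = Zero C W V))"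
  (is "_ \<longleftrightarrow> ?R")
proof -
  \<comment> \<open>Arrows that kill \<open>f\<close> factor through \<open>c0\<close>, so the
    cokernel alone decides the test.\<close>
  have cok: "(\<forall>V. \<forall>c\<in>Hom C (Cod C f) V. c \<cdot> f = Zero C (Dom C f) V \<longrightarrow> c \<cdot> x = Zero C W V)
      \<longleftrightarrow> c0 \<cdot> x = Zero C W (Cod C c0)"
    if c0: "is_cokernel C c0 f" and x: "x \<in> Hom C W (Cod C f)" for c0 x W
  proof -
    have f: "f \<in> Hom C (Dom C f) (Cod C f)" using c0 by (auto simp: is_cokernel_def Hom_def)
    note c = cokernelD[OF c0 f]
    have "c' \<cdot> x = Zero C W V"
      if c': "c' \<in> Hom C (Cod C f) V" "c' \<cdot> f = Zero C (Dom C f) V" "c0 \<cdot> x = Zero C W (Cod C c0)"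
      for V c'
    proof -
      obtain u where u: "u \<in> Hom C (Cod C c0) V" "u \<cdot> c0 = c'"
        using cokernel_factor[OF c0 f c'(1,2)] .
      then have "c' \<cdot> x = u \<cdot> (c0 \<cdot> x)" using Comp_assoc[OF x c(1) u(1)] by simp
      then show ?thesis using c'(3) Comp_Zero(1)[OF u(1)] Hom_Obj[OF x] by simp
    qed
    then show ?thesis using c by blast
  qed
  have ker: "(g \<cdot> x = Zero C W (Cod C g)) \<longleftrightarrow> (\<exists>u\<in>Hom C W (Dom C m). m \<cdot> u = x)"
    if m: "is_kernel C m g" and x: "x \<in> Hom C W (Cod C m)" for m g x W
  proof -
    note gm = kernel_Hom[OF m]
    show ?thesis
    proof
      assume "g \<cdot> x = Zero C W (Cod C g)"
      then show "\<exists>u\<in>Hom C W (Dom C m). m \<cdot> u = x"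
        using kernel_factor[OF m gm(1) x] by metis
    next
      assume "\<exists>u\<in>Hom C W (Dom C m). m \<cdot> u = x"
      then obtain u where u: "u \<in> Hom C W (Dom C m)" "m \<cdot> u = x" by blast
      then have "g \<cdot> x = (g \<cdot> m) \<cdot> u" using Comp_assoc[OF u(1) gm(2) gm(1)] by simp
      then show "g \<cdot> x = Zero C W (Cod C g)"
        using kernelD(2)[OF m gm(1)] Comp_Zero(2)[OF u(1)] Hom_Obj[OF gm(1)] by simp
    qed
  qed
  show ?thesis
  proof
    assume "exact_at C f g"
    then obtain m c where mc: "is_cokernel C c f" "is_kernel C m c" "is_kernel C m g"
      unfolding exact_at_def is_image_def by blast
    have eqs: "Cod C m = Dom C g" "Cod C m = Dom C c" "Dom C c = Cod C f"
      "f \<in> Arr C" "g \<in> Arr C"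
      using mc by (auto simp: is_kernel_def is_cokernel_def)
    show ?R
      using ker[OF mc(2)] ker[OF mc(3)] cok[OF mc(1)] eqs by (auto simp: eqs)
  next
    assume R: ?R
    obtain c where c: "is_cokernel C c f" using R ex_cokernel by blast
    obtain m where m: "is_kernel C m c" using c ex_kernel by (meson is_cokernel_def)
    have eqs: "Cod C m = Dom C g" "Dom C c = Dom C g"
      using c m R by (auto simp: is_kernel_def is_cokernel_def)
    have g: "g \<in> Hom C (Dom C g) (Cod C g)" using R by (simp add: Hom_def)
    have m': "m \<in> Hom C (Dom C m) (Dom C g)" using kernel_Hom[OF m] eqs by simp
    have c': "c \<in> Hom C (Dom C g) (Cod C c)" using cokernel_Hom[OF c] eqs by simp
    have iff: "g \<cdot> x = Zero C W (Cod C g) \<longleftrightarrow> c \<cdot> x = Zero C W (Cod C c)"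
      if "x \<in> Hom C W (Dom C g)" for x W
      using R cok[OF c] that by simp
    have "is_kernel C m g"
    proof (rule is_kernelI[OF m' g kernel_monic[OF m]])
      show "g \<cdot> m = Zero C (Dom C m) (Cod C g)"
        using iff[OF m'] kernelD(2)[OF m c'] by simp
      show "\<exists>u\<in>Hom C W (Dom C m). m \<cdot> u = x"
        if "x \<in> Hom C W (Dom C g)" "g \<cdot> x = Zero C W (Cod C g)" for W x
        using iff that kernel_factor[OF m c' that(1)] by metis
    qed
    then show "exact_at C f g"
      using c m unfolding exact_at_def is_image_def by blast
  qed
qed

lemma exact_atI:
  assumes "f \<in> Hom C X Y" "g \<in> Hom C Y Z"
    and "g \<cdot> f = Zero C X Z"
    and "\<And>V W c x. c \<in> Hom C Y V \<Longrightarrow> c \<cdot> f = Zero C X V \<Longrightarrow>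
      x \<in> Hom C W Y \<Longrightarrow> g \<cdot> x = Zero C W Z \<Longrightarrow> c \<cdot> x = Zero C W V"
  shows "exact_at C f g"
  unfolding exact_at_iff HomD[OF assms(1)] HomD[OF assms(2)]
proof (intro conjI allI ballI iffI impI)
  show "f \<in> Arr C" "g \<in> Arr C" "Y = Y" using HomD(1) assms(1,2) by simp_all
  fix W x assume x: "x \<in> Hom C W Y"
  show "c \<cdot> x = Zero C W V" if "g \<cdot> x = Zero C W Z" "c \<in> Hom C Y V" "c \<cdot> f = Zero C X V" for V c
    using assms(4)[OF that(2,3) x that(1)] .
  \<comment> \<open>The test arrow is \<open>g\<close> itself, which kills \<open>f\<close>.\<close>
  show "g \<cdot> x = Zero C W Z"
    if all: "\<forall>V. \<forall>c\<in>Hom C Y V. c \<cdot> f = Zero C X V \<longrightarrow> c \<cdot> x = Zero C W V"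
    using mp[OF bspec[OF spec[OF all] assms(2)] assms(3)] .
qed

lemma exact_at_Arr:
  assumes "exact_at C f g"
  shows "f \<in> Arr C" "g \<in> Arr C" "Cod C f = Dom C g"
  using assms unfolding exact_at_iff by blast+

lemma exact_at_Comp:
  assumes "exact_at C f g"
  shows "g \<cdot> f = Zero C (Dom C f) (Cod C g)"
proof -
  have "f \<in> Hom C (Dom C f) (Dom C g)"
    using exact_at_Arr[OF assms] by (simp add: Hom_def)
  moreover have "\<forall>x\<in>Hom C (Dom C f) (Dom C g). g \<cdot> x = Zero C (Dom C f) (Cod C g) \<longleftrightarrow>
      (\<forall>V. \<forall>c\<in>Hom C (Dom C g) V. c \<cdot> f = Zero C (Dom C f) V \<longrightarrow> c \<cdot> x = Zero C (Dom C f) V)"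
    using assms unfolding exact_at_iff by blast
  ultimately show ?thesis by blast
qed

lemma exact_at_test:
  assumes "exact_at C f g" "f \<in> Hom C X Y" "g \<in> Hom C Y Z" "x \<in> Hom C W Y" "g \<cdot> x = Zero C W Z"
    "c \<in> Hom C Y V" "c \<cdot> f = Zero C X V"
  shows "c \<cdot> x = Zero C W V"
proof -
  have "\<forall>V. \<forall>c\<in>Hom C Y V. c \<cdot> f = Zero C X V \<longrightarrow> c \<cdot> x = Zero C W V"
    using assms(1,4,5) unfolding exact_at_iff HomD[OF assms(2)] HomD[OF assms(3)] by blast
  then show ?thesis using assms(6,7) by blast
qed

text \<open>The cokernel of \<open>k\<close> is a test arrow and hence kills \<open>x\<close>; the
  monic \<open>k\<close> is the kernel of that cokernel.\<close>

lemma exact_at_monic_factor: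
  assumes "exact_at C k g" "monic C k" "k \<in> Hom C X Y" "g \<in> Hom C Y Z"
    "x \<in> Hom C W Y" "g \<cdot> x = Zero C W Z"
  obtains u where "u \<in> Hom C W X" "k \<cdot> u = x"
proof -
  obtain c where c: "is_cokernel C c k" using ex_cokernel assms(3) HomD by metis
  have "is_kernel C k c" using monic_kernel_of_cokernel[OF assms(2) c] .
  moreover have "c \<cdot> x = Zero C W (Cod C c)"
    using exact_at_test[OF assms(1,3-6) cokernelD[OF c assms(3)]] .
  ultimately show ?thesis
    using that kernel_factor[OF _ cokernelD(1)[OF c assms(3)] assms(5)] HomD(2)[OF assms(3)] by metis
qed

lemma exact_at_epic_factor:
  assumes "exact_at C f p" "epic C p" "f \<in> Hom C X Y" "p \<in> Hom C Y Z"
    "x \<in> Hom C Y W" "x \<cdot> f = Zero C X W"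
  obtains u where "u \<in> Hom C Z W" "u \<cdot> p = x"
proof -
  obtain k where k: "is_kernel C k p" using ex_kernel assms(4) HomD by metis
  have "is_cokernel C p k" using epic_cokernel_of_kernel[OF assms(2) k] .
  moreover have "x \<cdot> k = Zero C (Dom C k) W"
    using exact_at_test[OF assms(1,3,4) kernelD[OF k assms(4)] assms(5,6)] .
  ultimately show ?thesis
    using that cokernel_factor[OF _ kernelD(1)[OF k assms(4)] assms(5)] HomD(3)[OF assms(4)] by metis
qed

text \<open>\<open>m\<close> is the kernel of the cokernel \<open>c\<close> of \<open>f\<close>. To
  see that \<open>e\<close> is epic, let \<open>u\<close> kill \<open>e\<close> and let
  \<open>k\<close> be the kernel of \<open>u\<close>. Then \<open>f\<close> factors through
  \<open>n = m \<cdot> k\<close>, so the cokernel of \<open>n\<close> factors through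
  \<open>c\<close> and kills \<open>m\<close>. Hence \<open>m\<close> factors through
  \<open>n\<close>, the monic \<open>k\<close> has a right inverse, and \<open>u\<close> is
  zero.\<close>

lemma epic_mono_factorization:
  assumes "f \<in> Hom C X Y"
  obtains Z e m where "e \<in> Hom C X Z" "m \<in> Hom C Z Y" "epic C e" "monic C m" "m \<cdot> e = f"
proof -
  obtain c where c: "is_cokernel C c f" using ex_cokernel assms HomD by metis
  note c' = cokernelD[OF c assms]
  obtain m where m: "is_kernel C m c" using ex_kernel c' HomD by metis
  note m' = kernelD[OF m c'(1)]
  obtain e where e: "e \<in> Hom C X (Dom C m)" "m \<cdot> e = f"
    using kernel_factor[OF m c'(1) assms c'(2)] .
  have "epic C e"
  proof (rule epicI[OF e(1)])
    fix W u assume u: "u \<in> Hom C (Dom C m) W" "u \<cdot> e = Zero C X W"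
    obtain k where k: "is_kernel C k u" using ex_kernel u HomD by metis
    note k' = kernelD[OF k u(1)]
    obtain e' where e': "e' \<in> Hom C X (Dom C k)" "k \<cdot> e' = e"
      using kernel_factor[OF k u(1) e(1) u(2)] .
    define n where "n = m \<cdot> k"
    have n: "n \<in> Hom C (Dom C k) Y" unfolding n_def using k' m' Comp_Hom by blast
    have nm: "monic C n"
      unfolding n_def
      by (rule monic_Comp) (simp_all add: kernel_monic[OF k] kernel_monic[OF m] HomD(3)[OF k'(1)])
    have f: "n \<cdot> e' = f"
      unfolding n_def using e e' Comp_assoc[OF e'(1) k'(1) m'(1)] by simp
    obtain q where q: "is_cokernel C q n" using ex_cokernel n HomD by metis
    note q' = cokernelD[OF q n]
    have "q \<cdot> f = (q \<cdot> n) \<cdot> e'" using f Comp_assoc[OF e'(1) n q'(1)] by simp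
    also have "\<dots> = Zero C X (Cod C q)"
      using q'(2) Comp_Zero(2)[OF e'(1)] Hom_Obj[OF q'(1)] by simp
    finally obtain v where v: "v \<in> Hom C (Cod C c) (Cod C q)" "v \<cdot> c = q"
      using cokernel_factor[OF c assms q'(1)] by blast
    have "q \<cdot> m = v \<cdot> (c \<cdot> m)" using v Comp_assoc[OF m'(1) c'(1) v(1)] by simp
    also have "\<dots> = Zero C (Dom C m) (Cod C q)"
      using m'(2) Comp_Zero(1)[OF v(1)] Hom_Obj[OF m'(1)] by simp
    finally obtain t where t: "t \<in> Hom C (Dom C m) (Dom C n)" "n \<cdot> t = m"
      using kernel_factor[OF monic_kernel_of_cokernel[OF nm q] q'(1) m'(1)] by blast
    have t1: "t \<in> Hom C (Dom C m) (Dom C k)" using t n HomD by metis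
    have mO: "Dom C m \<in> Obj C" using Hom_Obj[OF m'(1)] by simp
    have "m \<cdot> (k \<cdot> t) = m \<cdot> Id C (Dom C m)"
      using t(2) n_def Comp_assoc[OF t1 k'(1) m'(1)] Comp_Id_right[OF m'(1)] by simp
    then have kt: "k \<cdot> t = Id C (Dom C m)"
      using monic_cancel[OF kernel_monic[OF m] Comp_Hom[OF t1 k'(1)] Id_Hom[OF mO]] by simp
    have "u = u \<cdot> (k \<cdot> t)" using kt Comp_Id_right[OF u(1)] by simp
    also have "\<dots> = (u \<cdot> k) \<cdot> t" using Comp_assoc[OF t1 k'(1) u(1)] by simp
    also have "\<dots> = Zero C (Dom C m) W"
      using k'(2) Comp_Zero(2)[OF t1] Hom_Obj[OF u(1)] by simp
    finally show "u = Zero C (Dom C m) W" .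
  qed
  then show ?thesis using that e m' kernel_monic[OF m] by blast
qed

section \<open>Short exact sequences, pullbacks and diagram chases\<close>

definition short_exact :: "'b \<Rightarrow> 'b \<Rightarrow> 'a \<Rightarrow> 'a \<Rightarrow> 'a \<Rightarrow> bool" where
  "short_exact k p Y Z Q \<longleftrightarrow> k \<in> Hom C Y Z \<and> p \<in> Hom C Z Q \<and> monic C k \<and> epic C p \<and> exact_at C k p"

lemma short_exactD:
  assumes "short_exact k p Y Z Q"
  shows "k \<in> Hom C Y Z" "p \<in> Hom C Z Q" "monic C k" "epic C p" "exact_at C k p"
    "p \<cdot> k = Zero C Y Q" "Y \<in> Obj C" "Z \<in> Obj C" "Q \<in> Obj C"
  using assms exact_at_Comp[of k p] Hom_Obj[of k Y Z] Hom_Obj[of p Z Q]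
  by (auto simp: short_exact_def HomD)

lemma short_exact_kernel_factor:
  assumes "short_exact k p Y Z Q" "x \<in> Hom C W Z" "p \<cdot> x = Zero C W Q"
  obtains u where "u \<in> Hom C W Y" "k \<cdot> u = x"
  using exact_at_monic_factor[OF short_exactD(5,3,1,2)[OF assms(1)] assms(2,3)] by blast

lemma short_exact_cokernel_factor:
  assumes "short_exact k p Y Z Q" "x \<in> Hom C Z W" "x \<cdot> k = Zero C Y W"
  obtains u where "u \<in> Hom C Q W" "u \<cdot> p = x"
  using exact_at_epic_factor[OF short_exactD(5,4,1,2)[OF assms(1)] assms(2,3)] by blast

lemma short_exactI:
  assumes "k \<in> Hom C Y Z" "p \<in> Hom C Z Q" "monic C k" "epic C p" "p \<cdot> k = Zero C Y Q"
    and "\<And>W x. x \<in> Hom C W Z \<Longrightarrow> p \<cdot> x = Zero C W Q \<Longrightarrow> \<exists>u\<in>Hom C W Y. k \<cdot> u = x"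
  shows "short_exact k p Y Z Q"
proof -
  have "c \<cdot> x = Zero C W V"
    if "c \<in> Hom C Z V" "c \<cdot> k = Zero C Y V" "x \<in> Hom C W Z" "p \<cdot> x = Zero C W Q" for V W c x
  proof -
    obtain u where u: "u \<in> Hom C W Y" "k \<cdot> u = x" using assms(6) \<open>x \<in> _\<close> \<open>p \<cdot> x = _\<close> by blast
    then have "c \<cdot> x = (c \<cdot> k) \<cdot> u" using Comp_assoc[OF u(1) assms(1) that(1)] by simp
    then show ?thesis using that(2) Comp_Zero(2)[OF u(1)] Hom_Obj[OF that(1)] by simp
  qed
  then show ?thesis
    unfolding short_exact_def using assms exact_atI[OF assms(1,2,5)] by blast
qed

lemma kernel_short_exact:
  assumes "is_kernel C k p" "epic C p" "p \<in> Hom C Z Q"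
  shows "short_exact k p (Dom C k) Z Q"
proof (rule short_exactI)
  note k = kernelD[OF assms(1,3)]
  show "k \<in> Hom C (Dom C k) Z" "p \<cdot> k = Zero C (Dom C k) Q" by (rule k)+
  show "p \<in> Hom C Z Q" "epic C p" "monic C k" using assms kernel_monic by auto
  show "\<exists>u\<in>Hom C W (Dom C k). k \<cdot> u = x" if "x \<in> Hom C W Z" "p \<cdot> x = Zero C W Q" for W x
    by (rule kernel_factor[OF assms(1,3) that]) blast
qed

lemma epic_short_exact:
  assumes "epic C p" "p \<in> Hom C Z Q"
  obtains k Y where "short_exact k p Y Z Q"
proof -
  obtain k where k: "is_kernel C k p" using ex_kernel HomD(1)[OF assms(2)] by blast
  show ?thesis using that kernel_short_exact[OF k assms] .
qed

lemma monic_short_exact: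
  assumes "monic C k" "k \<in> Hom C Y Z"
  obtains p Q where "short_exact k p Y Z Q"
proof -
  obtain p where p: "is_cokernel C p k" using ex_cokernel HomD(1)[OF assms(2)] by blast
  show ?thesis
    using that kernel_short_exact[OF monic_kernel_of_cokernel[OF assms(1) p] cokernel_epic[OF p]
      cokernelD(1)[OF p assms(2)]] unfolding HomD(2)[OF assms(2)] .
qed

text \<open>Write \<open>g\<close> as an epic \<open>e\<close> followed by a monic \<open>m\<close>.
  By exactness \<open>u\<close> kills the kernel of \<open>e\<close> and so descends along
  \<open>e\<close>; injectivity then extends the result along \<open>m\<close>.\<close>

lemma injective_extend:
  assumes "exact_at C f g" "f \<in> Hom C X Y" "g \<in> Hom C Y Z" "injective_object C I"
    "u \<in> Hom C Y I" "u \<cdot> f = Zero C X I"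
  obtains v where "v \<in> Hom C Z I" "v \<cdot> g = u"
proof -
  obtain V e m where em: "e \<in> Hom C Y V" "m \<in> Hom C V Z" "epic C e" "monic C m" "m \<cdot> e = g"
    using epic_mono_factorization[OF assms(3)] .
  obtain k K where k: "short_exact k e K Y V" using epic_short_exact[OF em(3,1)] .
  note k' = short_exactD[OF k]
  have "g \<cdot> k = m \<cdot> (e \<cdot> k)" using Comp_assoc[OF k'(1) em(1,2)] em by simp
  then have "g \<cdot> k = Zero C K Z" using k'(6) Comp_Zero(1)[OF em(2) k'(7)] by simp
  then have "u \<cdot> k = Zero C K I"
    using exact_at_test[OF assms(1-3) k'(1) _ assms(5,6)] by blast
  then obtain w where w: "w \<in> Hom C V I" "w \<cdot> e = u"
    using short_exact_cokernel_factor[OF k assms(5)] by blast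
  obtain v where v: "v \<in> Hom C Z I" "v \<cdot> m = w"
    using assms(4) em(2,4) w(1) unfolding injective_object_def by (metis HomD(2,3))
  have "v \<cdot> g = u" using v w em Comp_assoc[OF em(1,2) v(1)] by simp
  then show ?thesis using that v by blast
qed

text \<open>The pullback is the kernel of \<open>d = f \<cdot> p1 - e \<cdot> p2\<close> on the
  biproduct of \<open>X\<close> and \<open>I\<close>. As \<open>e\<close> is epic, so is
  \<open>d\<close>, and \<open>d\<close> is therefore the cokernel of its kernel; this makes the
  projection \<open>p\<close> epic.\<close>

lemma pullback:
  assumes e: "e \<in> Hom C I S" "epic C e" and f: "f \<in> Hom C X S"
  obtains P p q where "p \<in> Hom C P X" "q \<in> Hom C P I" "epic C p" "f \<cdot> p = e \<cdot> q"
    "\<And>W x y. x \<in> Hom C W X \<Longrightarrow> y \<in> Hom C W I \<Longrightarrow> f \<cdot> x = e \<cdot> y \<Longrightarrow>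
       \<exists>t\<in>Hom C W P. p \<cdot> t = x \<and> q \<cdot> t = y"
    "\<And>W t t'. t \<in> Hom C W P \<Longrightarrow> t' \<in> Hom C W P \<Longrightarrow> p \<cdot> t = p \<cdot> t' \<Longrightarrow> q \<cdot> t = q \<cdot> t' \<Longrightarrow> t = t'"
proof -
  have O: "I \<in> Obj C" "S \<in> Obj C" "X \<in> Obj C" using Hom_Obj e(1) f by auto
  obtain B i1 i2 p1 p2 where B: "is_biproduct C X I B i1 i2 p1 p2"
    using ex_biproduct O by blast
  have i: "i1 \<in> Hom C X B" "i2 \<in> Hom C I B" "p1 \<in> Hom C B X" "p2 \<in> Hom C B I"
    "p1 \<cdot> i1 = Id C X" "p2 \<cdot> i2 = Id C I" "p1 \<cdot> i2 = Zero C I X" "p2 \<cdot> i1 = Zero C X I"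
    "Add C (i1 \<cdot> p1) (i2 \<cdot> p2) = Id C B"
    using B unfolding is_biproduct_def by auto
  define d where "d = Sub (f \<cdot> p1) (e \<cdot> p2)"
  have fp: "f \<cdot> p1 \<in> Hom C B S" and ep: "e \<cdot> p2 \<in> Hom C B S"
    using i e f Comp_Hom by auto
  have d: "d \<in> Hom C B S" unfolding d_def using Sub_Hom[OF fp ep] .
  have dx: "d \<cdot> x = Zero C W S \<longleftrightarrow> f \<cdot> (p1 \<cdot> x) = e \<cdot> (p2 \<cdot> x)" if x: "x \<in> Hom C W B" for x W
    unfolding d_def
    using Sub_Comp[OF x fp ep] Sub_eq_Zero[OF Comp_Hom[OF x fp] Comp_Hom[OF x ep]]
      Comp_assoc[OF x i(3) f] Comp_assoc[OF x i(4) e(1)] by simp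
  have BO: "B \<in> Obj C" using Hom_Obj i by blast
  have joint: "t = Add C (i1 \<cdot> (p1 \<cdot> t)) (i2 \<cdot> (p2 \<cdot> t))" if t: "t \<in> Hom C W B" for t W
  proof -
    have "t = Id C B \<cdot> t" using Comp_Id_left[OF t] by simp
    also have "\<dots> = Add C ((i1 \<cdot> p1) \<cdot> t) ((i2 \<cdot> p2) \<cdot> t)"
      using Comp_Add_left[OF t, of "i1 \<cdot> p1" B "i2 \<cdot> p2"] i Comp_Hom by auto
    also have "\<dots> = Add C (i1 \<cdot> (p1 \<cdot> t)) (i2 \<cdot> (p2 \<cdot> t))"
      using Comp_assoc[OF t i(3,1)] Comp_assoc[OF t i(4,2)] by simp
    finally show ?thesis .
  qed
  obtain k where k: "is_kernel C k d" using ex_kernel d HomD by metis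
  note k' = kernelD[OF k d]
  define P where "P = Dom C k"
  note k'' = k'[folded P_def]
  define p q where "p = p1 \<cdot> k" and "q = p2 \<cdot> k"
  have p: "p \<in> Hom C P X" and q: "q \<in> Hom C P I"
    unfolding p_def q_def using k'' i Comp_Hom by auto
  have comm: "f \<cdot> p = e \<cdot> q"
    unfolding p_def q_def using dx[OF k''(1)] k''(2) by simp
  have lift: "\<exists>t\<in>Hom C W P. p \<cdot> t = x \<and> q \<cdot> t = y"
    if x: "x \<in> Hom C W X" and y: "y \<in> Hom C W I" and eq: "f \<cdot> x = e \<cdot> y" for W x y
  proof -
    define z where "z = Add C (i1 \<cdot> x) (i2 \<cdot> y)"
    have ix: "i1 \<cdot> x \<in> Hom C W B" and iy: "i2 \<cdot> y \<in> Hom C W B" using x y i Comp_Hom by auto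
    have z: "z \<in> Hom C W B" unfolding z_def using Add_Hom[OF ix iy] .
    have W: "W \<in> Obj C" using Hom_Obj[OF x] by simp
    have "p1 \<cdot> z = Add C ((p1 \<cdot> i1) \<cdot> x) ((p1 \<cdot> i2) \<cdot> y)"
      unfolding z_def using Comp_Add_right[OF ix iy i(3)] Comp_assoc[OF x i(1,3)] Comp_assoc[OF y i(2,3)]
      by simp
    then have z1: "p1 \<cdot> z = x"
      using i Comp_Id_left[OF x] Comp_Zero(2)[OF y O(3)] Add_Zero[OF x] by simp
    have "p2 \<cdot> z = Add C ((p2 \<cdot> i1) \<cdot> x) ((p2 \<cdot> i2) \<cdot> y)"
      unfolding z_def using Comp_Add_right[OF ix iy i(4)] Comp_assoc[OF x i(1,4)] Comp_assoc[OF y i(2,4)]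
      by simp
    then have z2: "p2 \<cdot> z = y"
      using i Comp_Id_left[OF y] Comp_Zero(2)[OF x O(1)] Add_Zero[OF y] by simp
    have "d \<cdot> z = Zero C W S" using dx[OF z] z1 z2 eq by simp
    then obtain t where t: "t \<in> Hom C W P" "k \<cdot> t = z"
      using kernel_factor[OF k d z] unfolding P_def by blast
    then show ?thesis
      using z1 z2 Comp_assoc[OF t(1) k''(1) i(3)] Comp_assoc[OF t(1) k''(1) i(4)]
      unfolding p_def q_def by auto
  qed
  have unique: "t = t'" if t: "t \<in> Hom C W P" "t' \<in> Hom C W P" "p \<cdot> t = p \<cdot> t'" "q \<cdot> t = q \<cdot> t'" for W t t'
  proof -
    have h: "k \<cdot> t \<in> Hom C W B" "k \<cdot> t' \<in> Hom C W B" using t k'' Comp_Hom by auto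
    have "p1 \<cdot> (k \<cdot> t) = p1 \<cdot> (k \<cdot> t')" "p2 \<cdot> (k \<cdot> t) = p2 \<cdot> (k \<cdot> t')"
      using t(3,4) Comp_assoc[OF t(1) k''(1) i(3)] Comp_assoc[OF t(2) k''(1) i(3)]
        Comp_assoc[OF t(1) k''(1) i(4)] Comp_assoc[OF t(2) k''(1) i(4)] unfolding p_def q_def by simp_all
    then have "k \<cdot> t = k \<cdot> t'" using joint[OF h(1)] joint[OF h(2)] by simp
    then show ?thesis using monic_cancel[OF kernel_monic[OF k]] t(1,2) unfolding P_def by blast
  qed
  have SO: "Zero C X S \<in> Hom C X S" using Zero_Hom O by simp
  \<comment> \<open>On the summand \<open>I\<close> the arrow \<open>d\<close> restricts to
    \<open>-e\<close>, which is epic.\<close>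
  have di2: "v = Zero C S V" if v: "v \<in> Hom C S V" "(v \<cdot> d) \<cdot> i2 = Zero C I V" for v V
  proof -
    have V: "V \<in> Obj C" using Hom_Obj[OF v(1)] by simp
    have "d \<cdot> i2 = Sub ((f \<cdot> p1) \<cdot> i2) ((e \<cdot> p2) \<cdot> i2)"
      unfolding d_def using Sub_Comp[OF i(2) fp ep] .
    also have "\<dots> = Sub (Zero C I S) e"
      using Comp_assoc[OF i(2,3) f] Comp_assoc[OF i(2,4) e(1)] i Comp_Zero(1)[OF f O(1)]
        Comp_Id_right[OF e(1)] by simp
    finally have "v \<cdot> (d \<cdot> i2) = Sub (v \<cdot> Zero C I S) (v \<cdot> e)"
      using Comp_Sub[OF Zero_Hom[OF O(1,2)] e(1) v(1)] by simp
    then have "Sub (Zero C I V) (v \<cdot> e) = Zero C I V"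
      using v(2) Comp_assoc[OF i(2) d v(1)] Comp_Zero(1)[OF v(1) O(1)] by simp
    then have "v \<cdot> e = Zero C I V"
      using Sub_eq_Zero[OF Zero_Hom[OF O(1) V] Comp_Hom[OF e(1) v(1)]] by simp
    then show ?thesis using epic_Zero[OF e(2), unfolded HomD(2,3)[OF e(1)], OF v(1)] by simp
  qed
  have "epic C d"
  proof (rule epicI[OF d])
    fix V v assume v: "v \<in> Hom C S V" "v \<cdot> d = Zero C B V"
    then show "v = Zero C S V" using di2[OF v(1)] Comp_Zero(2)[OF i(2)] Hom_Obj[OF v(1)] by simp
  qed
  then have dc: "is_cokernel C d k" using epic_cokernel_of_kernel[OF _ k] by blast
  \<comment> \<open>If \<open>u\<close> kills \<open>p\<close>, then \<open>u \<cdot> p1\<close>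
    kills the kernel of \<open>d\<close> and is of the form \<open>v \<cdot> d\<close>. On
    \<open>I\<close> it vanishes, which forces \<open>v\<close> to be zero; restriction to
    \<open>X\<close> then shows that \<open>u\<close> is zero.\<close>
  have "epic C p"
  proof (rule epicI[OF p])
    fix V u assume u: "u \<in> Hom C X V" "u \<cdot> p = Zero C P V"
    have V: "V \<in> Obj C" using Hom_Obj[OF u(1)] by simp
    have up: "u \<cdot> p1 \<in> Hom C B V" using u i Comp_Hom by blast
    have "(u \<cdot> p1) \<cdot> k = Zero C P V" using u Comp_assoc[OF k''(1) i(3) u(1)] unfolding p_def by simp
    then obtain v where v: "v \<in> Hom C (Cod C d) V" "v \<cdot> d = u \<cdot> p1"
      using cokernel_factor[OF dc k''(1) up] by blast
    have v1: "v \<in> Hom C S V" using v d HomD by metis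
    have "(v \<cdot> d) \<cdot> i2 = u \<cdot> (p1 \<cdot> i2)" using v Comp_assoc[OF i(2,3) u(1)] by simp
    also have "\<dots> = Zero C I V" using i Comp_Zero(1)[OF u(1) O(1)] by simp
    finally have "v = Zero C S V" using di2[OF v1] by blast
    then have up0: "u \<cdot> p1 = Zero C B V" using v(2) Comp_Zero(2)[OF d V] by simp
    have "u = (u \<cdot> p1) \<cdot> i1" using Comp_assoc[OF i(1,3) u(1)] i Comp_Id_right[OF u(1)] by simp
    then show "u = Zero C X V" using up0 Comp_Zero(2)[OF i(1) V] by simp
  qed
  then show ?thesis using that[OF p q _ comm] lift unique by blast
qed

text \<open>Takes the place of choosing a preimage of an element: \<open>x\<close> lifts along
  \<open>p\<close> after composition with an epic \<open>r\<close>, which \<open>epic_Zero\<close>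
  cancels at the end of a chase.\<close>

lemma epic_lift:
  assumes "p \<in> Hom C Z Q" "epic C p" "x \<in> Hom C W Q"
  obtains V r y where "r \<in> Hom C V W" "epic C r" "y \<in> Hom C V Z" "p \<cdot> y = x \<cdot> r"
  using pullback[OF assms] by metis

text \<open>The third isomorphism theorem: for subobjects \<open>Y\<close> of \<open>Z\<close> of
  \<open>I\<close>, the sequence relates \<open>Z / Y\<close>, \<open>I / Y\<close> and
  \<open>I / Z\<close>. Both arrows come from cokernel properties; monicity of \<open>j\<close> and
  exactness are chases with \<open>epic_lift\<close>.\<close>

lemma rotation:
  assumes kp: "short_exact k p Y Z Q" and zc: "short_exact z c Z I D"
    and e: "short_exact (z \<cdot> k) e Y I S"
  obtains j d where "short_exact j d Q S D" "j \<cdot> p = e \<cdot> z" "d \<cdot> e = c"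
proof -
  note kp' = short_exactD[OF kp] and zc' = short_exactD[OF zc] and e' = short_exactD[OF e]
  have ez: "e \<cdot> z \<in> Hom C Z S" using Comp_Hom[OF zc'(1) e'(2)] .
  have "(e \<cdot> z) \<cdot> k = Zero C Y S" using Comp_assoc[OF kp'(1) zc'(1) e'(2)] e'(6) by simp
  then obtain j where j: "j \<in> Hom C Q S" "j \<cdot> p = e \<cdot> z"
    using short_exact_cokernel_factor[OF kp ez] by blast
  have "c \<cdot> (z \<cdot> k) = Zero C Y D"
    using Comp_assoc[OF kp'(1) zc'(1,2)] zc'(6) Comp_Zero(2)[OF kp'(1) zc'(9)] by simp
  then obtain d where d: "d \<in> Hom C S D" "d \<cdot> e = c"
    using short_exact_cokernel_factor[OF e zc'(2)] by blast
  have "monic C j"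
  proof (rule monicI[OF j(1)])
    fix W x assume x: "x \<in> Hom C W Q" "j \<cdot> x = Zero C W S"
    obtain V r y where r: "r \<in> Hom C V W" "epic C r" "y \<in> Hom C V Z" "p \<cdot> y = x \<cdot> r"
      using epic_lift[OF kp'(2,4) x(1)] .
    have W: "W \<in> Obj C" using Hom_Obj[OF x(1)] by simp
    have zy: "z \<cdot> y \<in> Hom C V I" using Comp_Hom[OF r(3) zc'(1)] .
    have "e \<cdot> (z \<cdot> y) = j \<cdot> (x \<cdot> r)"
      using Comp_assoc[OF r(3) zc'(1) e'(2)] Comp_assoc[OF r(3) kp'(2) j(1)] j(2) r(4) by simp
    also have "\<dots> = Zero C V S"
      using Comp_assoc[OF r(1) x(1) j(1)] x(2) Comp_Zero(2)[OF r(1) e'(9)] by simp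
    finally obtain w where w: "w \<in> Hom C V Y" "(z \<cdot> k) \<cdot> w = z \<cdot> y"
      using short_exact_kernel_factor[OF e zy] by blast
    have "z \<cdot> (k \<cdot> w) = z \<cdot> y" using w Comp_assoc[OF w(1) kp'(1) zc'(1)] by simp
    then have y: "k \<cdot> w = y"
      using monic_cancel[OF zc'(3), unfolded HomD(2)[OF zc'(1)], OF Comp_Hom[OF w(1) kp'(1)] r(3)]
      by simp
    have "x \<cdot> r = (p \<cdot> k) \<cdot> w" using r(4) y Comp_assoc[OF w(1) kp'(1,2)] by simp
    also have "\<dots> = Zero C V Q" using kp'(6) Comp_Zero(2)[OF w(1) kp'(9)] by simp
    finally have "x \<cdot> r = Zero C V Q" .
    then show "x = Zero C W Q"
      using epic_Zero[OF r(2), unfolded HomD(2,3)[OF r(1)], OF x(1)] by simp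
  qed
  moreover have "epic C d"
  proof (rule epicI[OF d(1)])
    fix W x assume x: "x \<in> Hom C D W" "x \<cdot> d = Zero C S W"
    have "x \<cdot> c = (x \<cdot> d) \<cdot> e" using d(2) Comp_assoc[OF e'(2) d(1) x(1)] by simp
    also have "\<dots> = Zero C I W" using x(2) Comp_Zero(2)[OF e'(2)] Hom_Obj[OF x(1)] by simp
    finally show "x = Zero C D W"
      using epic_Zero[OF zc'(4), unfolded HomD(2,3)[OF zc'(2)], OF x(1)] by simp
  qed
  moreover have "exact_at C j d"
  proof (rule exact_atI[OF j(1) d(1)])
    have dj: "d \<cdot> j \<in> Hom C Q D" using Comp_Hom[OF j(1) d(1)] .
    have "(d \<cdot> j) \<cdot> p = (d \<cdot> e) \<cdot> z"
      using Comp_assoc[OF kp'(2) j(1) d(1)] Comp_assoc[OF zc'(1) e'(2) d(1)] j(2) by simp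
    also have "\<dots> = Zero C Z D" using d(2) zc'(6) by simp
    finally show "d \<cdot> j = Zero C Q D"
      using epic_Zero[OF kp'(4), unfolded HomD(2,3)[OF kp'(2)], OF dj] by simp
  next
    fix V W u x
    assume u: "u \<in> Hom C S V" "u \<cdot> j = Zero C Q V" and x: "x \<in> Hom C W S" "d \<cdot> x = Zero C W D"
    have V: "V \<in> Obj C" using Hom_Obj[OF u(1)] by simp
    obtain U r y where r: "r \<in> Hom C U W" "epic C r" "y \<in> Hom C U I" "e \<cdot> y = x \<cdot> r"
      using epic_lift[OF e'(2,4) x(1)] .
    have "c \<cdot> y = d \<cdot> (x \<cdot> r)" using d(2) Comp_assoc[OF r(3) e'(2) d(1)] r(4) by simp
    also have "\<dots> = Zero C U D"
      using Comp_assoc[OF r(1) x(1) d(1)] x(2) Comp_Zero(2)[OF r(1) zc'(9)] by simp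
    finally obtain w where w: "w \<in> Hom C U Z" "z \<cdot> w = y"
      using short_exact_kernel_factor[OF zc r(3)] by blast
    have pw: "p \<cdot> w \<in> Hom C U Q" using Comp_Hom[OF w(1) kp'(2)] .
    have ux: "u \<cdot> x \<in> Hom C W V" using Comp_Hom[OF x(1) u(1)] .
    have "x \<cdot> r = j \<cdot> (p \<cdot> w)"
      using r(4) w(2) Comp_assoc[OF w(1) zc'(1) e'(2)] Comp_assoc[OF w(1) kp'(2) j(1)] j(2) by simp
    then have "(u \<cdot> x) \<cdot> r = (u \<cdot> j) \<cdot> (p \<cdot> w)"
      using Comp_assoc[OF r(1) x(1) u(1)] Comp_assoc[OF pw j(1) u(1)] by simp
    also have "\<dots> = Zero C U V" using u(2) Comp_Zero(2)[OF pw V] by simp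
    finally show "u \<cdot> x = Zero C W V"
      using epic_Zero[OF r(2), unfolded HomD(2,3)[OF r(1)], OF ux] by simp
  qed
  ultimately show ?thesis using that[of j d] j d unfolding short_exact_def by blast
qed

text \<open>Composing with a monic does not change which arrows \<open>g\<close> kills.\<close>

lemma exact_at_monic_Comp:
  assumes "exact_at C f g" "monic C m" "Cod C g = Dom C m"
  shows "exact_at C f (m \<cdot> g)"
proof -
  note fg = exact_at_Arr[OF assms(1)]
  define X Y Z V where "X = Dom C f" and "Y = Dom C g" and "Z = Dom C m" and "V = Cod C m"
  have f: "f \<in> Hom C X Y" and g: "g \<in> Hom C Y Z" and m: "m \<in> Hom C Z V"
    using fg assms unfolding X_def Y_def Z_def V_def monic_def by (auto simp: Hom_def)
  have O: "X \<in> Obj C" using Hom_Obj f by blast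
  have gf: "g \<cdot> f = Zero C X Z"
    using exact_at_Comp[OF assms(1)] unfolding HomD(2)[OF f] HomD(3)[OF g] .
  show ?thesis
  proof (rule exact_atI[OF f Comp_Hom[OF g m]])
    show "(m \<cdot> g) \<cdot> f = Zero C X V"
      using Comp_assoc[OF f g m] gf Comp_Zero(1)[OF m O] by simp
    fix U W c x
    assume c: "c \<in> Hom C Y U" "c \<cdot> f = Zero C X U" and x: "x \<in> Hom C W Y" "(m \<cdot> g) \<cdot> x = Zero C W V"
    have "m \<cdot> (g \<cdot> x) = Zero C W V" using x Comp_assoc[OF x(1) g m] by simp
    then have "g \<cdot> x = Zero C W Z"
      using monic_Zero[OF assms(2), unfolded HomD(2,3)[OF m], OF Comp_Hom[OF x(1) g]] by simp
    then show "c \<cdot> x = Zero C W U" using exact_at_test[OF assms(1) f g x(1) _ c] by simp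
  qed
qed

text \<open>The arrows that kill \<open>f \<cdot> e\<close> are those that kill
  \<open>f\<close>.\<close>

lemma exact_at_Comp_epic:
  assumes "exact_at C f g" "epic C e" "Cod C e = Dom C f"
  shows "exact_at C (f \<cdot> e) g"
proof -
  note fg = exact_at_Arr[OF assms(1)]
  define X Y Z V where "X = Dom C f" and "Y = Dom C g" and "Z = Cod C g" and "V = Dom C e"
  have f: "f \<in> Hom C X Y" and g: "g \<in> Hom C Y Z" and e: "e \<in> Hom C V X"
    using fg assms unfolding X_def Y_def Z_def V_def epic_def by (auto simp: Hom_def)
  have O: "Z \<in> Obj C" using Hom_Obj g by blast
  have gf: "g \<cdot> f = Zero C X Z"
    using exact_at_Comp[OF assms(1)] unfolding HomD(2)[OF f] HomD(3)[OF g] .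
  show ?thesis
  proof (rule exact_atI[OF Comp_Hom[OF e f] g])
    show "g \<cdot> (f \<cdot> e) = Zero C V Z"
      using Comp_assoc[OF e f g] gf Comp_Zero(2)[OF e O] by simp
    fix U W c x
    assume c: "c \<in> Hom C Y U" "c \<cdot> (f \<cdot> e) = Zero C V U" and x: "x \<in> Hom C W Y" "g \<cdot> x = Zero C W Z"
    have "(c \<cdot> f) \<cdot> e = Zero C V U" using c Comp_assoc[OF e f c(1)] by simp
    then have "c \<cdot> f = Zero C X U"
      using epic_Zero[OF assms(2), unfolded HomD(2,3)[OF e], OF Comp_Hom[OF f c(1)]] by simp
    then show "c \<cdot> x = Zero C W U" using exact_at_test[OF assms(1) f g x c(1)] by simp
  qed
qed

lemma exact_sequence_iff:
  "exact_sequence C fs \<longleftrightarrow>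
    fs \<noteq> [] \<and> monic C (hd fs) \<and> epic C (last fs) \<and> successively (exact_at C) fs"
  by (simp add: exact_sequence_def successively_conv_nth)

section \<open>Splicing and chain maps of extensions\<close>

text \<open>The Yoneda product: the common end object disappears because the epic onto it is
  composed with the monic out of it. An extension of degree 0 is an isomorphism, and splicing with
  it alters a single arrow.\<close>

definition splice_ext :: "'b list \<Rightarrow> 'b list \<Rightarrow> 'b list" where
  "splice_ext fs gs = butlast fs @ (hd gs \<cdot> last fs) # tl gs"

lemma monic_Arr: "monic C f \<Longrightarrow> f \<in> Arr C"
  by (simp add: monic_def)

lemma epic_Arr: "epic C f \<Longrightarrow> f \<in> Arr C"
  by (simp add: epic_def)

lemma splice_ext_extensions:
  assumes "fs \<in> extensions C i Z Y" "gs \<in> extensions C j X Z"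
  shows "splice_ext fs gs \<in> extensions C (i + j) X Y"
proof -
  have fs0: "fs \<noteq> []" and gs0: "gs \<noteq> []"
    using assms by (auto simp: extensions_def exact_sequence_def)
  obtain fs' a where fs: "fs = fs' @ [a]" using fs0 by (metis append_butlast_last_id)
  obtain b gs' where gs: "gs = b # gs'" using gs0 by (metis list.collapse)
  have F: "monic C (hd (fs' @ [a]))" "epic C a" "successively (exact_at C) (fs' @ [a])"
      "length fs' = i" "Dom C (hd (fs' @ [a])) = Y" "Cod C a = Z"
    and G: "monic C b" "epic C (last (b # gs'))" "successively (exact_at C) (b # gs')"
      "length gs' = j" "Dom C b = Z" "Cod C (last (b # gs')) = X"
    using assms unfolding extensions_def exact_sequence_iff fs gs by auto
  have ab: "a \<in> Arr C" "b \<in> Arr C" "Cod C a = Dom C b"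
    using F G monic_Arr epic_Arr by auto
  note c = Comp_Arr[OF ab]
  have s: "splice_ext fs gs = fs' @ (b \<cdot> a) # gs'"
    unfolding splice_ext_def fs gs by simp
  have "monic C (hd (fs' @ (b \<cdot> a) # gs'))" "Dom C (hd (fs' @ (b \<cdot> a) # gs')) = Y"
    using F G monic_Comp[OF _ G(1) ab(3)] c by (cases fs'; simp)+
  moreover have "epic C (last (fs' @ (b \<cdot> a) # gs'))" "Cod C (last (fs' @ (b \<cdot> a) # gs')) = X"
    using F G epic_Comp[OF F(2) _ ab(3)] c by (cases gs'; simp)+
  moreover have "successively (exact_at C) (fs' @ (b \<cdot> a) # gs')"
    using F(3) G(3) exact_at_monic_Comp[OF _ G(1) ab(3)] exact_at_Comp_epic[OF _ F(2) ab(3)]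
    by (auto simp: successively_append_iff successively_Cons)
  ultimately show ?thesis
    using F(4) G(4) unfolding s extensions_def exact_sequence_iff by simp
qed

lemma short_exact_extensions:
  "[k, p] \<in> extensions C (Suc 0) Q Y \<longleftrightarrow> (\<exists>Z. short_exact k p Y Z Q)"
proof
  assume "[k, p] \<in> extensions C (Suc 0) Q Y"
  then have kp: "monic C k" "epic C p" "exact_at C k p" "Dom C k = Y" "Cod C p = Q"
    by (auto simp: extensions_def exact_sequence_iff)
  note a = exact_at_Arr[OF kp(3)]
  have "k \<in> Hom C Y (Dom C p)" "p \<in> Hom C (Dom C p) Q" using kp a by (simp_all add: Hom_def)
  then show "\<exists>Z. short_exact k p Y Z Q" using kp unfolding short_exact_def by blast
next
  assume "\<exists>Z. short_exact k p Y Z Q"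
  then obtain Z where "short_exact k p Y Z Q" ..
  note s = short_exactD[OF this]
  show "[k, p] \<in> extensions C (Suc 0) Q Y"
    using s(3-5) HomD(2)[OF s(1)] HomD(3)[OF s(2)] by (simp add: extensions_def exact_sequence_iff)
qed

text \<open>Serves as the coresolution of length zero, which makes degree 1 an instance of the
  general criterion.\<close>

lemma Id_extensions: "Y \<in> Obj C \<Longrightarrow> [Id C Y] \<in> extensions C 0 Y Y"
  by (simp add: extensions_def exact_sequence_iff monic_Id epic_Id Id_Arr)

text \<open>Only the outer vertical arrows are arguments; the inner ones are hidden behind one
  existential quantifier per square. Morphisms can thus be built, cut and composed by induction on
  the lists.\<close>

fun chain_map :: "'b \<Rightarrow> 'b list \<Rightarrow> 'b list \<Rightarrow> 'b \<Rightarrow> bool" where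
  "chain_map a [] [] b \<longleftrightarrow> a = b"
| "chain_map a (f # fs) (g # gs) b \<longleftrightarrow>
    (\<exists>c. f \<in> Arr C \<and> g \<in> Arr C \<and> a \<in> Hom C (Dom C f) (Dom C g) \<and> c \<in> Hom C (Cod C f) (Cod C g) \<and>
      c \<cdot> f = g \<cdot> a \<and> chain_map c fs gs b)"
| "chain_map a _ _ b \<longleftrightarrow> False"

lemma chain_map_length: "chain_map a fs gs b \<Longrightarrow> length fs = length gs"
  by (induction a fs gs b rule: chain_map.induct) auto

lemma chain_map_append:
  "length fs = length gs \<Longrightarrow>
    chain_map a (fs @ fs') (gs @ gs') c \<longleftrightarrow> (\<exists>b. chain_map a fs gs b \<and> chain_map b fs' gs' c)"
  by (induction fs gs arbitrary: a rule: list_induct2) (simp, simp, blast)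

text \<open>The trailing \<open>f\<close> takes no part in the chain map; it names the object at the
  right end, also when \<open>fs\<close> is empty.\<close>

lemma chain_map_Id:
  assumes "successively (exact_at C) (fs @ [f])" "f \<in> Arr C"
  shows "chain_map (Id C (Dom C (hd (fs @ [f])))) fs fs (Id C (Dom C f))"
  using assms
proof (induction fs)
  case (Cons g fs)
  have g: "g \<in> Arr C" "Cod C g = Dom C (hd (fs @ [f]))" and s: "successively (exact_at C) (fs @ [f])"
    using Cons.prems exact_at_Arr[of g] by (auto simp: successively_Cons)
  have "Id C (Cod C g) \<in> Hom C (Cod C g) (Cod C g)" "Id C (Dom C g) \<in> Hom C (Dom C g) (Dom C g)"
    using Id_Hom Dom_Obj Cod_Obj g(1) by auto
  moreover have "Id C (Cod C g) \<cdot> g = g \<cdot> Id C (Dom C g)" using g Comp_Id_Arr by simp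
  ultimately show ?case using g Cons.IH[OF s Cons.prems(2)] by auto
qed simp

lemma chain_map_Comp:
  assumes "chain_map a fs gs b" "chain_map a' gs ks b'"
  shows "chain_map (a' \<cdot> a) fs ks (b' \<cdot> b)"
  using assms
proof (induction fs arbitrary: gs ks a a')
  case (Cons f fs)
  obtain g gs' k ks' where eqs: "gs = g # gs'" "ks = k # ks'"
    using Cons.prems(1,2) chain_map_length by (metis length_Suc_conv list.size(4) add_Suc_right)
  obtain c where c: "f \<in> Arr C" "g \<in> Arr C" "a \<in> Hom C (Dom C f) (Dom C g)" "c \<in> Hom C (Cod C f) (Cod C g)"
      "c \<cdot> f = g \<cdot> a" "chain_map c fs gs' b"
    using Cons.prems(1) eqs by auto
  obtain c' where c': "k \<in> Arr C" "a' \<in> Hom C (Dom C g) (Dom C k)" "c' \<in> Hom C (Cod C g) (Cod C k)"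
      "c' \<cdot> g = k \<cdot> a'" "chain_map c' gs' ks' b'"
    using Cons.prems(2) eqs by auto
  have h: "f \<in> Hom C (Dom C f) (Cod C f)" "g \<in> Hom C (Dom C g) (Cod C g)" "k \<in> Hom C (Dom C k) (Cod C k)"
    using c c' by (simp_all add: Hom_def)
  have "(c' \<cdot> c) \<cdot> f = c' \<cdot> (g \<cdot> a)" using Comp_assoc[OF h(1) c(4) c'(3)] c(5) by simp
  also have "\<dots> = (k \<cdot> a') \<cdot> a" using Comp_assoc[OF c(3) h(2) c'(3)] c'(4) by simp
  also have "\<dots> = k \<cdot> (a' \<cdot> a)" using Comp_assoc[OF c(3) c'(2) h(3)] by simp
  finally have eq: "(c' \<cdot> c) \<cdot> f = k \<cdot> (a' \<cdot> a)" .
  then show ?case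
    using Cons.IH[OF c(6) c'(5)] c c' eqs Comp_Hom[OF c(3) c'(2)] Comp_Hom[OF c(4) c'(3)] by auto
next
  case Nil
  then have "length gs = 0" using chain_map_length by fastforce
  moreover have "length ks = length gs" using Nil.prems(2) chain_map_length by metis
  ultimately show ?case using Nil by simp
qed

lemma chain_map_end_Hom:
  assumes "chain_map a fs gs b" "fs \<noteq> []"
  shows "b \<in> Hom C (Cod C (last fs)) (Cod C (last gs))"
  using assms
proof (induction a fs gs b rule: chain_map.induct)
  case (2 a f fs g gs b)
  then obtain c where c: "c \<in> Hom C (Cod C f) (Cod C g)" "chain_map c fs gs b" by auto
  show ?case
  proof (cases fs)
    case Nil
    then have "gs = []" using c(2) chain_map_length by fastforce
    then show ?thesis using Nil c by simp
  next
    case (Cons f' fs')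
    then have "gs \<noteq> []" using c(2) chain_map_length by fastforce
    then show ?thesis using "2.IH"[OF c(2)] Cons by simp
  qed
qed auto

text \<open>The comparison theorem for injective inner terms. The arrow \<open>f0\<close> stands in
  front of \<open>fs\<close>, and the zero composite in the last hypothesis is the invariant of the
  induction: it allows \<open>hd gs \<cdot> a\<close> to extend along the first arrow of
  \<open>fs\<close>.\<close>

lemma chain_map_exists:
  assumes "successively (exact_at C) (f0 # fs)" "fs \<noteq> []" "epic C (last fs)" "length gs = length fs"
    "successively (exact_at C) gs" "\<forall>g\<in>set (tl gs). injective_object C (Dom C g)" "hd gs \<in> Arr C"
    "a \<in> Hom C (Cod C f0) (Dom C (hd gs))" "hd gs \<cdot> (a \<cdot> f0) = Zero C (Dom C f0) (Cod C (hd gs))"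
  shows "\<exists>b. chain_map a fs gs b"
  using assms
proof (induction fs arbitrary: f0 gs a)
  case (Cons f fs)
  obtain g gs' where gs: "gs = g # gs'" using Cons.prems(4) by (cases gs) auto
  have ex: "exact_at C f0 f" "successively (exact_at C) (f # fs)"
    using Cons.prems(1) by auto
  note f = exact_at_Arr[OF ex(1)]
  have g: "g \<in> Arr C" using Cons.prems(7) gs by simp
  have f0': "f0 \<in> Hom C (Dom C f0) (Dom C f)" and f': "f \<in> Hom C (Dom C f) (Cod C f)"
    and g': "g \<in> Hom C (Dom C g) (Cod C g)" and a: "a \<in> Hom C (Dom C f) (Dom C g)"
    using f g Cons.prems(8) gs by (simp_all add: Hom_def)
  have ga: "g \<cdot> a \<in> Hom C (Dom C f) (Cod C g)" using Comp_Hom[OF a g'] .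
  have ga0: "(g \<cdot> a) \<cdot> f0 = Zero C (Dom C f0) (Cod C g)"
    using Cons.prems(9) gs Comp_assoc[OF f0' a g'] by simp
  show ?case
  proof (cases fs)
    \<comment> \<open>The last target is not among the injective terms; here the epic
      \<open>f\<close> lets \<open>g \<cdot> a\<close> descend.\<close>
    case Nil
    then have "gs' = []" using Cons.prems(4) gs by simp
    obtain c where "c \<in> Hom C (Cod C f) (Cod C g)" "c \<cdot> f = g \<cdot> a"
      using exact_at_epic_factor[OF ex(1) _ f0' f' ga ga0] Cons.prems(3) Nil by auto
    then show ?thesis using Nil \<open>gs' = []\<close> f g a gs by auto
  next
    case (Cons f1 fs1)
    then obtain g1 gs1 where gs': "gs' = g1 # gs1" using Cons.prems(4) gs by (cases gs') auto
    have eg: "exact_at C g g1" using Cons.prems(5) gs gs' by simp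
    note g1 = exact_at_Arr[OF eg]
    have inj: "injective_object C (Cod C g)" using Cons.prems(6) gs gs' g1 by simp
    obtain c where c: "c \<in> Hom C (Cod C f) (Cod C g)" "c \<cdot> f = g \<cdot> a"
      using injective_extend[OF ex(1) f0' f' inj ga ga0] .
    have g1': "g1 \<in> Hom C (Cod C g) (Cod C g1)" using g1 by (simp add: Hom_def)
    have "g1 \<cdot> (c \<cdot> f) = (g1 \<cdot> g) \<cdot> a" using c Comp_assoc[OF a g' g1'] by simp
    also have "\<dots> = Zero C (Dom C f) (Cod C g1)"
      using exact_at_Comp[OF eg] Comp_Zero(2)[OF a] Cod_Obj[OF g1(2)] by simp
    finally have "\<exists>b. chain_map c fs gs' b"
      using Cons.IH[OF ex(2), of gs' c] Cons.prems Cons gs gs' g1 c by simp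
    then show ?thesis using f g a c gs by auto
  qed
qed simp

text \<open>
  The homotopy is built along with the induction: \<open>s\<close> is the component of the null-homotopy of the
  difference of the two chain maps that has been constructed so far.
\<close>

lemma chain_map_unique_aux:
  assumes "successively (exact_at C) (f0 # fs)" "fs \<noteq> []" "epic C (last fs)"
    "successively (exact_at C) (g0 # gs)" "\<forall>g\<in>set gs. injective_object C (Dom C g)"
    "chain_map a fs gs b" "chain_map a' fs gs b'"
    "s \<in> Hom C (Cod C f0) (Dom C g0)" "a \<cdot> f0 = Add C a' (g0 \<cdot> s) \<cdot> f0"
  shows "\<exists>t\<in>Hom C (Cod C (last fs)) (Dom C (last gs)). b = Add C b' (last gs \<cdot> t)"
  using assms
proof (induction fs arbitrary: f0 g0 gs a a' s)
  case (Cons f fs)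
  obtain g gs' where gs: "gs = g # gs'"
    using Cons.prems(6) chain_map_length by (metis length_Suc_conv list.size(4) add_Suc_right)
  have ex: "exact_at C f0 f" "successively (exact_at C) (f # fs)"
    and eg: "exact_at C g0 g" "successively (exact_at C) (g # gs')"
    using Cons.prems(1,4) gs by auto
  note f = exact_at_Arr[OF ex(1)] and g = exact_at_Arr[OF eg(1)]
  have f0': "f0 \<in> Hom C (Dom C f0) (Dom C f)" and f': "f \<in> Hom C (Dom C f) (Cod C f)"
    and g0': "g0 \<in> Hom C (Dom C g0) (Dom C g)" and g': "g \<in> Hom C (Dom C g) (Cod C g)"
    and s: "s \<in> Hom C (Dom C f) (Dom C g0)"
    using f g Cons.prems(8) by (simp_all add: Hom_def)
  obtain c where c: "a \<in> Hom C (Dom C f) (Dom C g)" "c \<in> Hom C (Cod C f) (Cod C g)"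
      "c \<cdot> f = g \<cdot> a" "chain_map c fs gs' b"
    using Cons.prems(6) gs by auto
  obtain c' where c': "a' \<in> Hom C (Dom C f) (Dom C g)" "c' \<in> Hom C (Cod C f) (Cod C g)"
      "c' \<cdot> f = g \<cdot> a'" "chain_map c' fs gs' b'"
    using Cons.prems(7) gs by auto
  have inj: "injective_object C (Dom C g)" using Cons.prems(5) gs by simp
  \<comment> \<open>\<open>a2\<close> is \<open>a'\<close> corrected by the homotopy found so far.
    It agrees with \<open>a\<close> after composition with \<open>f0\<close>, and \<open>g\<close>
    sends it to the same arrow as \<open>a'\<close>. So the difference of \<open>a\<close> and
    \<open>a2\<close> kills \<open>f0\<close> and extends along \<open>f\<close> to the next
    component \<open>t\<close>.\<close>
  define a2 where "a2 = Add C a' (g0 \<cdot> s)"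
  have gs0: "g0 \<cdot> s \<in> Hom C (Dom C f) (Dom C g)" using Comp_Hom[OF s g0'] .
  have a2: "a2 \<in> Hom C (Dom C f) (Dom C g)" unfolding a2_def using Add_Hom[OF c'(1) gs0] .
  have "g \<cdot> (g0 \<cdot> s) = (g \<cdot> g0) \<cdot> s" using Comp_assoc[OF s g0' g'] .
  also have "\<dots> = Zero C (Dom C f) (Cod C g)"
    using exact_at_Comp[OF eg(1)] Comp_Zero(2)[OF s] Cod_Obj[OF g(2)] by simp
  finally have ga2: "g \<cdot> a2 = g \<cdot> a'"
    unfolding a2_def using Comp_Add_right[OF c'(1) gs0 g'] Add_Zero(1)[OF Comp_Hom[OF c'(1) g']] by simp
  have u: "Sub a a2 \<in> Hom C (Dom C f) (Dom C g)" using Sub_Hom[OF c(1) a2] .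
  have "Sub a a2 \<cdot> f0 = Zero C (Dom C f0) (Dom C g)"
    using Sub_Comp[OF f0' c(1) a2] Sub_eq_Zero[OF Comp_Hom[OF f0' c(1)] Comp_Hom[OF f0' a2]]
      Cons.prems(9) unfolding a2_def by simp
  then obtain t where t: "t \<in> Hom C (Cod C f) (Dom C g)" "t \<cdot> f = Sub a a2"
    using injective_extend[OF ex(1) f0' f' inj u] by blast
  have gt: "g \<cdot> t \<in> Hom C (Cod C f) (Cod C g)" using Comp_Hom[OF t(1) g'] .
  have "Add C c' (g \<cdot> t) \<cdot> f = Add C (g \<cdot> a2) (g \<cdot> Sub a a2)"
    using Comp_Add_left[OF f' c'(2) gt] Comp_assoc[OF f' t(1) g'] t(2) c'(3) ga2 by simp
  also have "\<dots> = g \<cdot> Add C (Sub a a2) a2"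
    using Comp_Add_right[OF u a2 g'] Add_commute[OF Comp_Hom[OF u g'] Comp_Hom[OF a2 g']] by simp
  also have "\<dots> = c \<cdot> f" using Sub_Add[OF c(1) a2] c(3) by simp
  finally have eq: "c \<cdot> f = Add C c' (g \<cdot> t) \<cdot> f" by simp
  show ?case
  proof (cases fs)
    case Nil
    then have gs'0: "gs' = []" using c(4) chain_map_length by fastforce
    \<comment> \<open>At the right end \<open>f\<close> can be cancelled, and the homotopy equation
      holds for the end arrows themselves.\<close>
    have "epic C f" using Cons.prems(3) Nil by simp
    then have "c = Add C c' (g \<cdot> t)"
      using epic_cancel[OF _ c(2) Add_Hom[OF c'(2) gt] eq] by simp
    then show ?thesis using t c c' Nil gs gs'0 by auto
  next
    case (Cons f1 fs1)
    then have "gs' \<noteq> []" using c(4) chain_map_length by fastforce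
    then show ?thesis
      using Cons.IH[OF ex(2) _ _ eg(2) _ c(4) c'(4) t(1) eq] Cons.prems(3,5) Cons gs by simp
  qed
qed simp

lemma chain_map_exists_extensions:
  assumes "fs \<in> extensions C (Suc m) X Y" "gs \<in> extensions C (Suc m) S Y"
    "\<forall>g\<in>set (tl gs). injective_object C (Dom C g)"
  shows "\<exists>b. chain_map (Id C Y) fs gs b"
proof -
  have F: "fs \<noteq> []" "monic C (hd fs)" "epic C (last fs)" "successively (exact_at C) fs"
      "Dom C (hd fs) = Y" "length fs = Suc (Suc m)"
    and G: "gs \<noteq> []" "monic C (hd gs)" "successively (exact_at C) gs"
      "Dom C (hd gs) = Y" "length gs = Suc (Suc m)"
    using assms by (auto simp: extensions_def exact_sequence_iff)
  have f: "hd fs \<in> Hom C Y (Cod C (hd fs))" and g: "hd gs \<in> Hom C Y (Cod C (hd gs))"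
    using F G monic_Arr by (simp_all add: Hom_def)
  have Y: "Y \<in> Obj C" using Hom_Obj[OF f] by simp
  \<comment> \<open>The comparison theorem expects an arrow in front of the sequence. The zero arrow
    on \<open>Y\<close> serves, since monicity of \<open>hd fs\<close> is exactness at
    \<open>Y\<close>.\<close>
  define z where "z = Zero C Y Y"
  have z: "z \<in> Hom C Y Y" unfolding z_def using Zero_Hom Y by simp
  have "exact_at C z (hd fs)"
  proof (rule exact_atI[OF z f])
    show "hd fs \<cdot> z = Zero C Y (Cod C (hd fs))" unfolding z_def using Comp_Zero(1)[OF f Y] .
    fix V W c x
    assume c: "c \<in> Hom C Y V" and x: "x \<in> Hom C W Y" "hd fs \<cdot> x = Zero C W (Cod C (hd fs))"
    have "x = Zero C W Y" using monic_Zero[OF F(2)] F(5) x by simp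
    then show "c \<cdot> x = Zero C W V" using Comp_Zero(1)[OF c] Hom_Obj[OF x(1)] by simp
  qed
  then have ex: "successively (exact_at C) (z # fs)"
    using F(1,4) by (cases fs) auto
  have "Id C Y \<cdot> z = z" using Comp_Id_left[OF z] .
  moreover have "hd gs \<cdot> z = Zero C Y (Cod C (hd gs))" unfolding z_def using Comp_Zero(1)[OF g Y] .
  ultimately show ?thesis
    using chain_map_exists[OF ex F(1,3) _ G(3) assms(3), of "Id C Y"] F G Id_Hom[OF Y]
      HomD[OF z] HomD(1)[OF g] by simp
qed

text \<open>Both chain maps are the identity at \<open>Y\<close>, so the homotopy can start with the
  zero arrow into \<open>Y\<close>.\<close>

lemma chain_map_unique_extensions:
  assumes "fs \<in> extensions C (Suc m) X Y" "gs \<in> extensions C (Suc m) S Y"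
    "\<forall>g\<in>set (tl gs). injective_object C (Dom C g)"
    "chain_map (Id C Y) fs gs b" "chain_map (Id C Y) fs gs b'"
  shows "\<exists>t\<in>Hom C X (Dom C (last gs)). b = Add C b' (last gs \<cdot> t)"
proof -
  have F: "epic C (last fs)" "successively (exact_at C) fs" "Cod C (last fs) = X"
      "Dom C (hd fs) = Y" "length fs = Suc (Suc m)"
    and G: "successively (exact_at C) gs" "Dom C (hd gs) = Y" "length gs = Suc (Suc m)"
    using assms by (auto simp: extensions_def exact_sequence_iff)
  obtain f f1 fs' where fs: "fs = f # f1 # fs'" using F(5) by (auto simp: length_Suc_conv)
  obtain g g1 gs' where gs: "gs = g # g1 # gs'" using G(3) by (auto simp: length_Suc_conv)
  obtain c where c: "f \<in> Arr C" "g \<in> Arr C" "c \<in> Hom C (Cod C f) (Cod C g)"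
      "c \<cdot> f = g \<cdot> Id C Y" "chain_map c (f1 # fs') (g1 # gs') b"
    using assms(4) unfolding fs gs chain_map.simps(2)[of "Id C Y"] by blast
  obtain c' where c': "c' \<in> Hom C (Cod C f) (Cod C g)"
      "c' \<cdot> f = g \<cdot> Id C Y" "chain_map c' (f1 # fs') (g1 # gs') b'"
    using assms(5) unfolding fs gs chain_map.simps(2)[of "Id C Y"] by blast
  have O: "Cod C f \<in> Obj C" "Y \<in> Obj C" using Cod_Obj Dom_Obj c(1) F(4) fs by auto
  have g: "g \<in> Hom C Y (Cod C g)" using c(2) G(2) gs by (simp add: Hom_def)
  have s: "Zero C (Cod C f) Y \<in> Hom C (Cod C f) (Dom C g)" using Zero_Hom[OF O] HomD(2)[OF g] by simp
  have "Add C c' (g \<cdot> Zero C (Cod C f) Y) = c'"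
    using Comp_Zero(1)[OF g O(1)] Add_Zero(1)[OF c'(1)] by simp
  then have "c \<cdot> f = Add C c' (g \<cdot> Zero C (Cod C f) Y) \<cdot> f" using c(4) c'(2) by simp
  from chain_map_unique_aux[OF _ _ _ _ _ c(5) c'(3) s this] F G assms(3)
  show ?thesis unfolding fs gs by simp
qed

section \<open>Chain maps and morphisms of extensions\<close>

lemma extensions_Obj:
  assumes "fs \<in> extensions C i X Y"
  shows "X \<in> Obj C" "Y \<in> Obj C"
  using assms Cod_Obj[OF epic_Arr] Dom_Obj[OF monic_Arr]
  by (auto simp: extensions_def exact_sequence_iff)

lemma chain_map_imp_ext_morphism:
  assumes "fs \<in> extensions C i X Y" "gs \<in> extensions C i X Y" "chain_map (Id C Y) fs gs (Id C X)"
  shows "(fs, gs) \<in> ext_morphism_rel C i X Y"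
proof -
  have *: "\<exists>h. h 0 = a \<and> h (length fs) = b \<and> (\<forall>j<length fs. h j \<in> Hom C (Dom C (fs ! j)) (Dom C (gs ! j)) \<and>
      h (Suc j) \<cdot> (fs ! j) = (gs ! j) \<cdot> h j)" if "chain_map a fs gs b" for a b fs gs
    using that
  proof (induction a fs gs b rule: chain_map.induct)
    case (2 a f fs g gs b)
    then obtain c where c: "a \<in> Hom C (Dom C f) (Dom C g)" "c \<cdot> f = g \<cdot> a" "chain_map c fs gs b"
      by auto
    then obtain h where h: "h 0 = c" "h (length fs) = b"
        "\<forall>j<length fs. h j \<in> Hom C (Dom C (fs ! j)) (Dom C (gs ! j)) \<and> h (Suc j) \<cdot> (fs ! j) = (gs ! j) \<cdot> h j"
      using "2.IH" by blast
    \<comment> \<open>The new vertical arrow is put in front and shifts the others by one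
      index.\<close>
    have "case_nat a h 0 = a" "case_nat a h (length (f # fs)) = b" using h by simp_all
    moreover have "case_nat a h j \<in> Hom C (Dom C ((f # fs) ! j)) (Dom C ((g # gs) ! j)) \<and>
      case_nat a h (Suc j) \<cdot> ((f # fs) ! j) = ((g # gs) ! j) \<cdot> case_nat a h j" if "j < length (f # fs)" for j
      using that h c by (cases j) auto
    ultimately show ?case by blast
  qed auto
  have len: "length fs = Suc i" using assms by (simp add: extensions_def)
  obtain h where "h 0 = Id C Y" "h (Suc i) = Id C X"
      "\<forall>j\<le>i. h j \<in> Hom C (Dom C (fs ! j)) (Dom C (gs ! j)) \<and> h (Suc j) \<cdot> (fs ! j) = (gs ! j) \<cdot> h j"
    using *[OF assms(3)] unfolding len less_Suc_eq_le by blast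
  then show ?thesis unfolding ext_morphism_rel_def using assms(1,2) by blast
qed

lemma ext_morphism_imp_chain_map:
  assumes "(fs, gs) \<in> ext_morphism_rel C i X Y"
  shows "chain_map (Id C Y) fs gs (Id C X)"
proof -
  \<comment> \<open>\<open>ext_morphism_rel\<close> types the components at the domains only. The
    type of the last component is therefore a premise of its own; in the application it is the
    identity of \<open>X\<close>.\<close>
  have *: "chain_map (h 0) fs gs (h (length fs))"
    if "length fs = length gs" "successively (exact_at C) fs" "successively (exact_at C) gs"
      "\<forall>f\<in>set fs \<union> set gs. f \<in> Arr C"
      "\<forall>j<length fs. h j \<in> Hom C (Dom C (fs ! j)) (Dom C (gs ! j)) \<and> h (Suc j) \<cdot> (fs ! j) = (gs ! j) \<cdot> h j"
      "fs \<noteq> [] \<longrightarrow> h (length fs) \<in> Hom C (Cod C (last fs)) (Cod C (last gs))"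
    for h and fs gs :: "'b list"
    using that
  proof (induction fs gs arbitrary: h rule: list_induct2)
    case (Cons f fs g gs)
    have h: "h j \<in> Hom C (Dom C ((f # fs) ! j)) (Dom C ((g # gs) ! j)) \<and>
        h (Suc j) \<cdot> ((f # fs) ! j) = ((g # gs) ! j) \<cdot> h j" if "j \<le> length fs" for j
      using Cons.prems(4) that by simp
    have "h (Suc 0) \<in> Hom C (Cod C f) (Cod C g)"
    proof (cases fs)
      case Nil
      then show ?thesis using Cons.prems(5) Cons.hyps by simp
    next
      case (Cons f1 fs1)
      then obtain g1 gs1 where gs: "gs = g1 # gs1" using \<open>length fs = length gs\<close> by (cases gs) auto
      have "Cod C f = Dom C f1" "Cod C g = Dom C g1"
        using Cons.prems(1,2) Cons gs exact_at_Arr(3) by auto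
      then show ?thesis using h[of "Suc 0"] Cons gs by simp
    qed
    moreover have "chain_map (h (Suc 0)) fs gs (h (Suc (length fs)))"
    proof (rule Cons.IH[of "\<lambda>j. h (Suc j)"])
      show "successively (exact_at C) fs" "successively (exact_at C) gs"
        using Cons.prems(1,2) by (auto simp: successively_Cons)
      show "fs \<noteq> [] \<longrightarrow> h (Suc (length fs)) \<in> Hom C (Cod C (last fs)) (Cod C (last gs))"
        using Cons.prems(5) Cons.hyps by (cases gs) auto
    qed (use Cons.prems(3) h[of "Suc _"] in auto)
    ultimately show ?case using h[of 0] Cons.prems(3) by auto
  qed simp
  have arr: "\<forall>f\<in>set fs. f \<in> Arr C" if "exact_sequence C fs" for fs
  proof
    fix f assume "f \<in> set fs"
    then obtain xs ys where fs: "fs = xs @ f # ys" by (auto simp: in_set_conv_decomp)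
    show "f \<in> Arr C"
    proof (cases ys)
      case Nil
      then show ?thesis using that fs epic_Arr by (simp add: exact_sequence_iff)
    next
      case (Cons y ys')
      then show ?thesis using that fs exact_at_Arr(1)[of f y]
        by (simp add: exact_sequence_iff successively_append_iff)
    qed
  qed
  obtain h where fs: "fs \<in> extensions C i X Y" and gs: "gs \<in> extensions C i X Y"
    and h: "h 0 = Id C Y" "h (Suc i) = Id C X"
      "\<forall>j\<le>i. h j \<in> Hom C (Dom C (fs ! j)) (Dom C (gs ! j)) \<and> h (Suc j) \<cdot> (fs ! j) = (gs ! j) \<cdot> h j"
    using assms unfolding ext_morphism_rel_def by blast
  have F: "length fs = Suc i" "length gs = Suc i" "exact_sequence C fs" "exact_sequence C gs"
      "Cod C (last fs) = X" "Cod C (last gs) = X"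
    using fs gs by (auto simp: extensions_def)
  have "chain_map (h 0) fs gs (h (length fs))"
  proof (rule *)
    show "successively (exact_at C) fs" "successively (exact_at C) gs"
      using F by (auto simp: exact_sequence_iff)
    show "\<forall>f\<in>set fs \<union> set gs. f \<in> Arr C" using arr F by auto
    show "fs \<noteq> [] \<longrightarrow> h (length fs) \<in> Hom C (Cod C (last fs)) (Cod C (last gs))"
      using F h(2) Id_Hom extensions_Obj[OF fs] by simp
  qed (use F h(3) in \<open>simp_all add: less_Suc_eq_le\<close>)
  then show ?thesis using h F(1) by simp
qed

section \<open>Trivial extensions\<close>

lemma zero_object_arrow:
  assumes "is_zero_object C O0"
  shows "f \<in> Hom C X O0 \<Longrightarrow> f = Zero C X O0" "f \<in> Hom C O0 X \<Longrightarrow> f = Zero C O0 X"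
proof -
  have O: "O0 \<in> Obj C" using assms by (simp add: is_zero_object_def)
  show "f = Zero C X O0" if f: "f \<in> Hom C X O0"
    using assms f Zero_Hom[of X O0] O Hom_Obj[OF f] unfolding is_zero_object_def by blast
  show "f = Zero C O0 X" if f: "f \<in> Hom C O0 X"
    using assms f Zero_Hom[of O0 X] O Hom_Obj[OF f] unfolding is_zero_object_def by blast
qed

lemma short_exact_to_zero:
  assumes "is_zero_object C O0" "Y \<in> Obj C"
  shows "short_exact (Id C Y) (Zero C Y O0) Y Y O0"
proof (rule short_exactI)
  have O: "O0 \<in> Obj C" using assms by (simp add: is_zero_object_def)
  show Z: "Zero C Y O0 \<in> Hom C Y O0" using Zero_Hom O assms by simp
  show "Id C Y \<in> Hom C Y Y" "monic C (Id C Y)" using assms Id_Hom monic_Id by auto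
  show "Zero C Y O0 \<cdot> Id C Y = Zero C Y O0" using Comp_Id_right[OF Z] .
  show "epic C (Zero C Y O0)"
    by (rule epicI[OF Z]) (use zero_object_arrow(2)[OF assms(1)] in blast)
  show "\<exists>u\<in>Hom C W Y. Id C Y \<cdot> u = x" if "x \<in> Hom C W Y" for W x
    using that Comp_Id_left by blast
qed

lemma short_exact_from_zero:
  assumes "is_zero_object C O0" "X \<in> Obj C"
  shows "short_exact (Zero C O0 X) (Id C X) O0 X X"
proof (rule short_exactI)
  have O: "O0 \<in> Obj C" using assms by (simp add: is_zero_object_def)
  show Z: "Zero C O0 X \<in> Hom C O0 X" using Zero_Hom O assms by simp
  show I: "Id C X \<in> Hom C X X" "epic C (Id C X)" using assms Id_Hom epic_Id by auto
  show "Id C X \<cdot> Zero C O0 X = Zero C O0 X" using Comp_Id_left[OF Z] .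
  show "monic C (Zero C O0 X)"
    by (rule monicI[OF Z]) (use zero_object_arrow(1)[OF assms(1)] in blast)
  show "\<exists>u\<in>Hom C W O0. Zero C O0 X \<cdot> u = x"
    if "x \<in> Hom C W X" "Id C X \<cdot> x = Zero C W X" for W x
  proof -
    have "x = Zero C W X" "W \<in> Obj C" using that Comp_Id_left Hom_Obj by auto
    then show ?thesis using Zero_Hom[OF _ O] Comp_Zero(1)[OF Z] by blast
  qed
qed

abbreviation zero_arrow :: "'b \<Rightarrow> bool" where
  "zero_arrow f \<equiv> f = Zero C (Dom C f) (Cod C f)"

text \<open>The tail of a trivial extension of higher degree, from the first zero object on. Each
  step of the induction splices an exact sequence of zero objects in front.\<close>

lemma zero_object_extension:
  assumes "is_zero_object C O0" "X \<in> Obj C"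
  shows "\<exists>zs. zs \<noteq> [] \<and> (\<forall>z\<in>set zs. zero_arrow z) \<and> zs @ [Id C X] \<in> extensions C (Suc i) X O0"
proof (induction i)
  case 0
  have O: "O0 \<in> Obj C" using assms by (simp add: is_zero_object_def)
  have "[Zero C O0 X, Id C X] \<in> extensions C (Suc 0) X O0"
    using short_exact_from_zero[OF assms] short_exact_extensions by blast
  then show ?case using Zero_Arr[OF O assms(2)] by (intro exI[of _ "[Zero C O0 X]"]) simp
next
  case (Suc i)
  have O: "O0 \<in> Obj C" using assms by (simp add: is_zero_object_def)
  obtain zs where zs: "zs \<noteq> []" "\<forall>z\<in>set zs. zero_arrow z" "zs @ [Id C X] \<in> extensions C (Suc i) X O0"
    using Suc by blast
  obtain z zs' where z: "zs = z # zs'" using zs(1) by (cases zs) auto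
  have "[Id C O0, Zero C O0 O0] \<in> extensions C (Suc 0) O0 O0"
    using short_exact_to_zero[OF assms(1) O] short_exact_extensions by blast
  from splice_ext_extensions[OF this zs(3)]
  have e: "(Id C O0 # (z \<cdot> Zero C O0 O0) # zs') @ [Id C X] \<in> extensions C (Suc (Suc i)) X O0"
    by (simp add: splice_ext_def z)
  have zz: "z \<in> Arr C" "Dom C z = O0"
    using zs(3) z monic_Arr by (auto simp: extensions_def exact_sequence_iff)
  have "z \<cdot> Zero C O0 O0 = Zero C O0 (Cod C z)" using Comp_Zero_Arr(1)[OF zz(1) O zz(2)] .
  then have "zero_arrow (z \<cdot> Zero C O0 O0)" using Zero_Arr[OF O Cod_Obj[OF zz(1)]] by simp
  moreover have "zero_arrow (Id C O0)"
    using zero_object_arrow(1)[OF assms(1) Id_Hom[OF O]] Id_Arr[OF O] by simp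
  ultimately show ?case
    using e zs(2) z by (intro exI[of _ "Id C O0 # (z \<cdot> Zero C O0 O0) # zs'"]) simp
qed

lemma biproduct_short_exact:
  assumes "is_biproduct C Y X P i1 i2 p1 p2"
  shows "short_exact i1 p2 Y P X"
proof (rule short_exactI)
  have b: "i1 \<in> Hom C Y P" "i2 \<in> Hom C X P" "p1 \<in> Hom C P Y" "p2 \<in> Hom C P X"
      "p1 \<cdot> i1 = Id C Y" "p2 \<cdot> i2 = Id C X" "p2 \<cdot> i1 = Zero C Y X"
      "Add C (i1 \<cdot> p1) (i2 \<cdot> p2) = Id C P"
    using assms by (auto simp: is_biproduct_def)
  show "i1 \<in> Hom C Y P" "p2 \<in> Hom C P X" "p2 \<cdot> i1 = Zero C Y X" by (rule b)+
  show "monic C i1"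
  proof (rule monicI[OF b(1)])
    fix W x assume x: "x \<in> Hom C W Y" "i1 \<cdot> x = Zero C W P"
    have "x = p1 \<cdot> (i1 \<cdot> x)" using Comp_assoc[OF x(1) b(1,3)] b(5) Comp_Id_left[OF x(1)] by simp
    then show "x = Zero C W Y" using x Comp_Zero(1)[OF b(3)] Hom_Obj[OF x(1)] by simp
  qed
  show "epic C p2"
  proof (rule epicI[OF b(4)])
    fix W x assume x: "x \<in> Hom C X W" "x \<cdot> p2 = Zero C P W"
    have "x = (x \<cdot> p2) \<cdot> i2" using Comp_assoc[OF b(2,4) x(1)] b(6) Comp_Id_right[OF x(1)] by simp
    then show "x = Zero C X W" using x Comp_Zero(2)[OF b(2)] Hom_Obj[OF x(1)] by simp
  qed
  fix W x assume x: "x \<in> Hom C W P" "p2 \<cdot> x = Zero C W X"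
  have "x = Add C (i1 \<cdot> p1) (i2 \<cdot> p2) \<cdot> x" using b(8) Comp_Id_left[OF x(1)] by simp
  also have "\<dots> = Add C (i1 \<cdot> (p1 \<cdot> x)) (i2 \<cdot> (p2 \<cdot> x))"
    using Comp_Add_left[OF x(1) Comp_Hom[OF b(3,1)] Comp_Hom[OF b(4,2)]]
      Comp_assoc[OF x(1) b(3,1)] Comp_assoc[OF x(1) b(4,2)] by simp
  also have "\<dots> = i1 \<cdot> (p1 \<cdot> x)"
    using x(2) Comp_Zero(1)[OF b(2)] Hom_Obj[OF x(1)] Add_Zero(1)[OF Comp_Hom[OF Comp_Hom[OF x(1) b(3)] b(1)]]
    by simp
  finally show "\<exists>u\<in>Hom C W Y. i1 \<cdot> u = x" using Comp_Hom[OF x(1) b(3)] by metis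
qed

text \<open>Trades indices for a list shape on which an induction along the zero arrows can run. The
  list \<open>zs\<close> is nonempty because the degree is at least 2.\<close>

lemma trivial_extension_higher:
  "trivial_extension C (Suc (Suc i)) X Y ts \<longleftrightarrow> ts \<in> extensions C (Suc (Suc i)) X Y \<and>
    (\<exists>zs. zs \<noteq> [] \<and> (\<forall>z\<in>set zs. zero_arrow z) \<and> ts = Id C Y # zs @ [Id C X])"
  (is "?L \<longleftrightarrow> ?R")
proof
  assume ?L
  then have ts: "ts \<in> extensions C (Suc (Suc i)) X Y" "ts ! 0 = Id C Y" "ts ! Suc (Suc i) = Id C X"
      "\<And>j. 0 < j \<Longrightarrow> j < Suc (Suc i) \<Longrightarrow> zero_arrow (ts ! j)"
    by (auto simp: trivial_extension_def)
  have len: "length ts = Suc (Suc (Suc i))" using ts(1) by (simp add: extensions_def)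
  define zs where "zs = butlast (tl ts)"
  have lz: "length zs = Suc i" using len by (simp add: zs_def)
  have dec: "ts = Id C Y # zs @ [Id C X]"
  proof (rule nth_equalityI)
    show "length ts = length (Id C Y # zs @ [Id C X])" using len lz by simp
    fix j assume j: "j < length ts"
    show "ts ! j = (Id C Y # zs @ [Id C X]) ! j"
    proof (cases j)
      case 0
      then show ?thesis using ts by simp
    next
      case (Suc k)
      then show ?thesis using j len lz ts(3)
        by (cases "k = Suc i") (auto simp: nth_append zs_def nth_butlast nth_tl)
    qed
  qed
  have "zero_arrow z" if "z \<in> set zs" for z
  proof -
    obtain k where k: "k < length zs" "z = zs ! k" using \<open>z \<in> set zs\<close> in_set_conv_nth[of z zs] by metis
    have "z = ts ! Suc k" using dec k by (simp add: nth_append)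
    then show ?thesis using ts(4)[of "Suc k"] k lz by simp
  qed
  then show ?R using ts(1) dec lz by (intro conjI exI[of _ zs]) auto
next
  assume ?R
  then obtain zs where ts: "ts \<in> extensions C (Suc (Suc i)) X Y" "\<forall>z\<in>set zs. zero_arrow z"
      "ts = Id C Y # zs @ [Id C X]"
    by blast
  have lz: "length zs = Suc i" using ts(1) unfolding ts(3) by (simp add: extensions_def)
  have "zero_arrow (ts ! j)" if "0 < j" "j < Suc (Suc i)" for j
  proof -
    obtain k where k: "j = Suc k" "k < length zs" using \<open>0 < j\<close> \<open>j < _\<close> lz by (cases j) auto
    have "ts ! j = zs ! k" unfolding ts(3) using k by (simp add: nth_append)
    then show ?thesis using ts(2) k by (simp add: nth_mem)
  qed
  moreover have "ts ! Suc (Suc i) = Id C X" unfolding ts(3) by (simp add: lz[symmetric])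
  ultimately show ?L using ts by (auto simp: trivial_extension_def)
qed

text \<open>A biproduct in degree 1; in higher degrees, the identity of \<open>Y\<close> followed by
  the zero arrow to a zero object, spliced with a tail of zero arrows.\<close>

lemma trivial_extension_exists:
  assumes "X \<in> Obj C" "Y \<in> Obj C"
  shows "\<exists>ts. trivial_extension C (Suc i) X Y ts"
proof (cases i)
  case 0
  obtain P i1 i2 p1 p2 where b: "is_biproduct C Y X P i1 i2 p1 p2" using ex_biproduct assms by blast
  have "[i1, p2] \<in> extensions C (Suc 0) X Y"
    using biproduct_short_exact[OF b] short_exact_extensions by blast
  then have "trivial_extension C (Suc 0) X Y [i1, p2]"
    using b by (auto simp: trivial_extension_def)
  then show ?thesis using 0 by blast
next
  case (Suc k)
  obtain O0 where O0: "is_zero_object C O0" using ex_zero_object by blast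
  have O: "O0 \<in> Obj C" using O0 by (simp add: is_zero_object_def)
  obtain zs where zs: "zs \<noteq> []" "\<forall>z\<in>set zs. zero_arrow z" "zs @ [Id C X] \<in> extensions C (Suc k) X O0"
    using zero_object_extension[OF O0 assms(1)] by blast
  obtain z zs' where z: "zs = z # zs'" using zs(1) by (cases zs) auto
  have "[Id C Y, Zero C Y O0] \<in> extensions C (Suc 0) O0 Y"
    using short_exact_to_zero[OF O0 assms(2)] short_exact_extensions by blast
  from splice_ext_extensions[OF this zs(3)]
  have e: "Id C Y # ((z \<cdot> Zero C Y O0) # zs') @ [Id C X] \<in> extensions C (Suc (Suc k)) X Y"
    by (simp add: splice_ext_def z)
  have zz: "z \<in> Arr C" "Dom C z = O0"
    using zs(3) z monic_Arr by (auto simp: extensions_def exact_sequence_iff)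
  have "z \<cdot> Zero C Y O0 = Zero C Y (Cod C z)" using Comp_Zero_Arr(1)[OF zz(1) assms(2) zz(2)] .
  then have "zero_arrow (z \<cdot> Zero C Y O0)" using Zero_Arr[OF assms(2) Cod_Obj[OF zz(1)]] by simp
  then have "\<forall>w\<in>set ((z \<cdot> Zero C Y O0) # zs'). zero_arrow w" using zs(2) z by simp
  then have "trivial_extension C (Suc (Suc k)) X Y (Id C Y # ((z \<cdot> Zero C Y O0) # zs') @ [Id C X])"
    unfolding trivial_extension_higher using e by blast
  then show ?thesis using Suc by blast
qed

text \<open>The vertical arrows are \<open>a\<close>, then zeros, then the section \<open>s\<close>
  and the identity. The square next to \<open>a\<close> commutes since \<open>hd gs\<close> kills
  \<open>a\<close>, and the last one since \<open>s\<close> is a section.\<close>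

lemma chain_map_from_zeros:
  assumes "zs \<noteq> []" "\<forall>z\<in>set zs. zero_arrow z" "successively (exact_at C) (zs @ [Id C X])"
    "length gs = Suc (length zs)" "successively (exact_at C) gs" "Cod C (last gs) = X"
    "s \<in> Hom C X (Dom C (last gs))" "last gs \<cdot> s = Id C X"
    "a \<in> Hom C (Dom C (hd zs)) (Dom C (hd gs))" "hd gs \<cdot> a = Zero C (Dom C (hd zs)) (Cod C (hd gs))"
  shows "chain_map a (zs @ [Id C X]) gs (Id C X)"
  using assms
proof (induction zs arbitrary: gs a)
  case (Cons z zs)
  obtain g g1 gs' where gs: "gs = g # g1 # gs'" using Cons.prems(4) by (auto simp: length_Suc_conv)
  have eg: "exact_at C g g1" using Cons.prems(5) gs by simp
  note g = exact_at_Arr[OF eg]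
  have X: "X \<in> Obj C" using Hom_Obj[OF Cons.prems(7)] by simp
  have z: "zero_arrow z" using Cons.prems(2) by simp
  have a: "a \<in> Hom C (Dom C z) (Dom C g)" and ga: "g \<cdot> a = Zero C (Dom C z) (Cod C g)"
    using Cons.prems(9,10) gs by simp_all
  show ?case
  proof (cases zs)
    case Nil
    then have gs': "gs' = []" using Cons.prems(4) gs by simp
    have za: "z \<in> Arr C" "Cod C z = X"
      using Cons.prems(3) Nil exact_at_Arr[of z "Id C X"] Id_Arr[OF X] by simp_all
    have s: "s \<in> Hom C X (Cod C g)" "g1 \<cdot> s = Id C X" "Cod C g1 = X"
      using Cons.prems(6-8) gs gs' g by simp_all
    have "s \<cdot> z = Zero C (Dom C z) (Cod C g)"
      using Comp_Zero(1)[OF s(1) Dom_Obj[OF za(1)]] z za(2) by simp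
    then have "s \<cdot> z = g \<cdot> a" using ga by simp
    moreover have "chain_map s [Id C X] [g1] (Id C X)"
      using s g Id_Arr[OF X] Id_Hom[OF X] Comp_Id_left[OF Id_Hom[OF X]] by simp
    ultimately show ?thesis using Nil gs gs' za s a g by auto
  next
    case (Cons z1 zs1)
    have za: "z \<in> Arr C" "z1 \<in> Arr C" "Cod C z = Dom C z1"
      using Cons.prems(3) Cons exact_at_Arr[of z z1] by simp_all
    define c where "c = Zero C (Dom C z1) (Cod C g)"
    have O: "Dom C z1 \<in> Obj C" "Cod C g \<in> Obj C" using za(2) g(1) Dom_Obj Cod_Obj by auto
    have c: "c \<in> Hom C (Dom C z1) (Dom C g1)" "c \<in> Hom C (Cod C z) (Cod C g)"
      unfolding c_def using Zero_Hom[OF O] g za by simp_all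
    have "c \<cdot> z = Zero C (Dom C z) (Cod C g)"
      unfolding c_def using Comp_Zero_Arr(2)[OF za(1) O(2) za(3)] .
    moreover have "g1 \<cdot> c = Zero C (Dom C z1) (Cod C g1)"
      unfolding c_def using Comp_Zero_Arr(1)[OF g(2) O(1)] g(3) by simp
    ultimately have "chain_map c (zs @ [Id C X]) (g1 # gs') (Id C X)" "c \<cdot> z = g \<cdot> a"
      using Cons.IH[of "g1 # gs'" c] Cons.prems Cons gs c ga by simp_all
    then show ?thesis using za g a c gs by auto
  qed
qed simp

text \<open>The section provides the inner component next to \<open>X\<close>. On the biproduct of
  degree 1 the component is \<open>g \<cdot> p1 + s \<cdot> p2\<close>; in higher degrees the inner
  components are \<open>g\<close>, zeros and \<open>s\<close>.\<close>

lemma trivial_to_split: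
  assumes t: "trivial_extension C (Suc i) X Y ts" and gs: "gs \<in> extensions C (Suc i) X Y"
    and s: "s \<in> Hom C X (Dom C (last gs))" "last gs \<cdot> s = Id C X"
  shows "(ts, gs) \<in> ext_morphism_rel C (Suc i) X Y"
proof (rule chain_map_imp_ext_morphism)
  show tse: "ts \<in> extensions C (Suc i) X Y" using t by (simp add: trivial_extension_def)
  show "gs \<in> extensions C (Suc i) X Y" by (rule gs)
  note O = extensions_Obj[OF tse]
  obtain g g1 gs' where g: "gs = g # g1 # gs'"
    using gs by (auto simp: extensions_def length_Suc_conv)
  have G: "successively (exact_at C) gs" "length gs = Suc (Suc i)" "Cod C (last gs) = X" "Dom C g = Y"
    using gs g by (auto simp: extensions_def exact_sequence_iff)
  have eg: "exact_at C g g1" using G(1) g by simp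
  note ga = exact_at_Arr[OF eg]
  have gH: "g \<in> Hom C Y (Cod C g)" using ga G by (simp add: Hom_def)
  show "chain_map (Id C Y) ts gs (Id C X)"
  proof (cases i)
    case 0
    then have gs': "gs' = []" using G(2) g by simp
    obtain P i1 p2 i2 p1 where ts: "ts = [i1, p2]" and b: "is_biproduct C Y X P i1 i2 p1 p2"
      using t 0 by (auto simp: trivial_extension_def extensions_def length_Suc_conv)
    have b: "i1 \<in> Hom C Y P" "i2 \<in> Hom C X P" "p1 \<in> Hom C P Y" "p2 \<in> Hom C P X"
        "p1 \<cdot> i1 = Id C Y" "p2 \<cdot> i2 = Id C X" "p2 \<cdot> i1 = Zero C Y X"
        "Add C (i1 \<cdot> p1) (i2 \<cdot> p2) = Id C P"
      using b by (auto simp: is_biproduct_def)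
    have s: "s \<in> Hom C X (Cod C g)" "g1 \<cdot> s = Id C X" "Cod C g1 = X"
      using s G(3) ga g gs' by simp_all
    have g1H: "g1 \<in> Hom C (Cod C g) X" using ga s by (simp add: Hom_def)
    have gp: "g \<cdot> p1 \<in> Hom C P (Cod C g)" and sp: "s \<cdot> p2 \<in> Hom C P (Cod C g)"
      using Comp_Hom[OF b(3) gH] Comp_Hom[OF b(4) s(1)] .
    define c where "c = Add C (g \<cdot> p1) (s \<cdot> p2)"
    have c: "c \<in> Hom C P (Cod C g)" unfolding c_def using Add_Hom[OF gp sp] .
    have "c \<cdot> i1 = Add C (g \<cdot> Id C Y) (s \<cdot> Zero C Y X)"
      unfolding c_def using Comp_Add_left[OF b(1) gp sp] Comp_assoc[OF b(1,3) gH]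
        Comp_assoc[OF b(1,4) s(1)] b(5,7) by simp
    also have "\<dots> = g \<cdot> Id C Y"
      using Comp_Zero(1)[OF s(1) O(2)] Comp_Id_right[OF gH] Add_Zero(1)[OF gH] by simp
    finally have ci: "c \<cdot> i1 = g \<cdot> Id C Y" .
    have "g1 \<cdot> c = Add C ((g1 \<cdot> g) \<cdot> p1) ((g1 \<cdot> s) \<cdot> p2)"
      unfolding c_def using Comp_Add_right[OF gp sp g1H] Comp_assoc[OF b(3) gH g1H]
        Comp_assoc[OF b(4) s(1) g1H] by simp
    also have "\<dots> = Id C X \<cdot> p2"
      using exact_at_Comp[OF eg] G(4) s Comp_Zero(2)[OF b(3) O(1)] Comp_Id_left[OF b(4)]
        Add_Zero(2)[OF b(4)] by simp
    finally have "Id C X \<cdot> p2 = g1 \<cdot> c" by simp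
    then show ?thesis
      using ci c b(1,4) g1H gH Id_Hom[OF O(1)] Id_Hom[OF O(2)] ts g gs' HomD[OF b(1)] HomD[OF b(4)]
        HomD[OF g1H] HomD[OF gH] by auto
  next
    case (Suc k)
    obtain zs where zs: "zs \<noteq> []" "\<forall>z\<in>set zs. zero_arrow z" "ts = Id C Y # zs @ [Id C X]"
      using t Suc trivial_extension_higher by blast
    have T: "successively (exact_at C) ts" "length ts = Suc (Suc i)"
      using tse by (auto simp: extensions_def exact_sequence_iff)
    obtain z zs' where z: "zs = z # zs'" using zs(1) by (cases zs) auto
    have "exact_at C (Id C Y) z" using T zs z by simp
    then have dz: "Dom C z = Y" using exact_at_Arr(3) Id_Arr[OF O(2)] by metis
    have "chain_map g (zs @ [Id C X]) (g1 # gs') (Id C X)"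
    proof (rule chain_map_from_zeros[OF zs(1,2)])
      show "successively (exact_at C) (zs @ [Id C X])" using T(1) zs(3) z by simp
      show "length (g1 # gs') = Suc (length zs)" using T(2) G(2) zs(3) g by simp
      show "successively (exact_at C) (g1 # gs')" using G(1) g by simp
      show "Cod C (last (g1 # gs')) = X" using G(3) g by simp
      show "s \<in> Hom C X (Dom C (last (g1 # gs')))" "last (g1 # gs') \<cdot> s = Id C X" using s g by simp_all
      show "g \<in> Hom C (Dom C (hd zs)) (Dom C (hd (g1 # gs')))" using gH dz z ga by simp
      show "hd (g1 # gs') \<cdot> g = Zero C (Dom C (hd zs)) (Cod C (hd (g1 # gs')))"
        using exact_at_Comp[OF eg] G(4) dz z by simp
    qed
    then show ?thesis using zs(3) g Id_Arr[OF O(2)] Id_Hom[OF O(2)] G(4) ga gH by auto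
  qed
qed

section \<open>Yoneda Ext and injective coresolutions\<close>

text \<open>Surjectivity of the map that \<open>e\<close> induces on arrows from \<open>X\<close>.
  If \<open>e\<close> is the last arrow of an injective coresolution, the cokernel of that map is
  the usual derived functor Ext.\<close>

definition lifts :: "'a \<Rightarrow> 'b \<Rightarrow> bool" where
  "lifts X e \<longleftrightarrow> (\<forall>f\<in>Hom C X (Cod C e). \<exists>t\<in>Hom C X (Dom C e). e \<cdot> t = f)"

lemma liftsD:
  assumes "lifts X e" "e \<in> Hom C I S" "f \<in> Hom C X S"
  obtains t where "t \<in> Hom C X I" "e \<cdot> t = f"
  using assms(1,3) unfolding lifts_def HomD[OF assms(2)] by blast

lemma liftsI:
  assumes "e \<in> Hom C I S" "\<And>f. f \<in> Hom C X S \<Longrightarrow> \<exists>t\<in>Hom C X I. e \<cdot> t = f"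
  shows "lifts X e"
  using assms(2) unfolding lifts_def HomD[OF assms(1)] by blast

text \<open>Pulling back leaves the kernel \<open>Z\<close> unchanged. The universal property is
  passed on because morphisms into the pulled back extension are later built from it.\<close>

lemma pullback_short_exact:
  assumes ke: "short_exact k e Z I S" and f: "f \<in> Hom C X S"
  obtains P p q k' where "short_exact k' p Z P X" "q \<in> Hom C P I" "q \<cdot> k' = k" "f \<cdot> p = e \<cdot> q"
    "\<And>W x y. x \<in> Hom C W X \<Longrightarrow> y \<in> Hom C W I \<Longrightarrow> f \<cdot> x = e \<cdot> y \<Longrightarrow>
       \<exists>t\<in>Hom C W P. p \<cdot> t = x \<and> q \<cdot> t = y"
    "\<And>W t t'. t \<in> Hom C W P \<Longrightarrow> t' \<in> Hom C W P \<Longrightarrow> p \<cdot> t = p \<cdot> t' \<Longrightarrow> q \<cdot> t = q \<cdot> t' \<Longrightarrow> t = t'"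
proof -
  note ke' = short_exactD[OF ke]
  obtain P p q where p: "p \<in> Hom C P X" and q: "q \<in> Hom C P I" and ep: "epic C p"
    and comm: "f \<cdot> p = e \<cdot> q"
    and lift: "\<And>W x y. x \<in> Hom C W X \<Longrightarrow> y \<in> Hom C W I \<Longrightarrow> f \<cdot> x = e \<cdot> y \<Longrightarrow>
       \<exists>t\<in>Hom C W P. p \<cdot> t = x \<and> q \<cdot> t = y"
    and unique: "\<And>W t t'. t \<in> Hom C W P \<Longrightarrow> t' \<in> Hom C W P \<Longrightarrow> p \<cdot> t = p \<cdot> t' \<Longrightarrow> q \<cdot> t = q \<cdot> t' \<Longrightarrow> t = t'"
    by (rule pullback[OF ke'(2,4) f]) blast
  have X: "X \<in> Obj C" using Hom_Obj[OF f] by simp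
  have "f \<cdot> Zero C Z X = e \<cdot> k" using Comp_Zero(1)[OF f ke'(7)] ke'(6) by simp
  then obtain k' where k': "k' \<in> Hom C Z P" "p \<cdot> k' = Zero C Z X" "q \<cdot> k' = k"
    using lift[OF Zero_Hom[OF ke'(7) X] ke'(1)] by blast
  have "short_exact k' p Z P X"
  proof (rule short_exactI[OF k'(1) p _ ep k'(2)])
    show "monic C k'"
    proof (rule monicI[OF k'(1)])
      fix W x assume x: "x \<in> Hom C W Z" "k' \<cdot> x = Zero C W P"
      have "k \<cdot> x = q \<cdot> (k' \<cdot> x)" using k'(3) Comp_assoc[OF x(1) k'(1) q] by simp
      then have "k \<cdot> x = Zero C W I" using x Comp_Zero(1)[OF q] Hom_Obj[OF x(1)] by simp
      then show "x = Zero C W Z" using monic_Zero[OF ke'(3), unfolded HomD(2,3)[OF ke'(1)], OF x(1)] by simp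
    qed
    fix W x assume x: "x \<in> Hom C W P" "p \<cdot> x = Zero C W X"
    have qx: "q \<cdot> x \<in> Hom C W I" using Comp_Hom[OF x(1) q] .
    have "e \<cdot> (q \<cdot> x) = f \<cdot> (p \<cdot> x)"
      using comm Comp_assoc[OF x(1) p f] Comp_assoc[OF x(1) q ke'(2)] by simp
    also have "\<dots> = Zero C W S" using x Comp_Zero(1)[OF f] Hom_Obj[OF x(1)] by simp
    finally obtain u where u: "u \<in> Hom C W Z" "k \<cdot> u = q \<cdot> x"
      using short_exact_kernel_factor[OF ke qx] by blast
    have "k' \<cdot> u = x"
    proof (rule unique[OF Comp_Hom[OF u(1) k'(1)] x(1)])
      show "p \<cdot> (k' \<cdot> u) = p \<cdot> x"
        using Comp_assoc[OF u(1) k'(1) p] k'(2) Comp_Zero(2)[OF u(1) X] x(2) by simp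
      show "q \<cdot> (k' \<cdot> u) = q \<cdot> x" using Comp_assoc[OF u(1) k'(1) q] k'(3) u(2) by simp
    qed
    then show "\<exists>u\<in>Hom C W Z. k' \<cdot> u = x" using u(1) by blast
  qed
  then show ?thesis using that[of k' p P q] q k'(3) comm lift unique by blast
qed

text \<open>\<open>yoneda_zero\<close> is the image of all trivial extensions at once, so the
  quotient can be its singleton only if any two of them are related too. The existence of one keeps
  that image from being empty.\<close>

lemma ext_vanishes_singleton:
  assumes "equiv UNIV (yoneda_rel C i X Y)" "\<exists>ts. trivial_extension C i X Y ts"
  shows "ext_vanishes C i {X} {Y} \<longleftrightarrow>
    (\<forall>fs\<in>extensions C i X Y. \<forall>ts. trivial_extension C i X Y ts \<longrightarrow> (ts, fs) \<in> yoneda_rel C i X Y)"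
proof
  define R where "R = yoneda_rel C i X Y"
  note eq = assms(1)[folded R_def]
  assume "ext_vanishes C i {X} {Y}"
  then have "extensions C i X Y // R = {R `` {ts. trivial_extension C i X Y ts}}"
    unfolding ext_vanishes_def yoneda_ext_def yoneda_zero_def R_def by blast
  then have v: "(\<lambda>fs. R `` {fs}) ` extensions C i X Y = {R `` {ts. trivial_extension C i X Y ts}}"
    by (simp only: quotient_def UNION_singleton_eq_range)
  have K: "R `` {fs} = R `` {ts. trivial_extension C i X Y ts}" if "fs \<in> extensions C i X Y" for fs
    using imageI[OF that, of "\<lambda>fs. R `` {fs}"] unfolding v by simp
  have "(ts, fs) \<in> R" if fs: "fs \<in> extensions C i X Y" and ts: "trivial_extension C i X Y ts" for fs ts
  proof -
    have "ts \<in> extensions C i X Y" using ts by (simp add: trivial_extension_def)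
    then have "R `` {ts} = R `` {fs}" using K[OF fs] K by metis
    then show ?thesis by (rule eq_equiv_class[OF _ eq UNIV_I])
  qed
  then show "\<forall>fs\<in>extensions C i X Y. \<forall>ts. trivial_extension C i X Y ts \<longrightarrow> (ts, fs) \<in> yoneda_rel C i X Y"
    unfolding R_def by blast
next
  define R where "R = yoneda_rel C i X Y"
  note eq = assms(1)[folded R_def]
  assume "\<forall>fs\<in>extensions C i X Y. \<forall>ts. trivial_extension C i X Y ts \<longrightarrow> (ts, fs) \<in> yoneda_rel C i X Y"
  then have all: "(ts, fs) \<in> R" if "fs \<in> extensions C i X Y" "trivial_extension C i X Y ts" for fs ts
    using that unfolding R_def by blast
  obtain t0 where t0: "trivial_extension C i X Y t0" using assms(2) by blast
  then have t0': "t0 \<in> extensions C i X Y" by (simp add: trivial_extension_def)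
  have "R `` {fs} = R `` {ts. trivial_extension C i X Y ts}" if fs: "fs \<in> extensions C i X Y" for fs
  proof -
    have "R `` {ts} = R `` {fs}" if "trivial_extension C i X Y ts" for ts
      using equiv_class_eq[OF eq all[OF fs that]] .
    moreover have "R `` {ts. trivial_extension C i X Y ts} = (\<Union>ts\<in>Collect (trivial_extension C i X Y). R `` {ts})"
      by blast
    ultimately show ?thesis using t0 by auto
  qed
  then have "(\<lambda>fs. R `` {fs}) ` extensions C i X Y = {R `` {ts. trivial_extension C i X Y ts}}"
    using image_constant[OF t0'] by (simp cong: image_cong_simp)
  then have "extensions C i X Y // R = {R `` {ts. trivial_extension C i X Y ts}}"
    by (simp only: quotient_def UNION_singleton_eq_range)
  then show "ext_vanishes C i {X} {Y}"
    unfolding ext_vanishes_def yoneda_ext_def yoneda_zero_def R_def by simp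
qed

text \<open>The closure is reflexive on all lists, hence the carrier \<open>UNIV\<close>.\<close>

lemma yoneda_rel_equiv: "equiv UNIV (yoneda_rel C i X Y)"
  unfolding yoneda_rel_def
  by (intro equivI refl_rtrancl trans_rtrancl sym_rtrancl sym_Un_converse) simp

text \<open>\<open>tl\<close> drops the arrow out of the left end, so \<open>D\<close> speaks of the
  inner objects. The composite at the junction starts where the last arrow of \<open>fs\<close>
  starts.\<close>

lemma splice_ext_inner:
  assumes "fs \<in> extensions C i Z Y" "gs \<in> extensions C j X Z"
    "\<forall>f\<in>set (tl fs). D (Dom C f)" "\<forall>g\<in>set (tl gs). D (Dom C g)"
  shows "\<forall>h\<in>set (tl (splice_ext fs gs)). D (Dom C h)"
proof -
  have fs0: "fs \<noteq> []" and gs0: "gs \<noteq> []"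
    using assms by (auto simp: extensions_def exact_sequence_def)
  obtain fs' a where fs: "fs = fs' @ [a]" using fs0 by (metis append_butlast_last_id)
  obtain b gs' where gs: "gs = b # gs'" using gs0 by (metis list.collapse)
  have "epic C a" "monic C b" "Cod C a = Dom C b"
    using assms(1,2) fs gs by (auto simp: extensions_def exact_sequence_iff)
  then have "Dom C (b \<cdot> a) = Dom C a" using Comp_Arr(2) monic_Arr epic_Arr by blast
  then show ?thesis using assms(3,4) unfolding splice_ext_def fs gs by (cases fs') auto
qed

text \<open>
  The class of an extension of \<open>X\<close> by \<open>Y\<close> is determined by the end \<open>X \<rightarrow> S\<close> of a chain map into
  an injective coresolution of \<open>Y\<close>, up to maps that factor through the last epimorphism \<open>e\<close>.
\<close>

lemma ext_vanishes_iff_lifts: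
  assumes hs: "hs \<in> extensions C m Z Y" and inj: "\<forall>h\<in>set (tl hs). injective_object C (Dom C h)"
    and ke: "short_exact k e Z I S" and I: "injective_object C I" and X: "X \<in> Obj C"
  shows "ext_vanishes C (Suc m) {X} {Y} \<longleftrightarrow> lifts X e"
proof -
  note ke' = short_exactD[OF ke]
  have Y: "Y \<in> Obj C" using extensions_Obj[OF hs] by simp
  have hs0: "hs \<noteq> []" using hs by (auto simp: extensions_def exact_sequence_def)
  obtain hs' a where hsa: "hs = hs' @ [a]" using hs0 by (metis append_butlast_last_id)
  have ha: "epic C a" "Cod C a = Z" "Dom C (hd hs) = Y" "successively (exact_at C) (hs' @ [a])"
    using hs unfolding hsa by (auto simp: extensions_def exact_sequence_iff)
  have aH: "a \<in> Hom C (Dom C a) Z" using ha epic_Arr by (simp add: Hom_def)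
  have kext: "[k, e] \<in> extensions C (Suc 0) S Z" using ke short_exact_extensions by blast
  \<comment> \<open>The coresolution \<open>hs\<close> of \<open>Y\<close>, prolonged by one step
    through \<open>I\<close>; it ends in \<open>S\<close>.\<close>
  define gs where "gs = hs' @ [k \<cdot> a, e]"
  have gsplice: "splice_ext hs [k, e] = gs" by (simp add: splice_ext_def gs_def hsa)
  have gs: "gs \<in> extensions C (Suc m) S Y"
    using splice_ext_extensions[OF hs kext] unfolding gsplice by simp
  have ginj: "\<forall>g\<in>set (tl gs). injective_object C (Dom C g)"
    using splice_ext_inner[OF hs kext inj] I HomD(2)[OF ke'(2)] unfolding gsplice by simp
  have lastg: "last gs = e" by (simp add: gs_def)
  have idc: "chain_map (Id C Y) hs' hs' (Id C (Dom C a))"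
    using chain_map_Id[OF ha(4) epic_Arr[OF ha(1)]] ha(3) hsa by simp
  define R where "R = yoneda_rel C (Suc m) X Y"
  note equiv = yoneda_rel_equiv[of "Suc m" X Y, folded R_def]
  \<comment> \<open>The end of some comparison map vanishes modulo arrows through \<open>e\<close>.
    By uniqueness up to homotopy the same then holds for every comparison map.\<close>
  define null where "null fs \<longleftrightarrow> (\<exists>x\<in>Hom C X I. chain_map (Id C Y) fs gs (e \<cdot> x))" for fs
  have IdId: "Id C Y \<cdot> Id C Y = Id C Y" using Comp_Id_left[OF Id_Hom[OF Y]] .

  have null_step: "null fs \<longleftrightarrow> null fs'" if rel: "(fs, fs') \<in> ext_morphism_rel C (Suc m) X Y" for fs fs'
  proof
    have fs: "fs \<in> extensions C (Suc m) X Y" "fs' \<in> extensions C (Suc m) X Y"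
      using rel by (auto simp: ext_morphism_rel_def)
    note cm = ext_morphism_imp_chain_map[OF rel]
    show "null fs" if nf: "null fs'"
    proof -
      obtain x where x: "x \<in> Hom C X I" "chain_map (Id C Y) fs' gs (e \<cdot> x)"
        using nf by (auto simp: null_def)
      have "chain_map (Id C Y) fs gs ((e \<cdot> x) \<cdot> Id C X)" using chain_map_Comp[OF cm x(2)] IdId by simp
      then show ?thesis
        using x Comp_Id_right[OF Comp_Hom[OF x(1) ke'(2)]] unfolding null_def by auto
    qed
    show "null fs'" if nf: "null fs"
    proof -
      obtain x where x: "x \<in> Hom C X I" "chain_map (Id C Y) fs gs (e \<cdot> x)"
        using nf by (auto simp: null_def)
      \<comment> \<open>Composition carries comparison maps only backwards along the morphism. For
        the other direction an arbitrary one is chosen on \<open>fs'\<close>, and uniqueness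
        compares its composite on \<open>fs\<close> with the given one.\<close>
      obtain b where b: "chain_map (Id C Y) fs' gs b"
        using chain_map_exists_extensions[OF fs(2) gs ginj] by blast
      have F: "fs' \<noteq> []" "Cod C (last fs') = X" "Cod C (last gs) = S"
        using fs(2) gs by (auto simp: extensions_def exact_sequence_def)
      have bH: "b \<in> Hom C X S" using chain_map_end_Hom[OF b F(1)] F by simp
      have "chain_map (Id C Y) fs gs b"
        using chain_map_Comp[OF cm b] IdId Comp_Id_right[OF bH] by simp
      then obtain t where t: "t \<in> Hom C X I" "b = Add C (e \<cdot> x) (e \<cdot> t)"
        using chain_map_unique_extensions[OF fs(1) gs ginj _ x(2)] lastg HomD(2)[OF ke'(2)] by auto
      then have "b = e \<cdot> Add C x t" using Comp_Add_right[OF x(1) t(1) ke'(2)] by simp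
      then show ?thesis using b Add_Hom[OF x(1) t(1)] unfolding null_def by blast
    qed
  qed
  have null_rel: "null fs \<longleftrightarrow> null fs'" if rel: "(fs, fs') \<in> R" for fs fs'
    using rel unfolding R_def yoneda_rel_def
    by (induction rule: rtrancl_induct) (use null_step in blast)+

  \<comment> \<open>Pulling the last short exact sequence of \<open>gs\<close> back along
    \<open>f\<close> yields an extension with end \<open>f\<close>. Extensions with the same end map
    to it, and a factorization of \<open>f\<close> through \<open>e\<close> gives a section of its
    last arrow.\<close>
  have pull: "\<exists>gs'\<in>extensions C (Suc m) X Y. chain_map (Id C Y) gs' gs f \<and>
      (\<forall>fs\<in>extensions C (Suc m) X Y. chain_map (Id C Y) fs gs f \<longrightarrow> chain_map (Id C Y) fs gs' (Id C X)) \<and>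
      (\<forall>x\<in>Hom C X I. f = e \<cdot> x \<longrightarrow> (\<exists>s\<in>Hom C X (Dom C (last gs')). last gs' \<cdot> s = Id C X))"
    if f: "f \<in> Hom C X S" for f
  proof -
    obtain P p q k' where kp: "short_exact k' p Z P X" and q: "q \<in> Hom C P I" "q \<cdot> k' = k"
      and comm: "f \<cdot> p = e \<cdot> q"
      and lift: "\<And>W x y. x \<in> Hom C W X \<Longrightarrow> y \<in> Hom C W I \<Longrightarrow> f \<cdot> x = e \<cdot> y \<Longrightarrow>
         \<exists>t\<in>Hom C W P. p \<cdot> t = x \<and> q \<cdot> t = y"
      and unique: "\<And>W t t'. t \<in> Hom C W P \<Longrightarrow> t' \<in> Hom C W P \<Longrightarrow> p \<cdot> t = p \<cdot> t' \<Longrightarrow>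
         q \<cdot> t = q \<cdot> t' \<Longrightarrow> t = t'"
      by (rule pullback_short_exact[OF ke f]) blast
    note kp' = short_exactD[OF kp]
    have kpext: "[k', p] \<in> extensions C (Suc 0) X Z" using kp short_exact_extensions by blast
    define gs' where "gs' = hs' @ [k' \<cdot> a, p]"
    have "splice_ext hs [k', p] = gs'" by (simp add: splice_ext_def gs'_def hsa)
    then have gs': "gs' \<in> extensions C (Suc m) X Y" using splice_ext_extensions[OF hs kpext] by simp
    have ka: "k \<cdot> a \<in> Hom C (Dom C a) I" "k' \<cdot> a \<in> Hom C (Dom C a) P"
      using Comp_Hom[OF aH] ke' kp' by auto
    have aO: "Dom C a \<in> Obj C" using Hom_Obj[OF aH] by simp
    have "q \<cdot> (k' \<cdot> a) = (k \<cdot> a) \<cdot> Id C (Dom C a)"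
      using Comp_assoc[OF aH kp'(1) q(1)] q(2) Comp_Id_right[OF ka(1)] by simp
    then have "chain_map (Id C (Dom C a)) [k' \<cdot> a, p] [k \<cdot> a, e] f"
      using comm f q(1) Id_Hom[OF aO] HomD[OF ka(1)] HomD[OF ka(2)] HomD[OF kp'(2)] HomD[OF ke'(2)]
      by (auto intro!: exI[of _ q])
    then have "chain_map (Id C Y) gs' gs f"
      unfolding gs_def gs'_def using chain_map_append[of hs' hs'] idc by blast
    moreover have "chain_map (Id C Y) fs gs' (Id C X)"
      if fs: "fs \<in> extensions C (Suc m) X Y" and cm: "chain_map (Id C Y) fs gs f" for fs
    proof -
      have len: "length fs = length hs' + 2" using chain_map_length[OF cm] by (simp add: gs_def)
      define fs1 fs2 where "fs1 = take (length hs') fs" and "fs2 = drop (length hs') fs"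
      have l: "length fs1 = length hs'" "length fs2 = Suc (Suc 0)" using len by (auto simp: fs1_def fs2_def)
      obtain g h where fs2: "fs2 = [g, h]" using l(2) by (auto simp: length_Suc_conv)
      have dec: "fs = fs1 @ [g, h]" using fs2 by (simp add: fs1_def fs2_def flip: fs2)
      obtain b where b: "chain_map (Id C Y) fs1 hs' b" "chain_map b [g, h] [k \<cdot> a, e] f"
        using cm chain_map_append[OF l(1)] unfolding dec gs_def by blast
      obtain c where c: "g \<in> Arr C" "h \<in> Arr C" "b \<in> Hom C (Dom C g) (Dom C a)" "c \<in> Hom C (Cod C g) I"
          "c \<in> Hom C (Dom C h) I" "c \<cdot> g = (k \<cdot> a) \<cdot> b" "f \<cdot> h = e \<cdot> c"
        using b(2) HomD[OF ka(1)] HomD[OF ke'(2)] by auto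
      have eg: "exact_at C g h" and ch: "Cod C h = X"
        using fs unfolding dec extensions_def exact_sequence_iff
        by (auto simp: successively_append_iff)
      have gH: "g \<in> Hom C (Dom C g) (Dom C h)" and hH: "h \<in> Hom C (Dom C h) X"
        using c exact_at_Arr[OF eg] ch by (simp_all add: Hom_def)
      \<comment> \<open>The component at \<open>P\<close> comes from the universal property; its
        uniqueness part yields the square to the left.\<close>
      obtain d where d: "d \<in> Hom C (Dom C h) P" "p \<cdot> d = h" "q \<cdot> d = c"
        using lift[OF hH c(5,7)] by blast
      have kab: "(k' \<cdot> a) \<cdot> b \<in> Hom C (Dom C g) P" using Comp_Hom[OF c(3) ka(2)] .
      have ab: "a \<cdot> b \<in> Hom C (Dom C g) Z" using Comp_Hom[OF c(3) aH] .
      have kab': "(k' \<cdot> a) \<cdot> b = k' \<cdot> (a \<cdot> b)" using Comp_assoc[OF c(3) aH kp'(1)] by simp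
      have "d \<cdot> g = (k' \<cdot> a) \<cdot> b"
      proof (rule unique[OF Comp_Hom[OF gH d(1)] kab])
        have "p \<cdot> (d \<cdot> g) = Zero C (Dom C g) X"
          using Comp_assoc[OF gH d(1) kp'(2)] d(2) exact_at_Comp[OF eg] ch by simp
        moreover have "p \<cdot> ((k' \<cdot> a) \<cdot> b) = Zero C (Dom C g) X"
          using kab' Comp_assoc[OF ab kp'(1,2)] kp'(6) Comp_Zero(2)[OF ab X] by simp
        ultimately show "p \<cdot> (d \<cdot> g) = p \<cdot> ((k' \<cdot> a) \<cdot> b)" by simp
        show "q \<cdot> (d \<cdot> g) = q \<cdot> ((k' \<cdot> a) \<cdot> b)"
          using Comp_assoc[OF gH d(1) q(1)] d(3) c(6) kab' Comp_assoc[OF ab kp'(1) q(1)] q(2)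
            Comp_assoc[OF c(3) aH ke'(1)] by simp
      qed
      moreover have "Id C X \<cdot> h = p \<cdot> d" using d(2) Comp_Id_left[OF hH] by simp
      ultimately have "chain_map b [g, h] [k' \<cdot> a, p] (Id C X)"
        using c d HomD[OF gH] HomD[OF hH] HomD[OF ka(2)] HomD[OF kp'(2)] Id_Hom[OF X] by auto
      then show ?thesis unfolding dec gs'_def using chain_map_append[OF l(1)] b(1) by blast
    qed
    moreover have "\<exists>s\<in>Hom C X (Dom C (last gs')). last gs' \<cdot> s = Id C X"
      if x: "x \<in> Hom C X I" "f = e \<cdot> x" for x
    proof -
      have "f \<cdot> Id C X = e \<cdot> x" using x(2) Comp_Id_right[OF f] by simp
      then show ?thesis
        using lift[OF Id_Hom[OF X] x(1)] HomD(2)[OF kp'(2)] by (auto simp: gs'_def)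
    qed
    ultimately show ?thesis using gs' by blast
  qed

  have split_rel: "(ts, gs') \<in> R"
    if "trivial_extension C (Suc m) X Y ts" "gs' \<in> extensions C (Suc m) X Y"
      "s \<in> Hom C X (Dom C (last gs'))" "last gs' \<cdot> s = Id C X" for ts gs' s
    using trivial_to_split[OF that] unfolding R_def yoneda_rel_def by blast

  \<comment> \<open>The pullback along zero splits, so a trivial extension maps to it, and its end
    is zero.\<close>
  have trivial_null: "null ts" if ts: "trivial_extension C (Suc m) X Y ts" for ts
  proof -
    have IO: "I \<in> Obj C" using ke'(8) .
    have zx: "Zero C X I \<in> Hom C X I" using Zero_Hom[OF X IO] .
    obtain gs' where g: "gs' \<in> extensions C (Suc m) X Y" "chain_map (Id C Y) gs' gs (e \<cdot> Zero C X I)"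
        "\<exists>s\<in>Hom C X (Dom C (last gs')). last gs' \<cdot> s = Id C X"
      using pull[OF Comp_Hom[OF zx ke'(2)]] zx by blast
    then have "(ts, gs') \<in> R" using split_rel[OF ts] by blast
    moreover have "null gs'" using g(2) zx unfolding null_def by blast
    ultimately show ?thesis using null_rel by blast
  qed
  \<comment> \<open>The extension pulled back along the end \<open>e \<cdot> x\<close> splits; both
    \<open>fs\<close> and the trivial extension map to it.\<close>
  have null_trivial: "(ts, fs) \<in> R"
    if ts: "trivial_extension C (Suc m) X Y ts" and fs: "fs \<in> extensions C (Suc m) X Y" and n: "null fs"
    for ts fs
  proof -
    obtain x where x: "x \<in> Hom C X I" "chain_map (Id C Y) fs gs (e \<cdot> x)" using n by (auto simp: null_def)
    obtain gs' s where g: "gs' \<in> extensions C (Suc m) X Y" "chain_map (Id C Y) fs gs' (Id C X)"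
        "s \<in> Hom C X (Dom C (last gs'))" "last gs' \<cdot> s = Id C X"
      using pull[OF Comp_Hom[OF x(1) ke'(2)]] x fs by blast
    have "(fs, gs') \<in> R"
      using chain_map_imp_ext_morphism[OF fs g(1,2)] unfolding R_def yoneda_rel_def by blast
    then show ?thesis using split_rel[OF ts g(1,3,4)] equiv by (meson equiv_def symD transD)
  qed
  \<comment> \<open>By \<open>pull\<close> every arrow to \<open>S\<close> is an end, and by the
    comparison theorem every extension has an end.\<close>
  have "(\<forall>fs\<in>extensions C (Suc m) X Y. null fs) \<longleftrightarrow> lifts X e"
  proof
    assume all: "\<forall>fs\<in>extensions C (Suc m) X Y. null fs"
    show "lifts X e"
    proof (rule liftsI[OF ke'(2)])
      fix f assume f: "f \<in> Hom C X S"
      obtain gs' where g: "gs' \<in> extensions C (Suc m) X Y" "chain_map (Id C Y) gs' gs f"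
        using pull[OF f] by blast
      obtain x where x: "x \<in> Hom C X I" "chain_map (Id C Y) gs' gs (e \<cdot> x)"
        using all g(1) by (auto simp: null_def)
      obtain t where t: "t \<in> Hom C X I" "f = Add C (e \<cdot> x) (e \<cdot> t)"
        using chain_map_unique_extensions[OF g(1) gs ginj g(2) x(2)] lastg HomD(2)[OF ke'(2)] by auto
      then have "e \<cdot> Add C x t = f" using Comp_Add_right[OF x(1) t(1) ke'(2)] by simp
      then show "\<exists>t\<in>Hom C X I. e \<cdot> t = f" using Add_Hom[OF x(1) t(1)] by blast
    qed
  next
    assume l: "lifts X e"
    show "\<forall>fs\<in>extensions C (Suc m) X Y. null fs"
    proof
      fix fs assume fs: "fs \<in> extensions C (Suc m) X Y"
      obtain b where b: "chain_map (Id C Y) fs gs b"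
        using chain_map_exists_extensions[OF fs gs ginj] by blast
      have F: "fs \<noteq> []" "Cod C (last fs) = X" "Cod C (last gs) = S"
        using fs gs by (auto simp: extensions_def exact_sequence_def)
      have bH: "b \<in> Hom C X S" using chain_map_end_Hom[OF b F(1)] F by simp
      obtain x where "x \<in> Hom C X I" "e \<cdot> x = b" using liftsD[OF l ke'(2) bH] .
      then show "null fs" using b unfolding null_def by blast
    qed
  qed
  moreover have "ext_vanishes C (Suc m) {X} {Y} \<longleftrightarrow> (\<forall>fs\<in>extensions C (Suc m) X Y. null fs)"
    using ext_vanishes_singleton[OF yoneda_rel_equiv trivial_extension_exists[OF X Y, of m]]
      trivial_extension_exists[OF X Y, of m] trivial_null null_trivial null_rel unfolding R_def by metis
  ultimately show ?thesis by simp
qed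

end

section \<open>Dimension shifting\<close>

locale abelian_category_enough_injectives = abelian_category +
  assumes enough: "enough_injectives C"
begin

lemma injective_embedding:
  assumes "Y \<in> Obj C"
  obtains k e I S where "short_exact k e Y I S" "injective_object C I"
  using enough assms monic_short_exact unfolding enough_injectives_def by metis

text \<open>\<open>Z\<close> is the \<open>m\<close>-th cosyzygy, reached through \<open>m\<close>
  injective terms; for \<open>m = 0\<close> it is \<open>Y\<close> itself.\<close>

lemma injective_coresolution_exists:
  assumes "Y \<in> Obj C"
  shows "\<exists>Z hs. hs \<in> extensions C m Z Y \<and> (\<forall>h\<in>set (tl hs). injective_object C (Dom C h))"
proof (induction m)
  case 0
  then show ?case using Id_extensions[OF assms] by (intro exI[of _ Y] exI[of _ "[Id C Y]"]) simp
next
  case (Suc m)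
  then obtain Z hs where hs: "hs \<in> extensions C m Z Y" "\<forall>h\<in>set (tl hs). injective_object C (Dom C h)"
    by blast
  obtain k e I S where ke: "short_exact k e Z I S" and I: "injective_object C I"
    using injective_embedding[OF extensions_Obj(1)[OF hs(1)]] .
  have k: "[k, e] \<in> extensions C (Suc 0) S Z" using ke short_exact_extensions by blast
  have "splice_ext hs [k, e] \<in> extensions C (Suc m) S Y" using splice_ext_extensions[OF hs(1) k] by simp
  moreover have "\<forall>h\<in>set (tl (splice_ext hs [k, e])). injective_object C (Dom C h)"
    using splice_ext_inner[OF hs(1) k hs(2)] I HomD(2)[OF short_exactD(2)[OF ke]] by simp
  ultimately show ?case by blast
qed

lemma ext_vanishes_one_iff:
  assumes "short_exact k e Y I S" "injective_object C I" "X \<in> Obj C"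
  shows "ext_vanishes C (Suc 0) {X} {Y} \<longleftrightarrow> lifts X e"
  using ext_vanishes_iff_lifts[OF Id_extensions _ assms] short_exactD(7)[OF assms(1)] by simp

text \<open>Splicing \<open>Y\<close>, \<open>I\<close>, \<open>S\<close> in front of a coresolution
  of \<open>S\<close> gives one of \<open>Y\<close> with the same last epimorphism, so both sides
  are the same lifting condition.\<close>

lemma ext_vanishes_shift:
  assumes ke: "short_exact k e Y I S" and I: "injective_object C I" and X: "X \<in> Obj C"
  shows "ext_vanishes C (Suc (Suc i)) {X} {Y} \<longleftrightarrow> ext_vanishes C (Suc i) {X} {S}"
proof -
  obtain Z hs where hs: "hs \<in> extensions C i Z S" "\<forall>h\<in>set (tl hs). injective_object C (Dom C h)"
    using injective_coresolution_exists[OF short_exactD(9)[OF ke]] by blast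
  obtain k' e' I' S' where ke': "short_exact k' e' Z I' S'" and I': "injective_object C I'"
    using injective_embedding[OF extensions_Obj(1)[OF hs(1)]] .
  have k: "[k, e] \<in> extensions C (Suc 0) S Y" using ke short_exact_extensions by blast
  have s: "splice_ext [k, e] hs \<in> extensions C (Suc i) Z Y" using splice_ext_extensions[OF k hs(1)] by simp
  have "\<forall>h\<in>set (tl (splice_ext [k, e] hs)). injective_object C (Dom C h)"
    using splice_ext_inner[OF k hs(1) _ hs(2)] I HomD(2)[OF short_exactD(2)[OF ke]] by simp
  then show ?thesis
    using ext_vanishes_iff_lifts[OF s _ ke' I' X] ext_vanishes_iff_lifts[OF hs ke' I' X] by simp
qed

text \<open>Composition with \<open>f\<close> turns a coresolution of \<open>K\<close> into one of
  \<open>Y\<close> with the same end. Resolutions of length zero are isomorphisms, which is where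
  this is used.\<close>

lemma ext_vanishes_iso:
  assumes f: "[f] \<in> extensions C 0 K Y" and X: "X \<in> Obj C" and v: "ext_vanishes C (Suc i) {X} {Y}"
  shows "ext_vanishes C (Suc i) {X} {K}"
proof -
  obtain Z hs where hs: "hs \<in> extensions C i Z K" "\<forall>h\<in>set (tl hs). injective_object C (Dom C h)"
    using injective_coresolution_exists[OF extensions_Obj(1)[OF f]] by blast
  obtain k e I S where ke: "short_exact k e Z I S" and I: "injective_object C I"
    using injective_embedding[OF extensions_Obj(1)[OF hs(1)]] .
  have s: "splice_ext [f] hs \<in> extensions C i Z Y" using splice_ext_extensions[OF f hs(1)] by simp
  have "\<forall>h\<in>set (tl (splice_ext [f] hs)). injective_object C (Dom C h)"
    using splice_ext_inner[OF f hs(1) _ hs(2)] by simp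
  then show ?thesis
    using v ext_vanishes_iff_lifts[OF s _ ke I X] ext_vanishes_iff_lifts[OF hs ke I X] by simp
qed

text \<open>One injective \<open>I\<close> serves both \<open>Y\<close> and \<open>Z\<close>, so
  \<open>S\<close> and \<open>D\<close> are their cosyzygies and \<open>e\<close> and
  \<open>c\<close> their test arrows.\<close>

lemma rotation_injective:
  assumes kp: "short_exact k p Y Z Q"
  obtains I z c D e S j d where "injective_object C I" "short_exact z c Z I D"
    "short_exact (z \<cdot> k) e Y I S" "short_exact j d Q S D" "j \<cdot> p = e \<cdot> z" "d \<cdot> e = c"
proof -
  note kp' = short_exactD[OF kp]
  obtain z c I D where zc: "short_exact z c Z I D" and I: "injective_object C I"
    using injective_embedding[OF kp'(8)] .
  note zc' = short_exactD[OF zc]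
  have "monic C (z \<cdot> k)" using monic_Comp[OF kp'(3) zc'(3)] HomD(3)[OF kp'(1)] HomD(2)[OF zc'(1)] by simp
  then obtain e S where e: "short_exact (z \<cdot> k) e Y I S"
    using monic_short_exact Comp_Hom[OF kp'(1) zc'(1)] by blast
  obtain j d where "short_exact j d Q S D" "j \<cdot> p = e \<cdot> z" "d \<cdot> e = c"
    using rotation[OF kp zc e] .
  then show ?thesis using that[OF I zc e] by blast
qed

text \<open>Extends the criterion to a middle term that is not injective. Lift
  \<open>j \<cdot> f\<close> along \<open>e\<close> to an arrow \<open>t\<close> into
  \<open>I\<close>; as \<open>d\<close> kills \<open>j\<close>, the arrow \<open>c\<close> kills
  \<open>t\<close>, so \<open>t\<close> comes from \<open>Z\<close>.\<close>

lemma ext_vanishes_imp_lifts: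
  assumes kp: "short_exact k p Y Z Q" and X: "X \<in> Obj C" and v: "ext_vanishes C (Suc 0) {X} {Y}"
  shows "lifts X p"
proof -
  note kp' = short_exactD[OF kp]
  obtain I z c D e S j d where I: "injective_object C I" and zc: "short_exact z c Z I D"
    and e: "short_exact (z \<cdot> k) e Y I S" and jd: "short_exact j d Q S D"
    and eqs: "j \<cdot> p = e \<cdot> z" "d \<cdot> e = c"
    using rotation_injective[OF kp] .
  note zc' = short_exactD[OF zc] and e' = short_exactD[OF e] and jd' = short_exactD[OF jd]
  have l: "lifts X e" using v ext_vanishes_one_iff[OF e I X] by simp
  show ?thesis
  proof (rule liftsI[OF kp'(2)])
    fix f assume f: "f \<in> Hom C X Q"
    obtain t where t: "t \<in> Hom C X I" "e \<cdot> t = j \<cdot> f" using liftsD[OF l e'(2) Comp_Hom[OF f jd'(1)]] .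
    have "c \<cdot> t = (d \<cdot> j) \<cdot> f"
      using eqs(2) Comp_assoc[OF t(1) e'(2) jd'(2)] t(2) Comp_assoc[OF f jd'(1,2)] by simp
    also have "\<dots> = Zero C X D" using jd'(6) Comp_Zero(2)[OF f jd'(9)] by simp
    finally obtain s where s: "s \<in> Hom C X Z" "z \<cdot> s = t"
      using short_exact_kernel_factor[OF zc t(1)] by blast
    have "j \<cdot> (p \<cdot> s) = j \<cdot> f"
      using Comp_assoc[OF s(1) kp'(2) jd'(1)] eqs(1) Comp_assoc[OF s(1) zc'(1) e'(2)] s(2) t(2) by simp
    then have "p \<cdot> s = f"
      using monic_cancel[OF jd'(3), unfolded HomD(2)[OF jd'(1)], OF Comp_Hom[OF s(1) kp'(2)] f] by simp
    then show "\<exists>s\<in>Hom C X Z. p \<cdot> s = f" using s(1) by blast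
  qed
qed

text \<open>The test arrow of \<open>Z\<close> is \<open>c = d \<cdot> e\<close>, and both factors
  lift: \<open>e\<close> is the test arrow of \<open>Y\<close>, and the kernel of \<open>d\<close>
  is \<open>Q\<close>.\<close>

lemma ext_vanishes_middle_one:
  assumes kp: "short_exact k p Y Z Q" and X: "X \<in> Obj C"
    and Y: "ext_vanishes C (Suc 0) {X} {Y}" and Q: "ext_vanishes C (Suc 0) {X} {Q}"
  shows "ext_vanishes C (Suc 0) {X} {Z}"
proof -
  obtain I z c D e S j d where I: "injective_object C I" and zc: "short_exact z c Z I D"
    and e: "short_exact (z \<cdot> k) e Y I S" and jd: "short_exact j d Q S D"
    and eqs: "j \<cdot> p = e \<cdot> z" "d \<cdot> e = c"
    using rotation_injective[OF kp] .
  note zc' = short_exactD[OF zc] and e' = short_exactD[OF e] and jd' = short_exactD[OF jd]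
  have le: "lifts X e" using Y ext_vanishes_one_iff[OF e I X] by simp
  have ld: "lifts X d" using ext_vanishes_imp_lifts[OF jd X Q] .
  have "lifts X c"
  proof (rule liftsI[OF zc'(2)])
    fix f assume f: "f \<in> Hom C X D"
    obtain g where g: "g \<in> Hom C X S" "d \<cdot> g = f" using liftsD[OF ld jd'(2) f] .
    obtain t where t: "t \<in> Hom C X I" "e \<cdot> t = g" using liftsD[OF le e'(2) g(1)] .
    have "c \<cdot> t = f" using eqs(2) Comp_assoc[OF t(1) e'(2) jd'(2)] g t by simp
    then show "\<exists>t\<in>Hom C X I. c \<cdot> t = f" using t(1) by blast
  qed
  then show ?thesis using ext_vanishes_one_iff[OF zc I X] by simp
qed

text \<open>After two rotations \<open>e2\<close> tests \<open>Q\<close>, \<open>c\<close> tests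
  \<open>Z\<close>, and \<open>c2\<close> tests \<open>S\<close>, that is, \<open>Y\<close> in
  degree 2. An arrow to \<open>S2\<close> is lifted in two steps: \<open>c2\<close> takes care of
  its image in \<open>D2\<close>, and the remaining error comes from \<open>D\<close>, where
  \<open>c\<close> lifts it.\<close>

lemma ext_vanishes_right_one:
  assumes kp: "short_exact k p Y Z Q" and X: "X \<in> Obj C"
    and Z: "ext_vanishes C (Suc 0) {X} {Z}" and Y: "ext_vanishes C (Suc (Suc 0)) {X} {Y}"
  shows "ext_vanishes C (Suc 0) {X} {Q}"
proof -
  obtain I z c D e S j d where I: "injective_object C I" and zc: "short_exact z c Z I D"
    and e: "short_exact (z \<cdot> k) e Y I S" and jd: "short_exact j d Q S D"
    and eqs: "j \<cdot> p = e \<cdot> z" "d \<cdot> e = c"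
    using rotation_injective[OF kp] .
  note zc' = short_exactD[OF zc] and e' = short_exactD[OF e] and jd' = short_exactD[OF jd]
  obtain I2 z2 c2 D2 e2 S2 j2 d2 where I2: "injective_object C I2" and zc2: "short_exact z2 c2 S I2 D2"
    and e2: "short_exact (z2 \<cdot> j) e2 Q I2 S2" and jd2: "short_exact j2 d2 D S2 D2"
    and eqs2: "j2 \<cdot> d = e2 \<cdot> z2" "d2 \<cdot> e2 = c2"
    using rotation_injective[OF jd] .
  note zc2' = short_exactD[OF zc2] and e2' = short_exactD[OF e2] and jd2' = short_exactD[OF jd2]
  have lc: "lifts X c" using Z ext_vanishes_one_iff[OF zc I X] by simp
  have lc2: "lifts X c2"
    using Y ext_vanishes_shift[OF e I X] ext_vanishes_one_iff[OF zc2 I2 X] by simp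
  have "lifts X e2"
  proof (rule liftsI[OF e2'(2)])
    fix f assume f: "f \<in> Hom C X S2"
    obtain t where t: "t \<in> Hom C X I2" "c2 \<cdot> t = d2 \<cdot> f"
      using liftsD[OF lc2 zc2'(2) Comp_Hom[OF f jd2'(2)]] .
    have et: "e2 \<cdot> t \<in> Hom C X S2" using Comp_Hom[OF t(1) e2'(2)] .
    have u: "Sub f (e2 \<cdot> t) \<in> Hom C X S2" using Sub_Hom[OF f et] .
    have "d2 \<cdot> (e2 \<cdot> t) = d2 \<cdot> f" using Comp_assoc[OF t(1) e2'(2) jd2'(2)] eqs2(2) t(2) by simp
    then have "d2 \<cdot> Sub f (e2 \<cdot> t) = Zero C X D2"
      using Comp_Sub[OF f et jd2'(2)] Sub_eq_Zero[OF Comp_Hom[OF f jd2'(2)] Comp_Hom[OF et jd2'(2)]] by simp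
    then obtain g where g: "g \<in> Hom C X D" "j2 \<cdot> g = Sub f (e2 \<cdot> t)"
      using short_exact_kernel_factor[OF jd2 u] by blast
    obtain s where s: "s \<in> Hom C X I" "c \<cdot> s = g" using liftsD[OF lc zc'(2) g(1)] .
    have es: "e \<cdot> s \<in> Hom C X S" using Comp_Hom[OF s(1) e'(2)] .
    have zes: "z2 \<cdot> (e \<cdot> s) \<in> Hom C X I2" using Comp_Hom[OF es zc2'(1)] .
    have "Sub f (e2 \<cdot> t) = j2 \<cdot> (d \<cdot> (e \<cdot> s))"
      using g(2) s(2) eqs(2) Comp_assoc[OF s(1) e'(2) jd'(2)] by simp
    also have "\<dots> = e2 \<cdot> (z2 \<cdot> (e \<cdot> s))"
      using Comp_assoc[OF es jd'(2) jd2'(1)] eqs2(1) Comp_assoc[OF es zc2'(1) e2'(2)] by simp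
    finally have "e2 \<cdot> Add C (z2 \<cdot> (e \<cdot> s)) t = f"
      using Comp_Add_right[OF zes t(1) e2'(2)] Sub_Add[OF f et] by simp
    then show "\<exists>t\<in>Hom C X I2. e2 \<cdot> t = f" using Add_Hom[OF zes t(1)] by blast
  qed
  then show ?thesis using ext_vanishes_one_iff[OF e2 I2 X] by simp
qed

text \<open>
  Rotating \<open>0 \<rightarrow> Y \<rightarrow> Z \<rightarrow> Q \<rightarrow> 0\<close> to \<open>0 \<rightarrow> Q \<rightarrow> \<Sigma>Y \<rightarrow> \<Sigma>Z \<rightarrow> 0\<close> reduces exactness at the middle in degree
  \<open>i + 1\<close> to exactness at the right end in degree \<open>i\<close>, and rotating twice does the converse. Hence
  both are proved by one induction.
\<close>

lemma ext_vanishes_middle_right: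
  assumes X: "X \<in> Obj C"
  shows "short_exact k p Y Z Q \<Longrightarrow>
      (ext_vanishes C (Suc i) {X} {Y} \<and> ext_vanishes C (Suc i) {X} {Q} \<longrightarrow> ext_vanishes C (Suc i) {X} {Z}) \<and>
      (ext_vanishes C (Suc i) {X} {Z} \<and> ext_vanishes C (Suc (Suc i)) {X} {Y} \<longrightarrow> ext_vanishes C (Suc i) {X} {Q})"
proof (induction i arbitrary: k p Y Z Q)
  case 0
  then show ?case using ext_vanishes_middle_one[OF _ X] ext_vanishes_right_one[OF _ X] by blast
next
  case (Suc i)
  obtain I z c D e S j d where I: "injective_object C I" and zc: "short_exact z c Z I D"
    and e: "short_exact (z \<cdot> k) e Y I S" and jd: "short_exact j d Q S D"
    using rotation_injective[OF Suc.prems] by metis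
  obtain I2 z2 c2 D2 e2 S2 j2 d2 where I2: "injective_object C I2" and zc2: "short_exact z2 c2 S I2 D2"
    and e2: "short_exact (z2 \<cdot> j) e2 Q I2 S2" and jd2: "short_exact j2 d2 D S2 D2"
    using rotation_injective[OF jd] by metis
  note sZ = ext_vanishes_shift[OF zc I X] and sY = ext_vanishes_shift[OF e I X]
    and sS = ext_vanishes_shift[OF zc2 I2 X] and sQ = ext_vanishes_shift[OF e2 I2 X]
  \<comment> \<open>Middle: Ext into \<open>S\<close> vanishes in degree \<open>i + 1\<close> and
    into \<open>Q\<close> in degree \<open>i + 2\<close>, so the right-end clause for
    \<open>jd\<close> gives \<open>D\<close> in degree \<open>i + 1\<close>. Right end: Ext into
    \<open>D\<close> and into \<open>D2\<close>, the cosyzygy of \<open>S\<close>, vanishes in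
    degree \<open>i + 1\<close>, so the middle clause for \<open>jd2\<close> gives
    \<open>S2\<close>, hence \<open>Q\<close> in degree \<open>i + 2\<close>.\<close>
  show ?case
    using Suc.IH[OF jd] Suc.IH[OF jd2] sZ sY sS sQ by blast
qed

text \<open>Cuts at the image of \<open>f1\<close>: its epic part \<open>e\<close> completes a short
  exact sequence, and its monic part \<open>m\<close> starts the rest.\<close>

lemma exact_sequence_uncons:
  assumes "exact_sequence C (f # f1 # fs)"
  obtains e m Z where "short_exact f e (Dom C f) (Dom C f1) Z" "exact_sequence C (m # fs)"
    "Dom C m = Z" "Cod C (last (m # fs)) = Cod C (last (f1 # fs))"
proof -
  have s: "monic C f" "exact_at C f f1" "successively (exact_at C) (f1 # fs)" "epic C (last (f1 # fs))"
    using assms by (auto simp: exact_sequence_iff)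
  note a = exact_at_Arr[OF s(2)]
  have f: "f \<in> Hom C (Dom C f) (Dom C f1)" and f1: "f1 \<in> Hom C (Dom C f1) (Cod C f1)"
    using a by (simp_all add: Hom_def)
  obtain Z e m where em: "e \<in> Hom C (Dom C f1) Z" "m \<in> Hom C Z (Cod C f1)" "epic C e" "monic C m" "m \<cdot> e = f1"
    using epic_mono_factorization[OF f1] .
  have ef: "e \<cdot> f \<in> Hom C (Dom C f) Z" using Comp_Hom[OF f em(1)] .
  have fO: "Dom C f \<in> Obj C" using Hom_Obj[OF f] by simp
  have "m \<cdot> (e \<cdot> f) = Zero C (Dom C f) (Cod C f1)"
    using Comp_assoc[OF f em(1,2)] em(5) exact_at_Comp[OF s(2)] by simp
  then have ef0: "e \<cdot> f = Zero C (Dom C f) Z"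
    using monic_Zero[OF em(4), unfolded HomD(2,3)[OF em(2)], OF ef] by simp
  have se: "short_exact f e (Dom C f) (Dom C f1) Z"
  proof (rule short_exactI[OF f em(1) s(1) em(3) ef0])
    fix W x assume x: "x \<in> Hom C W (Dom C f1)" "e \<cdot> x = Zero C W Z"
    have "f1 \<cdot> x = Zero C W (Cod C f1)"
      using em(5) Comp_assoc[OF x(1) em(1,2)] x(2) Comp_Zero(1)[OF em(2)] Hom_Obj[OF x(1)] by simp
    then show "\<exists>u\<in>Hom C W (Dom C f). f \<cdot> u = x"
      using exact_at_monic_factor[OF s(2,1) f f1 x(1)] by blast
  qed
  have last: "epic C (last (m # fs))" "Cod C (last (m # fs)) = Cod C (last (f1 # fs))"
  proof -
    \<comment> \<open>Here \<open>m\<close> is the whole rest, an isomorphism.\<close>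
    have "epic C m" if "fs = []"
    proof (rule epicI[OF em(2)])
      fix W x assume x: "x \<in> Hom C (Cod C f1) W" "x \<cdot> m = Zero C Z W"
      have "x \<cdot> f1 = Zero C (Dom C f1) W"
        using em(5) Comp_assoc[OF em(1,2) x(1)] x(2) Comp_Zero(2)[OF em(1)] Hom_Obj[OF x(1)] by simp
      then show "x = Zero C (Cod C f1) W" using epic_Zero[OF _ x(1)] s(4) that by simp
    qed
    then show "epic C (last (m # fs))" "Cod C (last (m # fs)) = Cod C (last (f1 # fs))"
      using s(4) HomD(3)[OF em(2)] by (cases fs; simp)+
  qed
  have "exact_at C m g" if eg: "exact_at C f1 g" for g
  proof -
    note ga = exact_at_Arr[OF eg]
    have g: "g \<in> Hom C (Cod C f1) (Cod C g)" using ga by (simp add: Hom_def)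
    have gm: "g \<cdot> m \<in> Hom C Z (Cod C g)" using Comp_Hom[OF em(2) g] .
    show ?thesis
    proof (rule exact_atI[OF em(2) g])
      have "(g \<cdot> m) \<cdot> e = Zero C (Dom C f1) (Cod C g)"
        using Comp_assoc[OF em(1,2) g] em(5) exact_at_Comp[OF eg] by simp
      then show "g \<cdot> m = Zero C Z (Cod C g)"
        using epic_Zero[OF em(3), unfolded HomD(2,3)[OF em(1)], OF gm] by simp
      fix V W c x
      assume c: "c \<in> Hom C (Cod C f1) V" "c \<cdot> m = Zero C Z V"
        and x: "x \<in> Hom C W (Cod C f1)" "g \<cdot> x = Zero C W (Cod C g)"
      have "c \<cdot> f1 = Zero C (Dom C f1) V"
        using em(5) Comp_assoc[OF em(1,2) c(1)] c(2) Comp_Zero(2)[OF em(1)] Hom_Obj[OF c(1)] by simp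
      then show "c \<cdot> x = Zero C W V" using exact_at_test[OF eg f1 g x c(1)] by simp
    qed
  qed
  then have "successively (exact_at C) (m # fs)" using s(3) by (cases fs) auto
  then have "exact_sequence C (m # fs)" using em(4) last(1) by (simp add: exact_sequence_iff)
  then show ?thesis using that[OF se _ HomD(2)[OF em(2)]] last(2) by blast
qed

text \<open>Each step replaces the first two objects by the syzygy \<open>Z\<close>, and the
  right-end fragment lowers the degree by one. Of such a syzygy vanishing is known in this one
  degree only, hence the separate hypothesis on the head of \<open>fs\<close>.\<close>

lemma ext_vanishes_resolution:
  assumes X: "X \<in> Obj C"
  shows "exact_sequence C fs \<Longrightarrow> length fs = Suc d \<Longrightarrow> ext_vanishes C (Suc d) {X} {Dom C (hd fs)} \<Longrightarrow>
    (\<And>f i. f \<in> set (tl fs) \<Longrightarrow> Suc i \<le> d \<Longrightarrow> ext_vanishes C (Suc i) {X} {Dom C f}) \<Longrightarrow>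
    ext_vanishes C (Suc 0) {X} {Cod C (last fs)}"
proof (induction d arbitrary: fs)
  case 0
  then obtain f where fs: "fs = [f]" by (auto simp: length_Suc_conv)
  then have "[f] \<in> extensions C 0 (Cod C f) (Dom C f)" using 0 by (simp add: extensions_def)
  then show ?case using ext_vanishes_iso[OF _ X] 0 fs by simp
next
  case (Suc d)
  obtain f f1 fs' where fs: "fs = f # f1 # fs'" using Suc.prems(2) by (auto simp: length_Suc_conv)
  obtain e m Z where em: "short_exact f e (Dom C f) (Dom C f1) Z" "exact_sequence C (m # fs')"
    "Dom C m = Z" "Cod C (last (m # fs')) = Cod C (last (f1 # fs'))"
    using exact_sequence_uncons Suc.prems(1) fs by metis
  have "ext_vanishes C (Suc d) {X} {Dom C f1}" "ext_vanishes C (Suc (Suc d)) {X} {Dom C f}"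
    using Suc.prems(3) Suc.prems(4)[of f1 d] fs by simp_all
  then have "ext_vanishes C (Suc d) {X} {Z}" using ext_vanishes_middle_right[OF X em(1)] by blast
  then have "ext_vanishes C (Suc 0) {X} {Cod C (last (m # fs'))}"
    using Suc.IH[OF em(2)] Suc.prems(2,4) fs em(3) by simp
  then show ?case using em(4) fs by simp
qed

section \<open>Vanishing on the resolution class\<close>

lemma ext_vanishesI:
  "(\<And>X Y. X \<in> \<A> \<Longrightarrow> Y \<in> \<B> \<Longrightarrow> ext_vanishes C i {X} {Y}) \<Longrightarrow> ext_vanishes C i \<A> \<B>"
  by (simp add: ext_vanishes_def)

lemma ext_vanishesD:
  "ext_vanishes C i \<A> \<B> \<Longrightarrow> X \<in> \<A> \<Longrightarrow> Y \<in> \<B> \<Longrightarrow> ext_vanishes C i {X} {Y}"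
  by (simp add: ext_vanishes_def)

lemma left_perp_iff:
  "X \<in> left_perp C i \<B> \<longleftrightarrow> X \<in> Obj C \<and> (\<forall>Y\<in>\<B>. ext_vanishes C i {X} {Y})"
  by (auto simp: left_perp_def ext_vanishes_def)

lemma resolution_class_Obj: "resolution_class C \<B> m \<subseteq> Obj C"
  using Cod_Obj[OF epic_Arr] by (auto simp: resolution_class_def exact_sequence_iff)

lemma ext_vanishes_resolution_class_iff:
  assumes A: "\<A> \<subseteq> Obj C" and B: "\<B> \<subseteq> Obj C" and inj: "{I. injective_object C I} \<subseteq> \<B>"
  shows "ext_vanishes C (Suc 0) \<A> (resolution_class C \<B> m) \<longleftrightarrow>
    (\<forall>i\<le>m. ext_vanishes C (Suc i) \<A> \<B>)"
proof
  assume v: "ext_vanishes C (Suc 0) \<A> (resolution_class C \<B> m)"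
  have "ext_vanishes C (Suc i) {X} {Y}" if i: "i \<le> m" and X: "X \<in> \<A>" and Y: "Y \<in> \<B>" for i X Y
  proof -
    have O: "X \<in> Obj C" "Y \<in> Obj C" using A B X Y by auto
    obtain Z hs where hs: "hs \<in> extensions C i Z Y" "\<forall>h\<in>set (tl hs). injective_object C (Dom C h)"
      using injective_coresolution_exists[OF O(2)] by blast
    obtain k e I S where ke: "short_exact k e Z I S" and I: "injective_object C I"
      using injective_embedding[OF extensions_Obj(1)[OF hs(1)]] .
    \<comment> \<open>The domains are \<open>Y\<close> and the injective terms, so \<open>hs\<close>
      is itself a resolution of \<open>Z\<close>, with \<open>i + 1 \<le> m + 1\<close>
      terms.\<close>
    have "\<forall>h\<in>set hs. Dom C h \<in> \<B>"
      using hs inj Y by (cases hs) (auto simp: extensions_def exact_sequence_def)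
    then have "Z \<in> resolution_class C \<B> m"
      using hs(1) i unfolding resolution_class_def extensions_def by auto
    then have "ext_vanishes C (Suc 0) {X} {Z}" by (rule ext_vanishesD[OF v X])
    then show ?thesis
      using ext_vanishes_one_iff[OF ke I O(1)] ext_vanishes_iff_lifts[OF hs ke I O(1)] by simp
  qed
  then show "\<forall>i\<le>m. ext_vanishes C (Suc i) \<A> \<B>" using ext_vanishesI by simp
next
  assume v: "\<forall>i\<le>m. ext_vanishes C (Suc i) \<A> \<B>"
  have "ext_vanishes C (Suc 0) {X} {K}" if X: "X \<in> \<A>" and K: "K \<in> resolution_class C \<B> m" for X K
  proof -
    have v': "ext_vanishes C (Suc i) {X} {Y}" if "i \<le> m" "Y \<in> \<B>" for i Y
      using ext_vanishesD[OF _ X that(2)] v that(1) by simp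
    obtain fs where fs: "exact_sequence C fs" "length fs \<le> Suc m" "\<forall>f\<in>set fs. Dom C f \<in> \<B>"
        "Cod C (last fs) = K"
      using K by (auto simp: resolution_class_def)
    have fs0: "fs \<noteq> []" using fs(1) by (simp add: exact_sequence_def)
    then obtain d where d: "length fs = Suc d" by (cases fs) auto
    have "ext_vanishes C (Suc 0) {X} {Cod C (last fs)}"
    proof (rule ext_vanishes_resolution[OF _ fs(1) d])
      show "X \<in> Obj C" using X A by blast
      show "ext_vanishes C (Suc d) {X} {Dom C (hd fs)}" using v' d fs fs0 by simp
      show "ext_vanishes C (Suc i) {X} {Dom C f}" if "f \<in> set (tl fs)" "Suc i \<le> d" for f i
        using v' that d fs list.set_sel(2)[OF fs0] by simp
    qed
    then show ?thesis using fs(4) by simp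
  qed
  then show "ext_vanishes C (Suc 0) \<A> (resolution_class C \<B> m)" by (rule ext_vanishesI)
qed

section \<open>Cotorsion pairs\<close>

text \<open>To lift an arrow out of \<open>X\<close>, lift its composite with the projection
  \<open>p1\<close> out of \<open>A\<close> and restrict along \<open>i1\<close>.\<close>

lemma left_perp_closed_under_summands:
  assumes D: "\<D> \<subseteq> Obj C"
  shows "closed_under_summands C (left_perp C (Suc 0) \<D>)"
  unfolding closed_under_summands_def
proof safe
  fix A X Y i1 i2 p1 p2
  assume A: "A \<in> left_perp C (Suc 0) \<D>" and X: "X \<in> Obj C" and b: "is_biproduct C X Y A i1 i2 p1 p2"
  have i: "i1 \<in> Hom C X A" "p1 \<in> Hom C A X" "p1 \<cdot> i1 = Id C X" using b by (auto simp: is_biproduct_def)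
  have AO: "A \<in> Obj C" using A by (simp add: left_perp_iff)
  have "ext_vanishes C (Suc 0) {X} {K}" if K: "K \<in> \<D>" for K
  proof -
    obtain k e I S where ke: "short_exact k e K I S" and I: "injective_object C I"
      using injective_embedding K D by blast
    note ke' = short_exactD[OF ke]
    have "ext_vanishes C (Suc 0) {A} {K}" using A K by (simp add: left_perp_iff)
    then have l: "lifts A e" using ext_vanishes_one_iff[OF ke I AO] by simp
    have "lifts X e"
    proof (rule liftsI[OF ke'(2)])
      fix f assume f: "f \<in> Hom C X S"
      obtain t where t: "t \<in> Hom C A I" "e \<cdot> t = f \<cdot> p1" using liftsD[OF l ke'(2) Comp_Hom[OF i(2) f]] .
      have "e \<cdot> (t \<cdot> i1) = f"
        using Comp_assoc[OF i(1) t(1) ke'(2)] t(2) Comp_assoc[OF i(1,2) f] i(3) Comp_Id_right[OF f] by simp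
      then show "\<exists>t\<in>Hom C X I. e \<cdot> t = f" using Comp_Hom[OF i(1) t(1)] by blast
    qed
    then show ?thesis using ext_vanishes_one_iff[OF ke I X] by simp
  qed
  then show "X \<in> left_perp C (Suc 0) \<D>" using X by (simp add: left_perp_iff)
qed

text \<open>The retraction \<open>r\<close> is the identity minus \<open>s \<cdot> p\<close>,
  factored through the kernel \<open>k\<close>. \<open>X\<close> comes first because
  \<open>closed_under_summands\<close> speaks of the first factor.\<close>

lemma split_biproduct:
  assumes kp: "short_exact k p K A X" and s: "s \<in> Hom C X A" "p \<cdot> s = Id C X"
  obtains r where "is_biproduct C X K A s k p r"
proof -
  note kp' = short_exactD[OF kp]
  have IA: "Id C A \<in> Hom C A A" using Id_Hom kp' by simp
  have sp: "s \<cdot> p \<in> Hom C A A" using Comp_Hom[OF kp'(2) s(1)] .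
  have u: "Sub (Id C A) (s \<cdot> p) \<in> Hom C A A" using Sub_Hom[OF IA sp] .
  have "p \<cdot> (s \<cdot> p) = p \<cdot> Id C A"
    using Comp_assoc[OF kp'(2) s(1) kp'(2)] s(2) Comp_Id_left[OF kp'(2)] Comp_Id_right[OF kp'(2)] by simp
  then have "p \<cdot> Sub (Id C A) (s \<cdot> p) = Zero C A X"
    using Comp_Sub[OF IA sp kp'(2)] Sub_eq_Zero[OF Comp_Hom[OF IA kp'(2)] Comp_Hom[OF sp kp'(2)]] by simp
  then obtain r where r: "r \<in> Hom C A K" "k \<cdot> r = Sub (Id C A) (s \<cdot> p)"
    using short_exact_kernel_factor[OF kp u] by blast
  have sum: "Add C (s \<cdot> p) (k \<cdot> r) = Id C A"
    using r(2) Sub_Add[OF IA sp] Add_commute[OF sp u] by simp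
  have kx: "k \<cdot> x = k \<cdot> y \<Longrightarrow> x = y" if "x \<in> Hom C W K" "y \<in> Hom C W K" for x y W
    using monic_cancel[OF kp'(3), unfolded HomD(2)[OF kp'(1)], OF that] .
  have pk: "s \<cdot> (p \<cdot> k) = Zero C K A" using kp'(6) Comp_Zero(1)[OF s(1) kp'(7)] by simp
  have "k \<cdot> (r \<cdot> k) = Sub k (Zero C K A)"
    using Comp_assoc[OF kp'(1) r(1) kp'(1)] r(2) Sub_Comp[OF kp'(1) IA sp] Comp_Id_left[OF kp'(1)]
      Comp_assoc[OF kp'(1,2) s(1)] pk by simp
  also have "\<dots> = k"
    using Sub_unique[OF kp'(1) Zero_Hom[OF kp'(7,8)] kp'(1)] Add_Zero(1)[OF kp'(1)] by simp
  finally have rk: "r \<cdot> k = Id C K"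
    using kx[OF Comp_Hom[OF kp'(1) r(1)] Id_Hom[OF kp'(7)]] Comp_Id_right[OF kp'(1)] by simp
  have "k \<cdot> (r \<cdot> s) = Sub s s"
    using Comp_assoc[OF s(1) r(1) kp'(1)] r(2) Sub_Comp[OF s(1) IA sp] Comp_Id_left[OF s(1)]
      Comp_assoc[OF s(1) kp'(2) s(1)] s(2) Comp_Id_right[OF s(1)] by simp
  also have "\<dots> = k \<cdot> Zero C X K"
    using Sub_eq_Zero[OF s(1) s(1)] Comp_Zero(1)[OF kp'(1,9)] by simp
  finally have rs: "r \<cdot> s = Zero C X K"
    using kx[OF Comp_Hom[OF s(1) r(1)] Zero_Hom[OF kp'(9,7)]] by simp
  show ?thesis
    using that[of r] kp'(1,2,6) s r(1) sum rk rs by (simp add: is_biproduct_def)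
qed

text \<open>The right side has the shape of a left \<open>n\<close>-cotorsion pair, with degree 1
  into \<open>\<D>\<close> in place of degrees up to \<open>n\<close> into \<open>\<B>\<close>. For
  the resolution class the two notions thus differ only by the equivalence on Ext.\<close>

lemma complete_left_cotorsion_pair_iff:
  assumes A: "\<A> \<subseteq> Obj C" and D: "\<D> \<subseteq> Obj C"
  shows "complete_left_cotorsion_pair C \<A> \<D> \<longleftrightarrow>
    closed_under_summands C \<A> \<and> ext_vanishes C (Suc 0) \<A> \<D> \<and>
    (\<forall>X\<in>Obj C. \<exists>k p. exact_sequence C [k, p] \<and> Dom C k \<in> \<D> \<and> Dom C p \<in> \<A> \<and> Cod C p = X)"
proof
  assume c: "complete_left_cotorsion_pair C \<A> \<D>"
  then have Ap: "\<A> = left_perp C (Suc 0) \<D>" by (simp add: complete_left_cotorsion_pair_def)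
  have "\<exists>k p. exact_sequence C [k, p] \<and> Dom C k \<in> \<D> \<and> Dom C p \<in> \<A> \<and> Cod C p = X"
    if XO: "X \<in> Obj C" for X
  proof -
    obtain p k where p: "is_precover C \<A> X p" "epic C p" "is_kernel C k p" "Dom C k \<in> \<D>"
      using c XO unfolding complete_left_cotorsion_pair_def by blast
    have pH: "p \<in> Hom C (Dom C p) X" "Dom C p \<in> \<A>" using p(1) by (auto simp: is_precover_def Hom_def)
    have "[k, p] \<in> extensions C (Suc 0) X (Dom C k)"
      using kernel_short_exact[OF p(3,2) pH(1)] short_exact_extensions by blast
    then show ?thesis using p(4) pH by (auto simp: extensions_def)
  qed
  moreover have "ext_vanishes C (Suc 0) \<A> \<D>"
    by (rule ext_vanishesI) (simp add: Ap left_perp_iff)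
  ultimately show "closed_under_summands C \<A> \<and> ext_vanishes C (Suc 0) \<A> \<D> \<and>
    (\<forall>X\<in>Obj C. \<exists>k p. exact_sequence C [k, p] \<and> Dom C k \<in> \<D> \<and> Dom C p \<in> \<A> \<and> Cod C p = X)"
    using left_perp_closed_under_summands[OF D] Ap by blast
next
  assume R: "closed_under_summands C \<A> \<and> ext_vanishes C (Suc 0) \<A> \<D> \<and>
    (\<forall>X\<in>Obj C. \<exists>k p. exact_sequence C [k, p] \<and> Dom C k \<in> \<D> \<and> Dom C p \<in> \<A> \<and> Cod C p = X)"
  have ex: "\<exists>k p K Z. short_exact k p K Z X \<and> K \<in> \<D> \<and> Z \<in> \<A>" if XO: "X \<in> Obj C" for X
  proof -
    obtain k p where kp: "exact_sequence C [k, p]" "Dom C k \<in> \<D>" "Dom C p \<in> \<A>" "Cod C p = X"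
      using R XO by blast
    then have "[k, p] \<in> extensions C (Suc 0) X (Dom C k)" by (simp add: extensions_def)
    then obtain Z where Z: "short_exact k p (Dom C k) Z X" using short_exact_extensions by blast
    then show ?thesis using kp HomD(2)[OF short_exactD(2)[OF Z]] by blast
  qed
  have "\<A> = left_perp C (Suc 0) \<D>"
  proof
    show "\<A> \<subseteq> left_perp C (Suc 0) \<D>"
      using A ext_vanishesD[of "Suc 0" \<A> \<D>] R by (auto simp: left_perp_iff)
    show "left_perp C (Suc 0) \<D> \<subseteq> \<A>"
    proof
      fix X assume X: "X \<in> left_perp C (Suc 0) \<D>"
      then have XO: "X \<in> Obj C" by (simp add: left_perp_iff)
      obtain k p K Z where kp: "short_exact k p K Z X" "K \<in> \<D>" "Z \<in> \<A>" using ex[OF XO] by blast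
      note kp' = short_exactD[OF kp(1)]
      \<comment> \<open>The sequence given for \<open>X\<close> splits, which makes \<open>X\<close>
        a summand of \<open>Z\<close>.\<close>
      have "ext_vanishes C (Suc 0) {X} {K}" using X kp(2) by (simp add: left_perp_iff)
      then have "lifts X p" using ext_vanishes_imp_lifts[OF kp(1) XO] by blast
      then obtain s where s: "s \<in> Hom C X Z" "p \<cdot> s = Id C X"
        using liftsD[OF _ kp'(2) Id_Hom[OF XO]] by blast
      obtain r where "is_biproduct C X K Z s k p r" using split_biproduct[OF kp(1) s] .
      then show "X \<in> \<A>" using R kp(3) XO kp'(7) unfolding closed_under_summands_def by blast
    qed
  qed
  moreover have "\<exists>p k. is_precover C \<A> X p \<and> epic C p \<and> is_kernel C k p \<and> Dom C k \<in> \<D>"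
    if XO: "X \<in> Obj C" for X
  proof -
    obtain k p K Z where kp: "short_exact k p K Z X" "K \<in> \<D>" "Z \<in> \<A>" using ex[OF XO] by blast
    note kp' = short_exactD[OF kp(1)]
    \<comment> \<open>Lifting along \<open>p\<close> is the precover property; the kernel of
      \<open>p\<close> lies in \<open>\<D>\<close>.\<close>
    have "lifts A' p" if "A' \<in> \<A>" for A'
      using ext_vanishes_imp_lifts[OF kp(1)] ext_vanishesD[OF _ that kp(2)] R that A by blast
    then have "is_precover C \<A> X p"
      using kp(3) HomD[OF kp'(2)] by (auto simp: is_precover_def lifts_def)
    moreover have "is_kernel C k p"
      by (rule is_kernelI[OF kp'(1,2,3,6)]) (rule short_exact_kernel_factor[OF kp(1)], auto)
    ultimately show ?thesis using kp'(4) kp(2) HomD(2)[OF kp'(1)] by blast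
  qed
  ultimately show "complete_left_cotorsion_pair C \<A> \<D>"
    by (simp add: complete_left_cotorsion_pair_def)
qed

end

theorem proposition2p5:
  fixes C :: "('o, 'a, 'm) precat_scheme"
    and \<A> \<B> :: "'o set"
    and n :: nat
  assumes "n \<ge> 1"
    and "abelian_category C"
    and "enough_injectives C"
    and "\<A> \<subseteq> Obj C"
    and "\<B> \<subseteq> Obj C"
    and "{I. injective_object C I} \<subseteq> \<B>"
  shows "(ext_vanishes C 1 \<A> (resolution_class C \<B> (n - 1)) \<longleftrightarrow>
            (\<forall>i\<in>{1..n}. ext_vanishes C i \<A> \<B>)) \<and>
         (complete_left_cotorsion_pair C \<A> (resolution_class C \<B> (n - 1)) \<longleftrightarrow>
            left_n_cotorsion_pair C n \<A> \<B>)"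
proof -
  interpret abelian_category_enough_injectives C
    using assms by (simp add: abelian_category_enough_injectives_def
        abelian_category_enough_injectives_axioms_def)
  obtain m where n: "n = Suc m" using assms(1) by (cases n) auto
  \<comment> \<open>Degrees from \<open>1\<close> to \<open>n\<close> are the \<open>Suc i\<close>
    with \<open>i \<le> m\<close>, where \<open>m = n - 1\<close>.\<close>
  have "(\<forall>i\<in>{1..n}. P i) \<longleftrightarrow> (\<forall>i\<le>m. P (Suc i))" for P
    unfolding n by (auto simp: Ball_def) (metis Suc_le_D Suc_le_mono)
  then have iff: "ext_vanishes C 1 \<A> (resolution_class C \<B> (n - 1)) \<longleftrightarrow>
      (\<forall>i\<in>{1..n}. ext_vanishes C i \<A> \<B>)"
    using ext_vanishes_resolution_class_iff[OF assms(4-6), of m] n by simp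
  then show ?thesis
    using complete_left_cotorsion_pair_iff[OF assms(4) resolution_class_Obj, of \<B> "n - 1"]
    unfolding left_n_cotorsion_pair_def by simp
qed

end
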